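(* Let $B$ be a commutative separable complex $C^*$-algebra with self-adjoint part $B^{sa}$, let $\mathfrak X$ be a separable real normed vector space, let $\mathfrak Y\subseteq\mathfrak X$ be a closed linear subspace, and let $\phi:\mathfrak Y\to B^{sa}$ be a bounded $\mathbb R$-linear map. Let $m:\mathfrak X\to C_B$ be a $C_B$-valued seminorm which dominates $\phi$ and is locally balanced for $\phi$. Then for every $\delta>0$ there exists an $\mathbb R$-linear map $\widetilde\phi:\mathfrak X\to B^{sa}$ with $\widetilde\phi|_{\mathfrak Y}=\phi$ such that $$|\widetilde\phi(x)(t)|\ \le\ m(x)(t)+\delta\,\|x\|\qquad\text{for all } x\in\mathfrak X \text{ and all } t\in \mathrm{Spec}\,B .$$
   Context: Elements of $B$ are identified with continuous functions on the spectrum $\mathrm{Spec}\,B$ (a locally compact Hausdorff space) vanishing at infinity, via the Gelfand transform. $C_B$ denotes the cone of positive (i.e. nonnegative, real-valued) lower semicontinuous functions on $\mathrm{Spec}\,B$; as a convention, a function on $\mathrm{Spec}\,B$, continuous or semicontinuous, is always meant to be arbitrarily small outside some compact subset. A $C_B$-valued seminorm on $\mathfrak X$ is a map $m:\mathfrak X\to C_B$ with $m(x+y)\le m(x)+m(y)$ and $m(ax)=|a|\,m(x)$ for all $x,y\in\mathfrak X$, $a\in\mathbb R$ (inequalities are pointwise on $\mathrm{Spec}\,B$). $m$ dominates $\phi$ if $|\phi(y)(t)|\le m(y)(t)$ for all $y\in\mathfrak Y$, $t\in\mathrm{Spec}\,B$. A seminorm $m$ dominates another seminorm $m'$ if $m'(x)(t)\le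 m(x)(t)$ for all $x\in\mathfrak X$ and all $t$. Locally finite: a $C_B$-valued seminorm $m$ on $\mathfrak X$ is locally finite with respect to the closed subspace $\mathfrak Y\subseteq\mathfrak X$ if $m$ is bounded in norm (there is a constant $c$ with $\sup_t m(x)(t)\le c\|x\|$ for all $x\in\mathfrak X$) and there exists a complementary linear subspace $\mathfrak Y^c\subseteq\mathfrak X$ (so $\mathfrak Y\cap\mathfrak Y^c=\{0\}$) with $\overline{\mathfrak Y+\mathfrak Y^c}=\mathfrak X$ such that for each $t_0\in\mathrm{Spec}\,B$ at least one of the following two conditions holds: (i) for every $x\in\mathfrak Y^c$ and $\epsilon>0$ there is a neighbourhood $\mathcal U_{x,\epsilon}(t_0)$ of $t_0$ such that $m(x)(t)<\epsilon$ for all $t\in\mathcal U_{x,\epsilon}(t_0)$ (in particular $m(x)(t_0)=0$ for all $x\in\mathfrak Y^c$); (ii) there exist a finite-dimensional subspace $\mathfrak F\subseteq\mathfrak Y$, a complementary subspace $\mathfrak L\subseteq\mathfrak Y$ with $\mathfrak F+\mathfrak L=\mathfrak Y$ (and $\mathfrak F\cap\mathfrak L=\{0\}$), and a neighbourhood $\mathcal U(t_0)$ of $t_0$ such that $m(y)(t)=0$ for all $y\in\mathfrak L$ and all $t\in\mathcal U(t_0)$. Balanced: a $C_B$-valued seminorm $m$ on $\mathfrak X$ dominating $\phi$ is balanced for $\phi$ if $m$ dominates another seminorm $m'$ on $\mathfrak X$ which is locally finite with respect to $\mathfrak Y$ and which dominates $\phi$. Locally balanced: a $C_B$-valued seminorm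 $m$ on $\mathfrak X$ dominating $\phi$ is locally balanced for $\phi$ if for every $t\in\mathrm{Spec}\,B$ there is a neighbourhood $\mathcal V(t)$ of $t$ such that $m|_{\mathcal V(t)}$ is balanced for $\phi|_{\mathcal V(t)}$. Here $m|_{\mathcal V(t)}$ and $\phi|_{\mathcal V(t)}$ are obtained by restricting the function values $m(x)$, $\phi(y)$ to $\mathcal V(t)$, and the definitions of dominating, locally finite and balanced are applied with functions on $\mathcal V(t)$ and points of $\mathcal V(t)$ in place of functions on $\mathrm{Spec}\,B$ and points of $\mathrm{Spec}\,B$. *)

theory Defs
  imports "HOL-Analysis.Analysis"
begin

text \<open>
  Complex \<open>C\<^sup>*\<close>-algebras, not assumed to be unital. The real scalar multiplication of the
  underlying real Banach algebra is the restriction of \<open>scaleC\<close>.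
\<close>

class cstar_algebra = real_normed_algebra + banach +
  fixes scaleC :: "complex \<Rightarrow> 'a \<Rightarrow> 'a"
    and star :: "'a \<Rightarrow> 'a"
  assumes scaleC_add_right: "scaleC c (x + y) = scaleC c x + scaleC c y"
    and scaleC_add_left: "scaleC (c + d) x = scaleC c x + scaleC d x"
    and scaleC_scaleC: "scaleC c (scaleC d x) = scaleC (c * d) x"
    and scaleC_of_real: "scaleC (complex_of_real r) x = r *\<^sub>R x"
    and mult_scaleC_left: "scaleC c x * y = scaleC c (x * y)"
    and mult_scaleC_right: "x * scaleC c y = scaleC c (x * y)"
    and norm_scaleC: "norm (scaleC c x) = cmod c * norm x"
    and star_star: "star (star x) = x"
    and star_add: "star (x + y) = star x + star y"
    and star_scaleC: "star (scaleC c x) = scaleC (cnj c) (star x)"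
    and star_mult: "star (x * y) = star y * star x"
    and cstar_identity: "norm (star x * x) = (norm x)\<^sup>2"

class comm_cstar_algebra = cstar_algebra + comm_ring

definition self_adjoint :: "'b::cstar_algebra set" where
  "self_adjoint = {b. star b = b}"

text \<open>
  The spectrum consists of the nonzero characters; they are automatically continuous. Its topology
  is \<^term>\<open>top_of_set spectrum\<close>, the subspace topology of the product topology on the function
  type, i.e. the topology of pointwise convergence (the weak-star topology).
\<close>

definition spectrum :: "('b::comm_cstar_algebra \<Rightarrow> complex) set" where
  "spectrum = {t. (\<exists>b. t b \<noteq> 0) \<and> (\<forall>a b. t (a + b) = t a + t b) \<and>
     (\<forall>c b. t (scaleC c b) = c * t b) \<and> (\<forall>a b. t (a * b) = t a * t b)}"

definition gelfand :: "'b::comm_cstar_algebra \<Rightarrow> ('b \<Rightarrow> complex) \<Rightarrow> complex" where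
  "gelfand b t = t b"

definition neighbourhood_in :: "'p::topological_space set \<Rightarrow> 'p \<Rightarrow> 'p set \<Rightarrow> bool" where
  "neighbourhood_in S t U \<longleftrightarrow>
     U \<subseteq> S \<and> (\<exists>W. openin (top_of_set S) W \<and> t \<in> W \<and> W \<subseteq> U)"

definition lower_semicontinuous_on ::
    "'p::topological_space set \<Rightarrow> ('p \<Rightarrow> real) \<Rightarrow> bool" where
  "lower_semicontinuous_on S f \<longleftrightarrow> (\<forall>a. openin (top_of_set S) {t \<in> S. a < f t})"

text \<open>
  In what follows \<open>S\<close> is the whole spectrum or a neighbourhood in it; only the values of functions
  on \<open>S\<close> matter, so restricting to a subset amounts to changing \<open>S\<close>. The compact set outside of
  which a function is small may be any compact subset of the spectrum, also when \<open>S\<close> is smaller.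
  With this reading the restriction to \<open>S\<close> of a function in \<open>cone spectrum\<close> is always in
  \<open>cone S\<close>.
\<close>

definition cone ::
    "('b::comm_cstar_algebra \<Rightarrow> complex) set \<Rightarrow> (('b \<Rightarrow> complex) \<Rightarrow> real) set" where
  "cone S = {f. (\<forall>t\<in>S. 0 \<le> f t) \<and> lower_semicontinuous_on S f \<and>
     (\<forall>\<epsilon>>0. \<exists>K. compact K \<and> K \<subseteq> spectrum \<and> (\<forall>t\<in>S - K. f t < \<epsilon>))}"

definition cone_seminorm ::
    "('b::comm_cstar_algebra \<Rightarrow> complex) set \<Rightarrow>
     ('x::real_normed_vector \<Rightarrow> ('b \<Rightarrow> complex) \<Rightarrow> real) \<Rightarrow> bool" where
  "cone_seminorm S m \<longleftrightarrow>
     (\<forall>x. m x \<in> cone S) \<and>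
     (\<forall>x y. \<forall>t\<in>S. m (x + y) t \<le> m x t + m y t) \<and>
     (\<forall>a x. \<forall>t\<in>S. m (a *\<^sub>R x) t = \<bar>a\<bar> * m x t)"

definition dominates_map ::
    "('b::comm_cstar_algebra \<Rightarrow> complex) set \<Rightarrow>
     ('x::real_normed_vector \<Rightarrow> ('b \<Rightarrow> complex) \<Rightarrow> real) \<Rightarrow> 'x set \<Rightarrow> ('x \<Rightarrow> 'b) \<Rightarrow> bool" where
  "dominates_map S m Y \<phi> \<longleftrightarrow> (\<forall>y\<in>Y. \<forall>t\<in>S. cmod (gelfand (\<phi> y) t) \<le> m y t)"

definition dominates_seminorm ::
    "('b::comm_cstar_algebra \<Rightarrow> complex) set \<Rightarrow>
     ('x::real_normed_vector \<Rightarrow> ('b \<Rightarrow> complex) \<Rightarrow> real) \<Rightarrow>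
     ('x \<Rightarrow> ('b \<Rightarrow> complex) \<Rightarrow> real) \<Rightarrow> bool" where
  "dominates_seminorm S m m' \<longleftrightarrow> (\<forall>x. \<forall>t\<in>S. m' x t \<le> m x t)"

definition locally_finite ::
    "('b::comm_cstar_algebra \<Rightarrow> complex) set \<Rightarrow>
     ('x::real_normed_vector \<Rightarrow> ('b \<Rightarrow> complex) \<Rightarrow> real) \<Rightarrow> 'x set \<Rightarrow> bool" where
  "locally_finite S m Y \<longleftrightarrow>
     (\<exists>c. \<forall>x. \<forall>t\<in>S. m x t \<le> c * norm x) \<and>
     (\<exists>Yc. subspace Yc \<and> Y \<inter> Yc = {0} \<and> closure {y + z |y z. y \<in> Y \<and> z \<in> Yc} = UNIV \<and>
       (\<forall>t0\<in>S.
         (\<forall>x\<in>Yc. \<forall>\<epsilon>>0. \<exists>U. neighbourhood_in S t0 U \<and> (\<forall>t\<in>U. m x t < \<epsilon>)) \<or>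
         (\<exists>F L U. subspace F \<and> F \<subseteq> Y \<and> (\<exists>D. finite D \<and> F = span D) \<and>
            subspace L \<and> L \<subseteq> Y \<and> F \<inter> L = {0} \<and> {u + v |u v. u \<in> F \<and> v \<in> L} = Y \<and>
            neighbourhood_in S t0 U \<and> (\<forall>y\<in>L. \<forall>t\<in>U. m y t = 0))))"

definition balanced ::
    "('b::comm_cstar_algebra \<Rightarrow> complex) set \<Rightarrow>
     ('x::real_normed_vector \<Rightarrow> ('b \<Rightarrow> complex) \<Rightarrow> real) \<Rightarrow> 'x set \<Rightarrow> ('x \<Rightarrow> 'b) \<Rightarrow> bool" where
  "balanced S m Y \<phi> \<longleftrightarrow>
     cone_seminorm S m \<and> dominates_map S m Y \<phi> \<and>
     (\<exists>m'. cone_seminorm S m' \<and> dominates_seminorm S m m' \<and>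
        locally_finite S m' Y \<and> dominates_map S m' Y \<phi>)"

definition locally_balanced ::
    "('x::real_normed_vector \<Rightarrow> ('b::comm_cstar_algebra \<Rightarrow> complex) \<Rightarrow> real) \<Rightarrow>
     'x set \<Rightarrow> ('x \<Rightarrow> 'b) \<Rightarrow> bool" where
  "locally_balanced m Y \<phi> \<longleftrightarrow>
     cone_seminorm spectrum m \<and> dominates_map spectrum m Y \<phi> \<and>
     (\<forall>t\<in>spectrum. \<exists>V. neighbourhood_in spectrum t V \<and> balanced V m Y \<phi>)"

definition bounded_real_linear_on ::
    "'x::real_normed_vector set \<Rightarrow> ('x \<Rightarrow> 'b::real_normed_vector) \<Rightarrow> bool" where
  "bounded_real_linear_on Y \<phi> \<longleftrightarrow>
     (\<forall>x\<in>Y. \<forall>y\<in>Y. \<phi> (x + y) = \<phi> x + \<phi> y) \<and>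
     (\<forall>a. \<forall>y\<in>Y. \<phi> (a *\<^sub>R y) = a *\<^sub>R \<phi> y) \<and>
     (\<exists>C. \<forall>y\<in>Y. norm (\<phi> y) \<le> C * norm y)"

end

theory Submission
  imports Defs
begin

text \<open>
  Restricted to the spectrum, \<open>\<phi>\<close> is a family of real functionals \<open>\<phi>(\<sqdot>)(t)\<close> on \<open>Y\<close>, dominated by the
  seminorms \<open>m(\<sqdot>)(t)\<close>. The Hahn--Banach theorem extends each of them to the whole space; the task is to do
  this continuously in \<open>t\<close>, at the price of the slack \<open>\<delta> \<parallel>x\<parallel>\<close>.

  The problem is local. Extensions that obey the bound form a convex set, so local solutions can be
  averaged with continuous weights (\<open>locally_balanced_extension\<close>). This allows one to replace \<open>m\<close> by a
  smaller seminorm \<open>m'\<close> that is locally finite with respect to \<open>Y\<close>, with complement \<open>Yc\<close>. Let \<open>W\<close> be the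
  open set of points around which \<open>m'\<close> vanishes on a subspace \<open>L\<close> of finite codimension in \<open>Y\<close>. Over \<open>W\<close> the
  map is extended to vectors of \<open>Yc\<close>, one dimension at a time, until its domain is dense. In each step a
  Hahn--Banach constant for one point \<open>t0\<close> still works nearby with a slightly larger slack: only
  finitely many dimensions matter modulo \<open>L\<close>, and there compactness makes lower semicontinuity
  uniform (\<open>extension_constant_persists\<close>). Averaging these constants gives a continuous function. The
  slack is chosen to tend to \<open>0\<close> at the boundary of \<open>W\<close>. At a point off \<open>W\<close> the seminorms of the elements of
  \<open>Yc\<close> tend to \<open>0\<close>, so every extension dominated by them is automatically continuous there
  (\<open>extension_over_locally_finite_region\<close>).

  To return to \<open>B\<close> one needs the Gelfand theorem for commutative \<open>C\<^sup>*\<close>-algebras, possibly without unit: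
  characters attain the norm (\<open>character_attaining_norm\<close>), and a real continuous function that vanishes
  at infinity is the transform of a self-adjoint element (\<open>gelfand_surjective\<close>). Characters are obtained
  from minimal seminorms with \<open>p (x\<^sup>2) = p(x)\<^sup>2\<close>, which are multiplicative, and an elementary
  Gelfand--Mazur argument. The slack is taken to be \<open>\<parallel>x\<parallel> t(e)\<close> for an element \<open>e\<close> of norm at most \<open>\<delta>\<close>
  that is positive on the spectrum, so that the extended functions vanish at infinity. Separability
  of \<open>B\<close> embeds the spectrum in a metric space, which provides distance functions and convergent
  sequences.
\<close>

section \<open>Averages with countably many weights\<close>

lemma convex_series_bound:
  fixes w x :: "nat \<Rightarrow> real"
  assumes w: "\<And>k. 0 \<le> w k" "w sums 1"
    and x: "\<And>k. w k \<noteq> 0 \<Longrightarrow> \<bar>x k\<bar> \<le> q"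
  shows "summable (\<lambda>k. w k * x k)" "\<bar>\<Sum>k. w k * x k\<bar> \<le> q"
proof -
  have le: "norm (w k * x k) \<le> w k * q" for k
    using w(1)[of k] x[of k] by (cases "w k = 0") (auto simp: abs_mult mult_left_mono)
  have sq: "(\<lambda>k. w k * q) sums q" using sums_mult2[OF w(2), of q] by simp
  show "summable (\<lambda>k. w k * x k)"
    by (rule summable_comparison_test'[OF sums_summable[OF sq]]) (use le in auto)
  have sn: "summable (\<lambda>k. norm (w k * x k))"
    by (rule summable_comparison_test'[OF sums_summable[OF sq]]) (use le in auto)
  have "norm (\<Sum>k. w k * x k) \<le> (\<Sum>k. norm (w k * x k))" by (rule summable_norm[OF sn])
  also have "\<dots> \<le> (\<Sum>k. w k * q)" by (rule suminf_le[OF le sn sums_summable[OF sq]])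
  also have "\<dots> = q" using sq by (simp add: sums_iff)
  finally show "\<bar>\<Sum>k. w k * x k\<bar> \<le> q" by simp
qed

text \<open>
  The truncated distance to \<^term>\<open>S - U\<close>; if that set is empty the distance to it is \<open>0\<close> by
  convention, and the constant \<open>1\<close> takes its place.
\<close>

lemma bump_function:
  fixes S U :: "'p::metric_space set"
  assumes "openin (top_of_set S) U"
  obtains h :: "'p \<Rightarrow> real" where "continuous_on S h" "\<And>t. 0 \<le> h t" "\<And>t. h t \<le> 1"
    "\<And>t. t \<in> S \<Longrightarrow> h t > 0 \<longleftrightarrow> t \<in> U"
proof (cases "S - U = {}")
  case True
  show ?thesis by (rule that[of "\<lambda>_. 1"]) (use True in auto)
next
  case False
  have cl: "closedin (top_of_set S) (S - U)"
    using closedin_diff[OF closedin_topspace assms] by simp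
  show ?thesis
  proof (rule that[of "\<lambda>t. min 1 (infdist t (S - U))"])
    show "continuous_on S (\<lambda>t. min 1 (infdist t (S - U)))" by (intro continuous_intros)
    fix t assume t: "t \<in> S"
    have "infdist t (S - U) = 0 \<longleftrightarrow> t \<in> S - U"
    proof
      assume "infdist t (S - U) = 0"
      then have "t \<in> closure (S - U)" using False in_closure_iff_infdist_zero by blast
      moreover obtain T where "closed T" "S - U = S \<inter> T" using cl by (auto simp: closedin_closed)
      ultimately show "t \<in> S - U" using t closure_minimal[of "S - U" T] by blast
    qed auto
    then show "0 < min 1 (infdist t (S - U)) \<longleftrightarrow> t \<in> U"
      using t infdist_nonneg[of t "S - U"] by (auto simp: less_le)
  qed (auto simp: infdist_nonneg)
qed

lemma continuous_on_extend_by_zero: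
  fixes h f :: "'p::metric_space \<Rightarrow> real"
  assumes U: "openin (top_of_set S) U" and h: "continuous_on S h" and f: "continuous_on U f"
    and zero: "\<And>t. t \<in> S \<Longrightarrow> t \<notin> U \<Longrightarrow> h t = 0" and bd: "\<And>t. t \<in> U \<Longrightarrow> \<bar>f t\<bar> \<le> C"
  shows "continuous_on S (\<lambda>t. h t * f t)"
  unfolding continuous_on_def
proof
  fix t0 assume t0: "t0 \<in> S"
  show "((\<lambda>t. h t * f t) \<longlongrightarrow> h t0 * f t0) (at t0 within S)"
  proof (cases "t0 \<in> U")
    case True
    have US: "U \<subseteq> S" using U openin_imp_subset by blast
    have "continuous_on U (\<lambda>t. h t * f t)"
      by (intro continuous_intros f continuous_on_subset[OF h US])
    then have "((\<lambda>t. h t * f t) \<longlongrightarrow> h t0 * f t0) (at t0 within U)"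
      using True by (auto simp: continuous_on_def)
    moreover have "at t0 within S = at t0 within U"
    proof -
      obtain T where T: "open T" "U = S \<inter> T" using U by (auto simp: openin_open)
      show ?thesis by (rule at_within_nhd[of _ T]) (use T True in auto)
    qed
    ultimately show ?thesis by simp
  next
    case False
    have "(h \<longlongrightarrow> 0) (at t0 within S)"
      using h t0 zero[OF t0 False] by (auto simp: continuous_on_def)
    then have lim: "((\<lambda>t. \<bar>h t\<bar> * \<bar>C\<bar>) \<longlongrightarrow> 0) (at t0 within S)"
      by (auto intro!: tendsto_eq_intros)
    have "((\<lambda>t. h t * f t) \<longlongrightarrow> 0) (at t0 within S)"
    proof (rule Lim_null_comparison[OF _ lim])
      show "\<forall>\<^sub>F t in at t0 within S. norm (h t * f t) \<le> \<bar>h t\<bar> * \<bar>C\<bar>"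
        unfolding eventually_at_filter
      proof (rule always_eventually, intro allI impI)
        fix t assume "t \<in> S"
        show "norm (h t * f t) \<le> \<bar>h t\<bar> * \<bar>C\<bar>"
        proof (cases "t \<in> U")
          case True
          then show ?thesis using bd[of t] by (auto simp: abs_mult intro!: mult_left_mono)
        next
          case False
          then show ?thesis using zero[of t] \<open>t \<in> S\<close> by simp
        qed
      qed
    qed
    then show ?thesis using zero[OF t0 False] by simp
  qed
qed

text \<open>
  A substitute for a partition of unity that asks for no local finiteness. The bump functions of
  the sets are damped by \<open>2\<^sup>-\<^sup>k / C k\<close> before they are normalised; by the Weierstrass test the averages
  of functions \<open>f k\<close> that are bounded by a multiple of \<open>C k\<close> then stay continuous.
\<close>

lemma countable_partition_weights:
  fixes S :: "'p::metric_space set" and U :: "nat \<Rightarrow> 'p set" and C :: "nat \<Rightarrow> real"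
  assumes U: "\<And>k. openin (top_of_set S) (U k)" and cover: "S \<subseteq> (\<Union>k. U k)"
    and C: "\<And>k. C k \<ge> 1"
  obtains w :: "nat \<Rightarrow> 'p \<Rightarrow> real" where
    "\<And>k t. t \<in> S \<Longrightarrow> 0 \<le> w k t" "\<And>k t. t \<in> S \<Longrightarrow> t \<notin> U k \<Longrightarrow> w k t = 0"
    "\<And>t. t \<in> S \<Longrightarrow> (\<lambda>k. w k t) sums 1"
    "\<And>f N. (\<And>k. continuous_on (U k) (f k)) \<Longrightarrow> (\<And>k t. t \<in> U k \<Longrightarrow> \<bar>f k t\<bar> \<le> C k * N) \<Longrightarrow>
       continuous_on S (\<lambda>t. \<Sum>k. w k t * f k t) \<and> (\<forall>t\<in>S. summable (\<lambda>k. w k t * f k t))"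
proof -
  have "\<exists>h :: 'p \<Rightarrow> real. continuous_on S h \<and> (\<forall>t. 0 \<le> h t) \<and> (\<forall>t. h t \<le> 1) \<and>
    (\<forall>t\<in>S. h t > 0 \<longleftrightarrow> t \<in> U k)" for k
    by (rule bump_function[OF U[of k]]) blast
  then obtain h :: "nat \<Rightarrow> 'p \<Rightarrow> real" where h: "\<And>k. continuous_on S (h k)" "\<And>k t. 0 \<le> h k t"
      "\<And>k t. h k t \<le> 1" "\<And>k t. t \<in> S \<Longrightarrow> h k t > 0 \<longleftrightarrow> t \<in> U k"
    by metis
  \<comment> \<open>Dividing by \<open>C k\<close> lets the M-test absorb the bound \<open>C k * N\<close> on \<open>f k\<close>.\<close>
  define v where "v k t = (1/2)^k / C k * h k t" for k t
  have Cp: "C k > 0" for k using C[of k] by linarith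
  have v0: "0 \<le> v k t" for k t using h(2)[of k t] Cp[of k] by (simp add: v_def)
  have vz: "v k t = 0" if "t \<in> S" "t \<notin> U k" for k t
    using h(4)[OF that(1), of k] h(2)[of k t] that by (simp add: v_def)
  have vp: "v k t > 0" if "t \<in> S" "t \<in> U k" for k t
    using h(4)[OF that(1), of k] that Cp[of k] by (simp add: v_def)
  have vle: "v k t * C k \<le> (1/2)^k" for k t
    using h(3)[of k t] Cp[of k] by (simp add: v_def)
  have vc: "continuous_on S (v k)" for k
    unfolding v_def by (intro continuous_intros h(1)) (use Cp[of k] in auto)
  have main: "continuous_on S (\<lambda>t. \<Sum>k. v k t * f k t) \<and> (\<forall>t\<in>S. summable (\<lambda>k. v k t * f k t))"
    if fc: "\<And>k. continuous_on (U k) (f k)" and fb: "\<And>k t. t \<in> U k \<Longrightarrow> \<bar>f k t\<bar> \<le> C k * N" for f N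
  proof -
    have b: "norm (v k t * f k t) \<le> (1/2)^k * \<bar>N\<bar>" if t: "t \<in> S" for k t
    proof (cases "t \<in> U k")
      case True
      have "\<bar>f k t\<bar> \<le> C k * \<bar>N\<bar>"
        using fb[OF True] Cp[of k] by (meson abs_ge_self less_imp_le mult_left_mono order_trans)
      then have "v k t * \<bar>f k t\<bar> \<le> v k t * (C k * \<bar>N\<bar>)" by (rule mult_left_mono[OF _ v0])
      also have "\<dots> = (v k t * C k) * \<bar>N\<bar>" by simp
      also have "\<dots> \<le> (1/2)^k * \<bar>N\<bar>" by (rule mult_right_mono[OF vle]) simp
      finally show ?thesis using v0[of k t] by (simp add: abs_mult)
    qed (use vz t in auto)
    have sm: "summable (\<lambda>k. (1/2)^k * \<bar>N\<bar> :: real)"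
      by (intro summable_mult2 summable_geometric) simp
    have c: "continuous_on S (\<lambda>t. v k t * f k t)" for k
      by (rule continuous_on_extend_by_zero[OF U vc fc vz fb])
    have "uniform_limit S (\<lambda>n t. \<Sum>i<n. v i t * f i t) (\<lambda>t. \<Sum>i. v i t * f i t) sequentially"
      by (rule Weierstrass_m_test[OF b sm])
    then have "continuous_on S (\<lambda>t. \<Sum>k. v k t * f k t)"
      by (rule uniform_limit_theorem[rotated]) (auto intro!: always_eventually continuous_on_sum c)
    moreover have "summable (\<lambda>k. v k t * f k t)" if "t \<in> S" for t
      by (rule summable_comparison_test'[OF sm]) (use b[OF that] in auto)
    ultimately show ?thesis by blast
  qed
  define s where "s t = (\<Sum>k. v k t)" for t
  have s: "continuous_on S s" "\<And>t. t \<in> S \<Longrightarrow> summable (\<lambda>k. v k t)"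
    using main[of "\<lambda>_ _. 1" 1] C by (auto simp: s_def)
  have sp: "s t > 0" if t: "t \<in> S" for t
  proof -
    obtain k where "t \<in> U k" using cover t by blast
    then show ?thesis unfolding s_def using suminf_pos2[OF s(2)[OF t] v0] vp[OF t] by blast
  qed
  show ?thesis
  proof (rule that[of "\<lambda>k t. v k t / s t"])
    show "(\<lambda>k. v k t / s t) sums 1" if t: "t \<in> S" for t
      using sums_divide[OF summable_sums[OF s(2)[OF t]], of "s t"] sp[OF t] by (simp add: s_def)
    fix f :: "nat \<Rightarrow> 'p \<Rightarrow> real" and N
    assume f: "\<And>k. continuous_on (U k) (f k)" "\<And>k t. t \<in> U k \<Longrightarrow> \<bar>f k t\<bar> \<le> C k * N"
    note M = main[OF f]
    have eq: "(\<Sum>k. v k t / s t * f k t) = (\<Sum>k. v k t * f k t) / s t" if "t \<in> S" for t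
      using suminf_divide[of "\<lambda>k. v k t * f k t" "s t"] M that by (simp add: divide_simps mult.commute)
    have "continuous_on S (\<lambda>t. (\<Sum>k. v k t * f k t) / s t)"
      using M s(1) sp by (intro continuous_intros) force+
    then have "continuous_on S (\<lambda>t. \<Sum>k. v k t / s t * f k t)" using eq by simp
    moreover have "summable (\<lambda>k. v k t / s t * f k t)" if "t \<in> S" for t
      using M that summable_divide[of "\<lambda>k. v k t * f k t" "s t"] by (simp add: mult.commute)
    ultimately show "continuous_on S (\<lambda>t. \<Sum>k. v k t / s t * f k t) \<and>
        (\<forall>t\<in>S. summable (\<lambda>k. v k t / s t * f k t))" by blast
  qed (use v0 sp vz in \<open>auto simp: less_imp_le\<close>)
qed

lemma countable_subcover_with_data:
  fixes S :: "'p::second_countable_topology set"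
  assumes "S \<noteq> {}"
    and local: "\<And>t. t \<in> S \<Longrightarrow> \<exists>U d. openin (top_of_set S) U \<and> t \<in> U \<and> Q U d"
  obtains U :: "nat \<Rightarrow> 'p set" and d where "\<And>k. openin (top_of_set S) (U k)"
    "\<And>k. Q (U k) (d k)" "S \<subseteq> (\<Union>k. U k)"
proof -
  define F where "F = {U. openin (top_of_set S) U \<and> (\<exists>d. Q U d)}"
  obtain F' where F': "F' \<subseteq> F" "countable F'" "\<Union>F' = \<Union>F"
    by (rule Lindelof_openin[of F S]) (auto simp: F_def)
  have SF: "S \<subseteq> \<Union>F'" unfolding F'(3) using local by (force simp: F_def)
  then have ne: "F' \<noteq> {}" using assms(1) by blast
  have r: "range (from_nat_into F') = F'" by (rule range_from_nat_into[OF ne F'(2)])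
  have "from_nat_into F' k \<in> F" for k using r F'(1) by blast
  then have "\<forall>k. \<exists>d. Q (from_nat_into F' k) d" "\<And>k. openin (top_of_set S) (from_nat_into F' k)"
    by (auto simp: F_def)
  then show ?thesis using that SF r by (metis)
qed

text \<open>
  The constraints cut out a convex set of admissible values at each point. Where a constant is
  admissible on a whole neighbourhood of every point, averaging such constants gives a continuous
  admissible function.
\<close>

lemma continuous_selection_from_constants:
  fixes W :: "'p::{metric_space,second_countable_topology} set" and g q :: "'i \<Rightarrow> 'p \<Rightarrow> real"
  assumes local: "\<And>t. t \<in> W \<Longrightarrow> \<exists>U c. openin (top_of_set W) U \<and> t \<in> U \<and>
    (\<forall>s\<in>U. \<forall>i\<in>I. \<bar>g i s + c\<bar> \<le> q i s)"
  obtains a where "continuous_on W a" "\<And>t i. t \<in> W \<Longrightarrow> i \<in> I \<Longrightarrow> \<bar>g i t + a t\<bar> \<le> q i t"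
proof (cases "W = {}")
  case True then show ?thesis using that by auto
next
  case False
  obtain U and c :: "nat \<Rightarrow> real" where U: "\<And>k. openin (top_of_set W) (U k)"
    and c: "\<And>k. \<forall>s\<in>U k. \<forall>i\<in>I. \<bar>g i s + c k\<bar> \<le> q i s" and cov: "W \<subseteq> (\<Union>k. U k)"
    by (rule countable_subcover_with_data[OF False, of "\<lambda>U c. \<forall>s\<in>U. \<forall>i\<in>I. \<bar>g i s + c\<bar> \<le> q i s"])
       (use local in auto)
  obtain w where w: "\<And>k t. t \<in> W \<Longrightarrow> 0 \<le> w k t" "\<And>k t. t \<in> W \<Longrightarrow> t \<notin> U k \<Longrightarrow> w k t = 0"
    "\<And>t. t \<in> W \<Longrightarrow> (\<lambda>k. w k t) sums 1"
    "\<And>f N. (\<And>k. continuous_on (U k) (f k)) \<Longrightarrow> (\<And>k t. t \<in> U k \<Longrightarrow> \<bar>f k t\<bar> \<le> (1 + \<bar>c k\<bar>) * N) \<Longrightarrow>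
       continuous_on W (\<lambda>t. \<Sum>k. w k t * f k t) \<and> (\<forall>t\<in>W. summable (\<lambda>k. w k t * f k t))"
    by (rule countable_partition_weights[OF U cov, of "\<lambda>k. 1 + \<bar>c k\<bar>"]) auto
  define a where "a t = (\<Sum>k. w k t * c k)" for t
  have a: "continuous_on W a" "\<And>t. t \<in> W \<Longrightarrow> summable (\<lambda>k. w k t * c k)"
    using w(4)[of "\<lambda>k t. c k" 1] by (auto simp: a_def)
  show ?thesis
  proof (rule that[OF a(1)])
    fix t i assume t: "t \<in> W" and i: "i \<in> I"
    have "\<bar>\<Sum>k. w k t * (g i t + c k)\<bar> \<le> q i t"
    proof (rule convex_series_bound(2)[OF w(1)[OF t] w(3)[OF t]])
      fix k assume "w k t \<noteq> 0"
      then show "\<bar>g i t + c k\<bar> \<le> q i t" using w(2)[OF t] c i by blast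
    qed
    moreover have "(\<lambda>k. w k t * g i t + w k t * c k) sums (1 * g i t + a t)"
      unfolding a_def by (intro sums_add sums_mult2 w(3)[OF t] summable_sums a(2)[OF t])
    ultimately show "\<bar>g i t + a t\<bar> \<le> q i t" by (simp add: sums_iff distrib_left)
  qed
qed

section \<open>Continuous one-dimensional extensions\<close>

text \<open>
  Compactness of balls in the finite-dimensional quotient \<open>span (L \<union> A) / L\<close>, for a subspace \<open>L\<close> that
  may fail to be closed, so that the quotient carries only a seminorm. In the induction a new vector
  \<open>a\<close> either lies in the closure of the span so far, and can be replaced by approximations from it,
  or has positive distance to it, and then its coefficients along the sequence are bounded.
\<close>

lemma bounded_sequence_converges_modulo_subspace:
  fixes L :: "'x::real_normed_vector set"
  assumes "finite A" and L: "subspace L"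
  shows "(\<And>j. y j \<in> span (L \<union> A)) \<Longrightarrow> (\<And>j. norm (y j) \<le> R) \<Longrightarrow>
    \<exists>r l g. strict_mono (r :: nat \<Rightarrow> nat) \<and> (\<forall>j. l j \<in> L) \<and> g \<in> span (L \<union> A) \<and>
      (\<lambda>j. y (r j) - l j) \<longlonglongrightarrow> g"
  using \<open>finite A\<close>
proof (induction A arbitrary: y R rule: finite_induct)
  case empty
  have "span L = L" using L by (simp add: span_eq_iff)
  then have "\<forall>j. y j \<in> L" using empty(1) by (metis sup_bot_right)
  then show ?case
    by (intro exI[of _ id] exI[of _ y] exI[of _ 0]) (auto simp: strict_mono_def span_0)
next
  case (insert a A)
  define Z where "Z = span (L \<union> A)"
  have Z: "subspace Z" by (simp add: Z_def)
  have ZI: "span (L \<union> insert a A) = span (insert a (L \<union> A))" by simp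
  have sub: "Z \<subseteq> span (L \<union> insert a A)" unfolding Z_def by (rule span_mono) auto
  have "\<exists>k. y j - k *\<^sub>R a \<in> Z" for j
    using insert.prems(1)[of j] unfolding ZI span_breakdown_eq Z_def by blast
  then obtain k where k: "\<And>j. y j - k j *\<^sub>R a \<in> Z" by metis
  show ?case
  proof (cases "a \<in> closure Z")
    case True
    have "\<exists>u\<in>Z. norm (k j *\<^sub>R (a - u)) < 1 / real (Suc j)" for j
    proof -
      have "0 < 1 / (real (Suc j) * (\<bar>k j\<bar> + 1))" by simp
      then obtain u where u: "u \<in> Z" "dist u a < 1 / (real (Suc j) * (\<bar>k j\<bar> + 1))"
        using True unfolding closure_approachable by blast
      have "norm (k j *\<^sub>R (a - u)) \<le> (\<bar>k j\<bar> + 1) * norm (a - u)"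
        by (simp add: mult_right_mono)
      also have "\<dots> < (\<bar>k j\<bar> + 1) * (1 / (real (Suc j) * (\<bar>k j\<bar> + 1)))"
        using u(2) by (intro mult_strict_left_mono) (auto simp: dist_norm norm_minus_commute)
      also have "\<dots> = 1 / real (Suc j)" by (simp add: add_nonneg_eq_0_iff)
      finally show ?thesis using u(1) by blast
    qed
    then obtain u where u: "\<And>j. u j \<in> Z" "\<And>j. norm (k j *\<^sub>R (a - u j)) < 1 / real (Suc j)"
      by metis
    define y' where "y' j = y j - k j *\<^sub>R (a - u j)" for j
    have y'Z: "y' j \<in> span (L \<union> A)" for j
    proof -
      have "y' j = (y j - k j *\<^sub>R a) + k j *\<^sub>R u j" by (simp add: y'_def algebra_simps)
      then show ?thesis
        using k[of j] u(1)[of j] Z unfolding Z_def by (metis subspace_add subspace_scale)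
    qed
    have y'b: "norm (y' j) \<le> R + 1" for j
    proof -
      have "norm (y' j) \<le> norm (y j) + norm (k j *\<^sub>R (a - u j))"
        unfolding y'_def by (rule norm_triangle_ineq4)
      also have "1 / real (Suc j) \<le> 1" by simp
      then have "norm (y j) + norm (k j *\<^sub>R (a - u j)) \<le> R + 1"
        using insert.prems(2)[of j] u(2)[of j] by linarith
      finally show ?thesis .
    qed
    obtain r l g where r: "strict_mono r" "\<forall>j. l j \<in> L" "g \<in> span (L \<union> A)"
        "(\<lambda>j. y' (r j) - l j) \<longlonglongrightarrow> g"
      using insert.IH[of y', OF y'Z y'b] by blast
    have "(\<lambda>j. k j *\<^sub>R (a - u j)) \<longlonglongrightarrow> 0"
      by (rule Lim_null_comparison[OF _ LIMSEQ_inverse_real_of_nat])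
         (use u(2) in \<open>auto simp: inverse_eq_divide intro!: always_eventually less_imp_le\<close>)
    then have "(\<lambda>j. k (r j) *\<^sub>R (a - u (r j))) \<longlonglongrightarrow> 0"
      using LIMSEQ_subseq_LIMSEQ[OF _ r(1)] by (auto simp: o_def)
    from tendsto_add[OF r(4) this] have "(\<lambda>j. y (r j) - l j) \<longlonglongrightarrow> g"
      by (simp add: y'_def algebra_simps)
    then show ?thesis using r sub unfolding Z_def by blast
  next
    case False
    then obtain d where d: "d > 0" "\<And>u. u \<in> Z \<Longrightarrow> d \<le> dist u a"
      unfolding closure_approachable by (meson not_less)
    have kb: "\<bar>k j\<bar> * d \<le> R" for j
    proof (cases "k j = 0")
      case True
      then show ?thesis using order_trans[OF norm_ge_zero insert.prems(2)[of j]] by simp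
    next
      case nz: False
      have "(- (1 / k j)) *\<^sub>R (y j - k j *\<^sub>R a) \<in> Z" by (rule subspace_scale[OF Z k])
      from d(2)[OF this] have "d \<le> norm ((- (1 / k j)) *\<^sub>R (y j - k j *\<^sub>R a) - a)"
        by (simp add: dist_norm)
      also have "(- (1 / k j)) *\<^sub>R (y j - k j *\<^sub>R a) - a = (- (1 / k j)) *\<^sub>R y j"
        using nz by (simp add: algebra_simps)
      finally have "d \<le> norm (y j) / \<bar>k j\<bar>" by simp
      then have "\<bar>k j\<bar> * d \<le> norm (y j)" using nz by (simp add: field_simps)
      then show ?thesis using insert.prems(2)[of j] by linarith
    qed
    have kb': "\<bar>k j\<bar> \<le> R / d" for j using kb[of j] d(1) by (simp add: field_simps)
    have "bounded (range k)" by (rule boundedI[of _ "R / d"]) (use kb' in auto)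
    then obtain \<kappa> r1 where r1: "strict_mono r1" "(k \<circ> r1) \<longlonglongrightarrow> \<kappa>"
      using bounded_imp_convergent_subsequence[of k] by blast
    define y' where "y' j = y (r1 j) - k (r1 j) *\<^sub>R a" for j
    have y'Z: "y' j \<in> span (L \<union> A)" for j using k by (simp add: y'_def Z_def)
    have y'b: "norm (y' j) \<le> R + R / d * norm a" for j
    proof -
      have "norm (y' j) \<le> norm (y (r1 j)) + norm (k (r1 j) *\<^sub>R a)"
        unfolding y'_def by (rule norm_triangle_ineq4)
      also have "\<dots> \<le> R + R / d * norm a"
        using insert.prems(2)[of "r1 j"] mult_right_mono[OF kb'[of "r1 j"], of "norm a"] by simp
      finally show ?thesis .
    qed
    obtain r l g where r: "strict_mono r" "\<forall>j. l j \<in> L" "g \<in> span (L \<union> A)"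
        "(\<lambda>j. y' (r j) - l j) \<longlonglongrightarrow> g"
      using insert.IH[of y', OF y'Z y'b] by blast
    have "(\<lambda>j. k (r1 (r j))) \<longlonglongrightarrow> \<kappa>"
      using LIMSEQ_subseq_LIMSEQ[OF r1(2) r(1)] by (simp add: o_def)
    then have "(\<lambda>j. k (r1 (r j)) *\<^sub>R a) \<longlonglongrightarrow> \<kappa> *\<^sub>R a" by (intro tendsto_intros)
    from tendsto_add[OF r(4) this] have "(\<lambda>j. y ((r1 \<circ> r) j) - l j) \<longlonglongrightarrow> g + \<kappa> *\<^sub>R a"
      by (simp add: y'_def algebra_simps)
    moreover have "strict_mono (r1 \<circ> r)" by (rule strict_mono_o[OF r1(1) r(1)])
    moreover have "g + \<kappa> *\<^sub>R a \<in> span (L \<union> insert a A)"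
      using r(3) sub by (auto simp: Z_def intro!: span_add span_scale intro: span_base)
    ultimately show ?thesis using r(2) by blast
  qed
qed

definition linear_over :: "'x::real_vector set \<Rightarrow> ('x \<Rightarrow> real) \<Rightarrow> bool" where
  "linear_over Z f \<longleftrightarrow> (\<forall>x\<in>Z. \<forall>y\<in>Z. f (x + y) = f x + f y) \<and> (\<forall>a. \<forall>x\<in>Z. f (a *\<^sub>R x) = a * f x)"

lemma linear_over_add: "linear_over Z f \<Longrightarrow> x \<in> Z \<Longrightarrow> y \<in> Z \<Longrightarrow> f (x + y) = f x + f y"
  by (simp add: linear_over_def)

lemma linear_over_scale: "linear_over Z f \<Longrightarrow> x \<in> Z \<Longrightarrow> f (a *\<^sub>R x) = a * f x"
  by (simp add: linear_over_def)

lemma linear_over_diff: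
  assumes "linear_over Z f" "subspace Z" "x \<in> Z" "y \<in> Z"
  shows "f (x - y) = f x - f y"
proof -
  have "f (x + (-1) *\<^sub>R y) = f x + (-1) * f y"
    using assms by (simp only: linear_over_add linear_over_scale subspace_scale)
  then show ?thesis by simp
qed

text \<open>
  The admissible values \<open>c\<close> for the extension of \<open>f\<close> at a new vector \<open>z\<close> form the interval between
  \<open>sup (- p (y + z) - f y)\<close> and \<open>inf (p (y + z) - f y)\<close>, which the triangle inequality shows to be
  nonempty.
\<close>

lemma hahn_banach_one_step:
  fixes p :: "'x::real_vector \<Rightarrow> real"
  assumes Z: "subspace Z" and f: "linear_over Z f"
    and p: "\<And>x y. p (x + y) \<le> p x + p y" "\<And>x. p (- x) = p x"
    and le: "\<And>y. y \<in> Z \<Longrightarrow> \<bar>f y\<bar> \<le> p y"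
  obtains c where "\<And>y. y \<in> Z \<Longrightarrow> \<bar>f y + c\<bar> \<le> p (y + z)"
proof -
  have key: "- p (y + z) - f y \<le> p (y' + z) - f y'" if y: "y \<in> Z" "y' \<in> Z" for y y'
  proof -
    have "f y' - f y = f (y' - y)" using linear_over_diff[OF f Z y(2,1)] by simp
    also have "\<dots> \<le> p (y' - y)" using le[of "y' - y"] subspace_diff[OF Z y(2,1)] by linarith
    also have "\<dots> \<le> p (y' + z) + p (- (y + z))" using p(1)[of "y' + z" "- (y + z)"] by simp
    finally show ?thesis by (simp only: p(2))
  qed
  define c where "c = (SUP y\<in>Z. - p (y + z) - f y)"
  have Z0: "0 \<in> Z" using Z by (rule subspace_0)
  have bdd: "bdd_above ((\<lambda>y. - p (y + z) - f y) ` Z)"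
    using key[OF _ Z0] by (intro bdd_aboveI2)
  show ?thesis
  proof
    fix y assume y: "y \<in> Z"
    have "- p (y + z) - f y \<le> c" unfolding c_def by (rule cSUP_upper[OF y bdd])
    moreover have "c \<le> p (y + z) - f y"
      unfolding c_def by (rule cSUP_least) (use Z0 key y in auto)
    ultimately show "\<bar>f y + c\<bar> \<le> p (y + z)" by linarith
  qed
qed

lemma lower_semicontinuous_on_compose:
  assumes "lower_semicontinuous_on T g" "continuous_on S f" "f ` S \<subseteq> T"
  shows "lower_semicontinuous_on S (\<lambda>x. g (f x))"
  unfolding lower_semicontinuous_on_def
proof
  fix a
  have "openin (top_of_set S) (S \<inter> f -` {t \<in> T. a < g t})"
    by (rule continuous_openin_preimage[OF assms(2), of T])
       (use assms(1,3) in \<open>auto simp: lower_semicontinuous_on_def\<close>)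
  also have "S \<inter> f -` {t \<in> T. a < g t} = {x \<in> S. a < g (f x)}" using assms(3) by blast
  finally show "openin (top_of_set S) {x \<in> S. a < g (f x)}" .
qed

locale seminorm_family =
  fixes V :: "'p::{metric_space,second_countable_topology} set"
    and m :: "'x::real_normed_vector \<Rightarrow> 'p \<Rightarrow> real" and C :: real
  assumes lsc: "lower_semicontinuous_on V (m x)"
    and triangle: "t \<in> V \<Longrightarrow> m (x + y) t \<le> m x t + m y t"
    and homog: "t \<in> V \<Longrightarrow> m (a *\<^sub>R x) t = \<bar>a\<bar> * m x t"
    and bound: "t \<in> V \<Longrightarrow> m x t \<le> C * norm x"
begin

lemma m_minus: "t \<in> V \<Longrightarrow> m (- x) t = m x t"
  using homog[of t "-1" x] by simp

lemma m_nonneg: "t \<in> V \<Longrightarrow> 0 \<le> m x t"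
  using triangle[of t x "- x"] m_minus[of t x] homog[of t 0 x] by simp

lemma m_diff_le: "t \<in> V \<Longrightarrow> m x t \<le> m y t + C * norm (x - y)"
  using triangle[of t y "x - y"] bound[of t "x - y"] by simp

lemma m_cong_null:
  assumes "t \<in> V" "m l t = 0"
  shows "m (x + l) t = m x t"
  using triangle[OF assms(1), of x l] triangle[OF assms(1), of "x + l" "- l"] m_minus[OF assms(1), of l]
    assms(2) by simp

lemma lsc_sequentially:
  assumes "t0 \<in> V" "\<And>j. t j \<in> V" "t \<longlonglongrightarrow> t0" "\<eta> > 0"
  shows "\<forall>\<^sub>F j in sequentially. m x t0 - \<eta> < m x (t j)"
proof -
  obtain T where T: "open T" "{t \<in> V. m x t0 - \<eta> < m x t} = V \<inter> T"
    using lsc[of x] unfolding lower_semicontinuous_on_def openin_open by blast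
  have "t0 \<in> V \<inter> T" using T(2) assms by force
  then have "\<forall>\<^sub>F j in sequentially. t j \<in> T" using assms(3) T(1) by (auto dest: topological_tendstoD)
  then show ?thesis by eventually_elim (use T(2) assms(2) in blast)
qed

text \<open>
  The extension constant \<open>c\<close> found at \<open>t0\<close> remains admissible at nearby points once the slack grows from
  \<open>\<alpha>\<close> to \<open>\<beta>\<close>. Otherwise points \<open>t j\<close> converging to \<open>t0\<close> and vectors \<open>y j\<close> violate the bound. The additional
  slack makes the \<open>y j\<close> bounded, hence convergent modulo \<open>L\<close> along a subsequence, and both \<open>f\<close> and \<open>m\<close>
  ignore \<open>L\<close> near \<open>t0\<close>. Lower semicontinuity then carries the violation, with slack \<open>\<beta>\<close>, over to the limit
  point \<open>t0\<close>, where the bound with slack \<open>\<alpha>\<close> contradicts it, since \<open>z\<close> has positive distance to \<open>Z\<close>.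
\<close>

lemma extension_constant_persists:
  assumes Z: "subspace Z" and f: "\<And>t. t \<in> V \<Longrightarrow> linear_over Z (\<lambda>x. f x t)"
    and cont: "\<And>x. x \<in> Z \<Longrightarrow> continuous_on V (f x)"
    and \<epsilon>: "continuous_on V \<epsilon>" "\<And>t. t \<in> V \<Longrightarrow> 0 < \<epsilon> t" and ab: "0 \<le> \<alpha>" "\<alpha> < \<beta>"
    and dom: "\<And>x t. x \<in> Z \<Longrightarrow> t \<in> V \<Longrightarrow> \<bar>f x t\<bar> \<le> m x t + \<alpha> * \<epsilon> t * norm x"
    and t0: "t0 \<in> V" and U: "openin (top_of_set V) U" "t0 \<in> U"
    and L: "subspace L" "finite A" "Z = span (L \<union> A)"
    and null: "\<And>l t. l \<in> L \<Longrightarrow> t \<in> U \<Longrightarrow> m l t = 0 \<and> f l t = 0"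
    and z: "z \<notin> closure Z"
    and c: "\<And>y. y \<in> Z \<Longrightarrow> \<bar>f y t0 + c\<bar> \<le> m (y + z) t0 + \<alpha> * \<epsilon> t0 * norm (y + z)"
  shows "\<exists>U. openin (top_of_set V) U \<and> t0 \<in> U \<and>
    (\<forall>s\<in>U. \<forall>y\<in>Z. \<bar>f y s + c\<bar> \<le> m (y + z) s + \<beta> * \<epsilon> s * norm (y + z))"
proof (rule ccontr)
  assume contra: "\<not> ?thesis"
  define e where "e = \<epsilon> t0"
  have e: "e > 0" using \<epsilon>(2)[OF t0] by (simp add: e_def)
  \<comment> \<open>On \<open>U'\<close> the slack function is bounded above and away from \<open>0\<close>.\<close>
  define U' where "U' = U \<inter> (V \<inter> \<epsilon> -` {e/2<..<2*e})"
  have U': "openin (top_of_set V) U'"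
    unfolding U'_def by (intro openin_Int U(1) continuous_openin_preimage_gen[OF \<epsilon>(1)]) auto
  have t0U': "t0 \<in> U'" using U(2) t0 e by (auto simp: U'_def e_def)
  have UV: "U' \<subseteq> V" by (auto simp: U'_def)
  have "\<exists>s y. s \<in> U' \<and> dist s t0 < 1 / real (Suc j) \<and> y \<in> Z \<and>
      m (y + z) s + \<beta> * \<epsilon> s * norm (y + z) < \<bar>f y s + c\<bar>" for j
  proof (rule ccontr)
    assume n: "\<not> ?thesis"
    have "openin (top_of_set V) (U' \<inter> (V \<inter> ball t0 (1 / real (Suc j))))"
      by (intro openin_Int U' openin_open_Int open_ball)
    moreover have "t0 \<in> U' \<inter> (V \<inter> ball t0 (1 / real (Suc j)))" using t0U' t0 by auto
    moreover have "\<forall>s\<in>U' \<inter> (V \<inter> ball t0 (1 / real (Suc j))). \<forall>y\<in>Z.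
        \<bar>f y s + c\<bar> \<le> m (y + z) s + \<beta> * \<epsilon> s * norm (y + z)"
    proof (intro ballI)
      fix s y assume "s \<in> U' \<inter> (V \<inter> ball t0 (1 / real (Suc j)))" "y \<in> Z"
      moreover from this have "dist s t0 < 1 / real (Suc j)"
        by (metis IntD2 dist_commute mem_ball)
      ultimately show "\<bar>f y s + c\<bar> \<le> m (y + z) s + \<beta> * \<epsilon> s * norm (y + z)"
        using n by (meson IntD1 not_less)
    qed
    ultimately show False using contra by blast
  qed
  then obtain t y where t: "\<And>j. t j \<in> U'" "\<And>j. dist (t j) t0 < 1 / real (Suc j)"
    and y: "\<And>j. y j \<in> Z"
    and big: "\<And>j. m (y j + z) (t j) + \<beta> * \<epsilon> (t j) * norm (y j + z) < \<bar>f (y j) (t j) + c\<bar>"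
    by metis
  have tV: "t j \<in> V" for j using t(1) UV by blast
  have tU: "t j \<in> U" for j using t(1) by (auto simp: U'_def)
  have \<epsilon>b: "e/2 < \<epsilon> (t j)" "\<epsilon> (t j) < 2 * e" for j using t(1)[of j] by (auto simp: U'_def)
  have tlim: "t \<longlonglongrightarrow> t0"
    by (subst tendsto_dist_iff, rule Lim_null_comparison[OF _ LIMSEQ_inverse_real_of_nat])
       (use t(2) in \<open>auto simp: inverse_eq_divide intro!: always_eventually less_imp_le\<close>)
  \<comment> \<open>Coercivity: \<open>(\<beta> - \<alpha>) \<epsilon> \<parallel>y j + z\<parallel>\<close> is at most \<open>K\<close>.\<close>
  define K where "K = C * norm z + \<bar>c\<bar> + \<alpha> * (2 * e) * norm z"
  define R where "R = K / ((\<beta> - \<alpha>) * (e/2)) + norm z"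
  have yb: "norm (y j) \<le> R" for j
  proof -
    have "\<bar>f (y j) (t j) + c\<bar> \<le> m (y j) (t j) + \<alpha> * \<epsilon> (t j) * norm (y j) + \<bar>c\<bar>"
      using dom[OF y tV, of j j] by linarith
    moreover have "m (y j) (t j) \<le> m (y j + z) (t j) + C * norm z"
      using m_diff_le[OF tV, of "y j" j "y j + z"] by simp
    moreover have "\<alpha> * \<epsilon> (t j) * norm (y j) \<le> \<alpha> * \<epsilon> (t j) * norm (y j + z) + \<alpha> * (2 * e) * norm z"
    proof -
      have "norm (y j) \<le> norm (y j + z) + norm z" using norm_triangle_ineq4[of "y j + z" z] by simp
      then have "\<alpha> * \<epsilon> (t j) * norm (y j) \<le> \<alpha> * \<epsilon> (t j) * (norm (y j + z) + norm z)"
        using \<epsilon>b[of j] e ab(1) by (intro mult_left_mono) auto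
      moreover have "\<alpha> * \<epsilon> (t j) * norm z \<le> \<alpha> * (2 * e) * norm z"
        using \<epsilon>b[of j] ab(1) by (intro mult_right_mono mult_left_mono) auto
      ultimately show ?thesis by (simp add: distrib_left)
    qed
    ultimately have "(\<beta> - \<alpha>) * \<epsilon> (t j) * norm (y j + z) < K"
      using big[of j] by (simp add: K_def algebra_simps)
    moreover have "(\<beta> - \<alpha>) * (e/2) * norm (y j + z) \<le> (\<beta> - \<alpha>) * \<epsilon> (t j) * norm (y j + z)"
      using \<epsilon>b[of j] ab by (intro mult_right_mono mult_left_mono) auto
    ultimately have "norm (y j + z) * ((\<beta> - \<alpha>) * (e/2)) \<le> K" by (simp add: mult.commute)
    then have "norm (y j + z) \<le> K / ((\<beta> - \<alpha>) * (e/2))"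
      using ab e by (subst pos_le_divide_eq) auto
    then show ?thesis unfolding R_def using norm_triangle_ineq4[of "y j + z" z] by simp
  qed
  obtain r l g where r: "strict_mono (r :: nat \<Rightarrow> nat)" "\<forall>j. l j \<in> L" and g: "g \<in> Z"
      and lim: "(\<lambda>j. y (r j) - l j) \<longlonglongrightarrow> g"
    using bounded_sequence_converges_modulo_subspace[of A L y, OF L(2,1) y[unfolded L(3)] yb]
    unfolding L(3)[symmetric] by blast
  define h where "h j = y (r j) - l j" for j
  define \<tau> where "\<tau> j = t (r j)" for j
  have LZ: "L \<subseteq> Z" unfolding L(3) using span_superset by blast
  have hZ: "h j \<in> Z" for j unfolding h_def using y r(2) LZ Z by (blast intro: subspace_diff)
  have \<tau>: "\<tau> \<longlonglongrightarrow> t0" "\<And>j. \<tau> j \<in> V" "\<And>j. \<tau> j \<in> U"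
    using LIMSEQ_subseq_LIMSEQ[OF tlim r(1)] tV tU by (auto simp: \<tau>_def[abs_def] o_def)
  have \<epsilon>lim: "(\<lambda>j. \<epsilon> (\<tau> j)) \<longlonglongrightarrow> e"
    unfolding e_def using continuous_on_tendsto_compose[OF \<epsilon>(1) \<tau>(1) t0] \<tau>(2) by auto
  have nlim: "(\<lambda>j. norm (h j - g)) \<longlonglongrightarrow> 0"
    using lim by (simp add: h_def tendsto_norm_zero_iff LIM_zero_iff)
  have fy: "f (y (r j)) (\<tau> j) = f g (\<tau> j) + f (h j - g) (\<tau> j)" for j
  proof -
    have "f (h j + l j) (\<tau> j) = f (h j) (\<tau> j) + f (l j) (\<tau> j)"
      using linear_over_add[OF f[OF \<tau>(2)] hZ, of "l j"] r(2) LZ by blast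
    moreover have "f (h j - g) (\<tau> j) = f (h j) (\<tau> j) - f g (\<tau> j)"
      using linear_over_diff[OF f[OF \<tau>(2)] Z hZ g] by simp
    ultimately show ?thesis using null[of "l j" "\<tau> j"] r(2) \<tau>(3) by (simp add: h_def)
  qed
  have "(\<lambda>j. f (h j - g) (\<tau> j)) \<longlonglongrightarrow> 0"
  proof (rule Lim_null_comparison)
    show "\<forall>\<^sub>F j in sequentially. norm (f (h j - g) (\<tau> j)) \<le> (C + \<alpha> * (2 * e)) * norm (h j - g)"
    proof (rule always_eventually, rule allI)
      fix j
      have "\<bar>f (h j - g) (\<tau> j)\<bar> \<le> m (h j - g) (\<tau> j) + \<alpha> * \<epsilon> (\<tau> j) * norm (h j - g)"
        by (rule dom[OF subspace_diff[OF Z hZ g] \<tau>(2)])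
      also have "\<dots> \<le> C * norm (h j - g) + \<alpha> * (2 * e) * norm (h j - g)"
        using \<epsilon>b[of "r j"] ab(1)
        by (intro add_mono bound[OF \<tau>(2)] mult_right_mono mult_left_mono) (auto simp: \<tau>_def)
      finally show "norm (f (h j - g) (\<tau> j)) \<le> (C + \<alpha> * (2 * e)) * norm (h j - g)"
        by (simp add: distrib_right)
    qed
    show "(\<lambda>j. (C + \<alpha> * (2 * e)) * norm (h j - g)) \<longlonglongrightarrow> 0"
      using tendsto_mult_right_zero[OF nlim] .
  qed
  moreover have "(\<lambda>j. f g (\<tau> j)) \<longlonglongrightarrow> f g t0"
    using continuous_on_tendsto_compose[OF cont[OF g] \<tau>(1) t0] \<tau>(2) by auto
  ultimately have "(\<lambda>j. f (y (r j)) (\<tau> j)) \<longlonglongrightarrow> f g t0 + 0"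
    unfolding fy by (intro tendsto_add)
  then have Alim: "(\<lambda>j. \<bar>f (y (r j)) (\<tau> j) + c\<bar>) \<longlonglongrightarrow> \<bar>f g t0 + c\<bar>"
    by (intro tendsto_intros) simp
  \<comment> \<open>In the limit the norms \<open>\<parallel>y (r j) + z\<parallel>\<close> are at least the distance \<open>D\<close> from \<open>g + z\<close> to \<open>L\<close>.\<close>
  define D where "D = (INF l\<in>L. norm (g + z + l))"
  have L0: "0 \<in> L" by (rule subspace_0[OF L(1)])
  have bddL: "bdd_below ((\<lambda>l. norm (g + z + l)) ` L)" by (rule bdd_belowI2[of _ 0]) simp
  obtain d where d: "d > 0" "\<And>u. u \<in> Z \<Longrightarrow> d \<le> dist u z"
    using z unfolding closure_approachable by (meson not_less)
  have "d \<le> D" unfolding D_def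
  proof (rule cINF_greatest)
    fix l assume "l \<in> L"
    then have "- (g + l) \<in> Z" using g LZ Z by (blast intro: subspace_neg subspace_add)
    from d(2)[OF this] show "d \<le> norm (g + z + l)"
      using norm_minus_cancel[of "g + z + l"] by (simp add: dist_norm algebra_simps)
  qed (use L0 in auto)
  then have D: "D > 0" using d by linarith
  define B where "B j = \<beta> * \<epsilon> (\<tau> j) * (D - norm (h j - g)) - C * norm (h j - g)" for j
  have Blim: "B \<longlonglongrightarrow> \<beta> * e * (D - 0) - C * 0"
    unfolding B_def by (intro tendsto_intros \<epsilon>lim nlim)
  have lower: "m (g + z) (\<tau> j) + B j \<le> \<bar>f (y (r j)) (\<tau> j) + c\<bar>" for j
  proof -
    have eq: "y (r j) + z = (h j + z) + l j" by (simp add: h_def)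
    have "m (y (r j) + z) (\<tau> j) = m (h j + z) (\<tau> j)"
      unfolding eq by (rule m_cong_null[OF \<tau>(2)]) (use null r(2) \<tau>(3) in blast)
    moreover have "m (g + z) (\<tau> j) \<le> m (h j + z) (\<tau> j) + C * norm (h j - g)"
      using m_diff_le[OF \<tau>(2), of "g + z" j "h j + z"] by (simp add: norm_minus_commute)
    moreover have "D - norm (h j - g) \<le> norm (y (r j) + z)"
    proof -
      have "D \<le> norm (g + z + l j)" unfolding D_def using r(2) by (intro cINF_lower[OF bddL]) auto
      also have "g + z + l j = (y (r j) + z) - (h j - g)" by (simp add: h_def)
      also have "norm \<dots> \<le> norm (y (r j) + z) + norm (h j - g)" by (rule norm_triangle_ineq4)
      finally show ?thesis by simp
    qed
    then have "\<beta> * \<epsilon> (\<tau> j) * (D - norm (h j - g)) \<le> \<beta> * \<epsilon> (\<tau> j) * norm (y (r j) + z)"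
      using ab \<epsilon>(2)[OF \<tau>(2)[of j]] by (intro mult_left_mono) auto
    ultimately show ?thesis using big[of "r j"] by (simp add: B_def \<tau>_def)
  qed
  have up: "\<bar>f g t0 + c\<bar> - m (g + z) t0 \<le> \<alpha> * e * D"
  proof -
    have "\<bar>f g t0 + c\<bar> - m (g + z) t0 \<le> \<alpha> * e * norm (g + z + l)" if l: "l \<in> L" for l
    proof -
      have "f (g + l) t0 = f g t0"
        using linear_over_add[OF f[OF t0] g, of l] l LZ null[OF l U(2)] by auto
      moreover have "m (g + l + z) t0 = m (g + z) t0"
        using m_cong_null[OF t0, of l "g + z"] null[OF l U(2)] by (simp add: add.commute add.left_commute)
      moreover have "g + l \<in> Z" using g l LZ Z by (blast intro: subspace_add)
      ultimately show ?thesis using c[of "g + l"] by (simp add: e_def add.commute add.left_commute)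
    qed
    note all = this
    show ?thesis
    proof (cases "\<alpha> = 0")
      case True then show ?thesis using all[OF L0] by simp
    next
      case False
      then have p: "\<alpha> * e > 0" using ab(1) e by simp
      have "(\<bar>f g t0 + c\<bar> - m (g + z) t0) / (\<alpha> * e) \<le> D"
        unfolding D_def by (rule cINF_greatest) (use L0 all p in \<open>auto simp: field_simps\<close>)
      then show ?thesis using p by (simp add: field_simps)
    qed
  qed
  \<comment> \<open>The bounds at \<open>t0\<close> differ by \<open>(\<beta> - \<alpha>) e D\<close>; lower semicontinuity may lose at most half of it.\<close>
  define \<eta> where "\<eta> = (\<beta> - \<alpha>) * e * D / 2"
  have \<eta>: "\<eta> > 0" using ab e D by (simp add: \<eta>_def)
  have "\<forall>\<^sub>F j in sequentially. (m (g + z) t0 - \<eta>) + B j \<le> \<bar>f (y (r j)) (\<tau> j) + c\<bar>"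
    using lsc_sequentially[OF t0 \<tau>(2,1) \<eta>, of "g + z"]
    by eventually_elim (use lower in \<open>smt (verit)\<close>)
  then have "(m (g + z) t0 - \<eta>) + (\<beta> * e * (D - 0) - C * 0) \<le> \<bar>f g t0 + c\<bar>"
    by (intro tendsto_le[OF _ Alim tendsto_add[OF tendsto_const Blim]]) auto
  then have "\<beta> * e * D - \<eta> \<le> \<alpha> * e * D" using up by simp
  moreover have "\<beta> * e * D - \<alpha> * e * D = 2 * \<eta>" by (simp add: \<eta>_def algebra_simps)
  ultimately show False using \<eta> by linarith
qed

text \<open>
  The Hahn--Banach constants at the single points persist locally, and a continuous selection
  \<open>a\<close> of them serves as the value of the extended map at \<open>z\<close>.
\<close>

lemma one_dimensional_extension:
  assumes Z: "subspace Z" and f: "\<And>t. t \<in> V \<Longrightarrow> linear_over Z (\<lambda>x. f x t)"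
    and cont: "\<And>x. x \<in> Z \<Longrightarrow> continuous_on V (f x)"
    and \<epsilon>: "continuous_on V \<epsilon>" "\<And>t. t \<in> V \<Longrightarrow> 0 < \<epsilon> t" and ab: "0 \<le> \<alpha>" "\<alpha> < \<beta>"
    and dom: "\<And>x t. x \<in> Z \<Longrightarrow> t \<in> V \<Longrightarrow> \<bar>f x t\<bar> \<le> m x t + \<alpha> * \<epsilon> t * norm x"
    and loc: "\<And>t0. t0 \<in> V \<Longrightarrow> \<exists>U L A. openin (top_of_set V) U \<and> t0 \<in> U \<and> subspace L \<and> finite A \<and>
      Z = span (L \<union> A) \<and> (\<forall>l\<in>L. \<forall>t\<in>U. m l t = 0 \<and> f l t = 0)"
    and z: "z \<notin> closure Z"
  obtains f' where "\<And>t. t \<in> V \<Longrightarrow> linear_over (span (insert z Z)) (\<lambda>x. f' x t)"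
    "\<And>x. x \<in> span (insert z Z) \<Longrightarrow> continuous_on V (f' x)" "\<And>x t. x \<in> Z \<Longrightarrow> f' x t = f x t"
    "\<And>x t. x \<in> span (insert z Z) \<Longrightarrow> t \<in> V \<Longrightarrow> \<bar>f' x t\<bar> \<le> m x t + \<beta> * \<epsilon> t * norm x"
proof -
  have "\<exists>U c. openin (top_of_set V) U \<and> t0 \<in> U \<and>
    (\<forall>s\<in>U. \<forall>y\<in>Z. \<bar>f y s + c\<bar> \<le> m (y + z) s + \<beta> * \<epsilon> s * norm (y + z))" if t0: "t0 \<in> V" for t0
  proof -
    obtain U L A where U: "openin (top_of_set V) U" "t0 \<in> U" and L: "subspace L" "finite A"
      "Z = span (L \<union> A)" and null: "\<forall>l\<in>L. \<forall>t\<in>U. m l t = 0 \<and> f l t = 0"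
      using loc[OF t0] by blast
    obtain c where c: "\<And>y. y \<in> Z \<Longrightarrow> \<bar>f y t0 + c\<bar> \<le> m (y + z) t0 + \<alpha> * \<epsilon> t0 * norm (y + z)"
    proof (rule hahn_banach_one_step[OF Z f[OF t0], of "\<lambda>x. m x t0 + \<alpha> * \<epsilon> t0 * norm x" z])
      fix x y :: 'x
      have "\<alpha> * \<epsilon> t0 * norm (x + y) \<le> \<alpha> * \<epsilon> t0 * (norm x + norm y)"
        using ab(1) \<epsilon>(2)[OF t0] by (intro mult_left_mono norm_triangle_ineq) auto
      then show "m (x + y) t0 + \<alpha> * \<epsilon> t0 * norm (x + y)
          \<le> m x t0 + \<alpha> * \<epsilon> t0 * norm x + (m y t0 + \<alpha> * \<epsilon> t0 * norm y)"
        using triangle[OF t0, of x y] by (simp add: distrib_left)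
    qed (use dom t0 m_minus in auto)
    show ?thesis
      using extension_constant_persists[OF Z f cont \<epsilon> ab dom t0 U L _ z c] null by blast
  qed
  then obtain a where a: "continuous_on V a"
    "\<And>t y. t \<in> V \<Longrightarrow> y \<in> Z \<Longrightarrow> \<bar>f y t + a t\<bar> \<le> m (y + z) t + \<beta> * \<epsilon> t * norm (y + z)"
    by (rule continuous_selection_from_constants[of V Z f "\<lambda>y s. m (y + z) s + \<beta> * \<epsilon> s * norm (y + z)"])
       (assumption, rule that, auto)
  have zZ: "z \<notin> Z" using z closure_subset by blast
  define \<kappa> where "\<kappa> x = (THE k. x - k *\<^sub>R z \<in> Z)" for x
  have \<kappa>_eq: "\<kappa> (u + k *\<^sub>R z) = k" if u: "u \<in> Z" for u k
    unfolding \<kappa>_def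
  proof (rule the_equality)
    fix k' assume "u + k *\<^sub>R z - k' *\<^sub>R z \<in> Z"
    from subspace_diff[OF Z this u] have "(k - k') *\<^sub>R z \<in> Z" by (simp add: algebra_simps)
    from subspace_scale[OF Z this, of "1 / (k - k')"] show "k' = k" using zZ by (cases "k = k'") auto
  qed (use u in simp)
  have decomp: "\<exists>u k. u \<in> Z \<and> x = u + k *\<^sub>R z" if x: "x \<in> span (insert z Z)" for x
  proof -
    obtain k where "x - k *\<^sub>R z \<in> span Z" using x unfolding span_breakdown_eq by blast
    then have "x - k *\<^sub>R z \<in> Z" using Z by (simp add: span_eq_iff[THEN iffD2])
    then show ?thesis by (intro exI[of _ "x - k *\<^sub>R z"] exI[of _ k]) simp
  qed
  define f' where "f' x t = f (x - \<kappa> x *\<^sub>R z) t + \<kappa> x * a t" for x t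
  have f': "f' (u + k *\<^sub>R z) t = f u t + k * a t" if "u \<in> Z" for u k t
    using \<kappa>_eq[OF that, of k] by (simp add: f'_def)
  show ?thesis
  proof
    show "linear_over (span (insert z Z)) (\<lambda>x. f' x t)" if t: "t \<in> V" for t
      unfolding linear_over_def
    proof (intro conjI ballI allI)
      fix x y assume "x \<in> span (insert z Z)" "y \<in> span (insert z Z)"
      then obtain u k v j where x: "u \<in> Z" "x = u + k *\<^sub>R z" and y: "v \<in> Z" "y = v + j *\<^sub>R z"
        using decomp by meson
      have "f' (u + v + (k + j) *\<^sub>R z) t = f (u + v) t + (k + j) * a t"
        by (rule f') (use x y Z in \<open>blast intro: subspace_add\<close>)
      then show "f' (x + y) t = f' x t + f' y t"
        using f'[OF x(1), of k t] f'[OF y(1), of j t] linear_over_add[OF f[OF t] x(1) y(1)]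
        by (simp add: x(2) y(2) algebra_simps)
    next
      fix b x assume "x \<in> span (insert z Z)"
      then obtain u k where x: "u \<in> Z" "x = u + k *\<^sub>R z" using decomp by meson
      have "f' (b *\<^sub>R u + (b * k) *\<^sub>R z) t = f (b *\<^sub>R u) t + (b * k) * a t"
        by (rule f') (use x Z in \<open>blast intro: subspace_scale\<close>)
      then show "f' (b *\<^sub>R x) t = b * f' x t"
        using f'[OF x(1), of k t] linear_over_scale[OF f[OF t] x(1), of b]
        by (simp add: x(2) algebra_simps)
    qed
    show "continuous_on V (f' x)" if x: "x \<in> span (insert z Z)" for x
    proof -
      obtain u k where x: "u \<in> Z" "x = u + k *\<^sub>R z" using decomp[OF x] by blast
      have "continuous_on V (\<lambda>t. f u t + k * a t)" by (intro continuous_intros cont[OF x(1)] a(1))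
      then show ?thesis using f'[OF x(1), of k] by (simp add: x(2))
    qed
    show "f' x t = f x t" if "x \<in> Z" for x t using f'[OF that, of 0 t] by simp
    show "\<bar>f' x t\<bar> \<le> m x t + \<beta> * \<epsilon> t * norm x" if x: "x \<in> span (insert z Z)" and t: "t \<in> V" for x t
    proof -
      obtain u k where x: "u \<in> Z" "x = u + k *\<^sub>R z" using decomp[OF x] by blast
      show ?thesis
      proof (cases "k = 0")
        case True
        have "\<alpha> * \<epsilon> t * norm u \<le> \<beta> * \<epsilon> t * norm u"
          using ab \<epsilon>(2)[OF t] by (intro mult_right_mono) auto
        then show ?thesis using dom[OF x(1) t] f'[OF x(1), of 0 t] True x(2) by simp
      next
        case False
        define v where "v = (1 / k) *\<^sub>R u"
        have v: "v \<in> Z" unfolding v_def by (rule subspace_scale[OF Z x(1)])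
        have xv: "x = k *\<^sub>R (v + z)" using False by (simp add: x(2) v_def algebra_simps)
        have "f u t = k * f v t" using linear_over_scale[OF f[OF t] v, of k] False by (simp add: v_def)
        then have "f' x t = k * (f v t + a t)" using f'[OF x(1), of k t] x(2) by (simp add: algebra_simps)
        then have "\<bar>f' x t\<bar> = \<bar>k\<bar> * \<bar>f v t + a t\<bar>" by (simp add: abs_mult)
        also have "\<dots> \<le> \<bar>k\<bar> * (m (v + z) t + \<beta> * \<epsilon> t * norm (v + z))"
          by (intro mult_left_mono a(2)[OF t v]) simp
        also have "\<dots> = m x t + \<beta> * \<epsilon> t * norm x"
          unfolding xv homog[OF t] norm_scaleR by (simp add: distrib_left mult.left_commute)
        finally show ?thesis .
      qed
    qed
  qed
qed

end

section \<open>Extensions under a locally finite seminorm\<close>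

text \<open>
  The two alternatives at one point of the definition of \<^const>\<open>locally_finite\<close>, over an arbitrary
  topological space. In the second one the complement of \<open>L\<close> in \<open>Y\<close> is given by a finite spanning set.
\<close>

definition locally_finite_at ::
    "'p::topological_space set \<Rightarrow> ('x::real_normed_vector \<Rightarrow> 'p \<Rightarrow> real) \<Rightarrow> 'x set \<Rightarrow> 'x set \<Rightarrow> 'p \<Rightarrow> bool" where
  "locally_finite_at V m Y Yc t0 \<longleftrightarrow>
     (\<forall>x\<in>Yc. \<forall>\<eta>>0. \<exists>U. openin (top_of_set V) U \<and> t0 \<in> U \<and> (\<forall>t\<in>U. m x t < \<eta>)) \<or>
     (\<exists>U L A. openin (top_of_set V) U \<and> t0 \<in> U \<and> subspace L \<and> finite A \<and>
       Y = span (L \<union> A) \<and> (\<forall>l\<in>L. \<forall>t\<in>U. m l t = 0))"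

lemma seminorm_family_subset:
  assumes "seminorm_family V m C" "W \<subseteq> V"
  shows "seminorm_family W m C"
proof -
  interpret seminorm_family V m C by fact
  show ?thesis
  proof
    show "lower_semicontinuous_on W (m x)" for x
      using lower_semicontinuous_on_compose[OF lsc, of W "\<lambda>t. t" x] assms(2) by simp
  qed (use assms(2) triangle homog bound in blast)+
qed

context seminorm_family
begin

text \<open>
  Infinitely many one-dimensional extensions, with the total slack kept below \<open>\<epsilon>\<close>. A vector \<open>z n\<close> in
  the closure of the current domain is skipped: the final passage to the closure takes care of it,
  and \<open>extension_constant_persists\<close> needs a new vector at positive distance.
\<close>

lemma extension_along_sequence:
  fixes z :: "nat \<Rightarrow> 'x"
  assumes Y: "subspace Y" and \<phi>: "\<And>t. t \<in> V \<Longrightarrow> linear_over Y (\<lambda>y. \<phi> y t)"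
    and cont: "\<And>y. y \<in> Y \<Longrightarrow> continuous_on V (\<phi> y)"
    and dom: "\<And>y t. y \<in> Y \<Longrightarrow> t \<in> V \<Longrightarrow> \<bar>\<phi> y t\<bar> \<le> m y t"
    and loc: "\<And>t0. t0 \<in> V \<Longrightarrow> \<exists>U L A. openin (top_of_set V) U \<and> t0 \<in> U \<and> subspace L \<and> finite A \<and>
      Y = span (L \<union> A) \<and> (\<forall>l\<in>L. \<forall>t\<in>U. m l t = 0)"
    and \<epsilon>: "continuous_on V \<epsilon>" "\<And>t. t \<in> V \<Longrightarrow> 0 < \<epsilon> t"
  obtains D f where "subspace D" "Y \<subseteq> D" "D \<subseteq> span (Y \<union> range z)" "range z \<subseteq> closure D"
    "\<And>t. t \<in> V \<Longrightarrow> linear_over D (\<lambda>x. f x t)" "\<And>x. x \<in> D \<Longrightarrow> continuous_on V (f x)"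
    "\<And>y t. y \<in> Y \<Longrightarrow> t \<in> V \<Longrightarrow> f y t = \<phi> y t"
    "\<And>x t. x \<in> D \<Longrightarrow> t \<in> V \<Longrightarrow> \<bar>f x t\<bar> \<le> m x t + \<epsilon> t * norm x"
proof -
  \<comment> \<open>The slack used after \<open>n\<close> steps is the fraction \<open>\<alpha> n\<close> of \<open>\<epsilon>\<close>.\<close>
  define \<alpha> where "\<alpha> n = 1 - 1 / real (Suc n)" for n
  define stage where "stage n p \<longleftrightarrow> (case p of (Z, f) \<Rightarrow>
      (\<exists>A. finite A \<and> A \<subseteq> range z \<and> Z = span (Y \<union> A)) \<and>
      (\<forall>t\<in>V. linear_over Z (\<lambda>x. f x t)) \<and> (\<forall>x\<in>Z. continuous_on V (f x)) \<and>
      (\<forall>y\<in>Y. \<forall>t\<in>V. f y t = \<phi> y t) \<and>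
      (\<forall>x\<in>Z. \<forall>t\<in>V. \<bar>f x t\<bar> \<le> m x t + \<alpha> n * \<epsilon> t * norm x))" for n p
  define extends where "extends n p p' \<longleftrightarrow> (case p of (Z, f) \<Rightarrow> case p' of (Z', f') \<Rightarrow>
      Z \<subseteq> Z' \<and> (\<forall>x\<in>Z. \<forall>t\<in>V. f' x t = f x t) \<and> z n \<in> closure Z')"
    for n :: nat and p p' :: "'x set \<times> ('x \<Rightarrow> 'p \<Rightarrow> real)"
  have \<alpha>: "0 \<le> \<alpha> n" "\<alpha> n < \<alpha> (Suc n)" "\<alpha> n \<le> 1" for n
    by (auto simp: \<alpha>_def field_simps)
  have "\<exists>s. \<forall>n. stage n (s n) \<and> extends n (s n) (s (Suc n))"
  proof (rule dependent_nat_choice)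
    have "span (Y \<union> {}) = Y" using Y by (simp add: span_eq_iff)
    then have "\<exists>A. finite A \<and> A \<subseteq> range z \<and> Y = span (Y \<union> A)" by (metis empty_subsetI finite.emptyI)
    then have "stage 0 (Y, \<phi>)" using \<phi> cont dom by (simp add: stage_def \<alpha>_def)
    then show "\<exists>p. stage 0 p" ..
  next
    fix p n assume st: "stage n p"
    obtain Z f where p: "p = (Z, f)" by (cases p)
    obtain A where A: "finite A" "A \<subseteq> range z" "Z = span (Y \<union> A)"
      and f: "\<And>t. t \<in> V \<Longrightarrow> linear_over Z (\<lambda>x. f x t)" "\<And>x. x \<in> Z \<Longrightarrow> continuous_on V (f x)"
        "\<And>y t. y \<in> Y \<Longrightarrow> t \<in> V \<Longrightarrow> f y t = \<phi> y t"
        "\<And>x t. x \<in> Z \<Longrightarrow> t \<in> V \<Longrightarrow> \<bar>f x t\<bar> \<le> m x t + \<alpha> n * \<epsilon> t * norm x"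
      using st unfolding stage_def p by auto
    have Z: "subspace Z" unfolding A(3) by (rule subspace_span)
    have YZ: "Y \<subseteq> Z" unfolding A(3) using span_superset by blast
    show "\<exists>p'. stage (Suc n) p' \<and> extends n p p'"
    proof (cases "z n \<in> closure Z")
      case True
      have "\<bar>f x t\<bar> \<le> m x t + \<alpha> (Suc n) * \<epsilon> t * norm x" if "x \<in> Z" "t \<in> V" for x t
      proof -
        have "\<alpha> n * \<epsilon> t * norm x \<le> \<alpha> (Suc n) * \<epsilon> t * norm x"
          using \<alpha>(2)[of n] \<epsilon>(2)[OF that(2)] by (intro mult_right_mono) auto
        then show ?thesis using f(4)[OF that] by linarith
      qed
      then have "stage (Suc n) (Z, f)" using A f unfolding stage_def by auto
      moreover have "extends n p (Z, f)" using True by (simp add: extends_def p)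
      ultimately show ?thesis by blast
    next
      case False
      have loc': "\<exists>U L A. openin (top_of_set V) U \<and> t0 \<in> U \<and> subspace L \<and> finite A \<and>
        Z = span (L \<union> A) \<and> (\<forall>l\<in>L. \<forall>t\<in>U. m l t = 0 \<and> f l t = 0)" if t0: "t0 \<in> V" for t0
      proof -
        obtain U L B where U: "openin (top_of_set V) U" "t0 \<in> U" and L: "subspace L" "finite B"
          "Y = span (L \<union> B)" and null: "\<forall>l\<in>L. \<forall>t\<in>U. m l t = 0"
          using loc[OF t0] by blast
        have "Z = span (L \<union> (B \<union> A))" unfolding A(3)
        proof (rule span_subspace[OF _ _ subspace_span])
          have "Y \<subseteq> span (L \<union> (B \<union> A))" unfolding L(3) by (rule span_mono) blast
          moreover have "A \<subseteq> span (L \<union> (B \<union> A))" by (auto intro: span_base)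
          ultimately show "Y \<union> A \<subseteq> span (L \<union> (B \<union> A))" by simp
          have "L \<union> B \<subseteq> Y" unfolding L(3) by (rule span_superset)
          then have "L \<union> (B \<union> A) \<subseteq> Y \<union> A" by blast
          then show "span (L \<union> (B \<union> A)) \<subseteq> span (Y \<union> A)" by (rule span_mono)
        qed
        moreover have "m l t = 0 \<and> f l t = 0" if "l \<in> L" "t \<in> U" for l t
        proof -
          have l: "l \<in> Y" unfolding L(3) using that(1) by (simp add: span_base)
          have t: "t \<in> V" using U(1) that(2) openin_imp_subset by blast
          show ?thesis using dom[OF l t] f(3)[OF l t] null that by auto
        qed
        ultimately show ?thesis using U L(1,2) A(1) by (metis finite_UnI)
      qed
      obtain f' where f': "\<And>t. t \<in> V \<Longrightarrow> linear_over (span (insert (z n) Z)) (\<lambda>x. f' x t)"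
        "\<And>x. x \<in> span (insert (z n) Z) \<Longrightarrow> continuous_on V (f' x)" "\<And>x t. x \<in> Z \<Longrightarrow> f' x t = f x t"
        "\<And>x t. x \<in> span (insert (z n) Z) \<Longrightarrow> t \<in> V \<Longrightarrow> \<bar>f' x t\<bar> \<le> m x t + \<alpha> (Suc n) * \<epsilon> t * norm x"
        using one_dimensional_extension[OF Z f(1,2) \<epsilon> \<alpha>(1)[of n] \<alpha>(2)[of n] f(4) loc' False] by blast
      have span_eq: "span (insert (z n) Z) = span (Y \<union> insert (z n) A)"
      proof (rule span_subspace[OF _ _ subspace_span])
        have "Z \<subseteq> span (Y \<union> insert (z n) A)" unfolding A(3) by (rule span_mono) blast
        then show "insert (z n) Z \<subseteq> span (Y \<union> insert (z n) A)" by (simp add: span_base)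
        have "Y \<union> insert (z n) A \<subseteq> insert (z n) Z" unfolding A(3) using span_superset[of "Y \<union> A"] by blast
        then show "span (Y \<union> insert (z n) A) \<subseteq> span (insert (z n) Z)" by (rule span_mono)
      qed
      have "\<exists>B. finite B \<and> B \<subseteq> range z \<and> span (insert (z n) Z) = span (Y \<union> B)"
        by (rule exI[of _ "insert (z n) A"]) (use A span_eq in auto)
      then have "stage (Suc n) (span (insert (z n) Z), f')"
        unfolding stage_def using f' f(3) YZ by auto
      moreover have "z n \<in> closure (span (insert (z n) Z))"
        by (rule subsetD[OF closure_subset]) (simp add: span_base)
      then have "extends n p (span (insert (z n) Z), f')"
        using f'(3) span_superset[of "insert (z n) Z"] by (auto simp: extends_def p)
      ultimately show ?thesis by blast
    qed
  qed
  then obtain s where s: "\<And>n. stage n (s n)" "\<And>n. extends n (s n) (s (Suc n))" by blast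
  define Z where "Z n = fst (s n)" for n
  define f where "f n = snd (s n)" for n
  have sn: "s n = (Z n, f n)" for n by (simp add: Z_def f_def)
  have ZA: "\<exists>A. finite A \<and> A \<subseteq> range z \<and> Z n = span (Y \<union> A)"
    and fl: "t \<in> V \<Longrightarrow> linear_over (Z n) (\<lambda>x. f n x t)"
    and fc: "x \<in> Z n \<Longrightarrow> continuous_on V (f n x)"
    and fY: "y \<in> Y \<Longrightarrow> t \<in> V \<Longrightarrow> f n y t = \<phi> y t"
    and fd: "x \<in> Z n \<Longrightarrow> t \<in> V \<Longrightarrow> \<bar>f n x t\<bar> \<le> m x t + \<alpha> n * \<epsilon> t * norm x" for n t x y
    using s(1)[of n] unfolding stage_def sn by auto
  have step: "Z n \<subseteq> Z (Suc n)" "x \<in> Z n \<Longrightarrow> t \<in> V \<Longrightarrow> f (Suc n) x t = f n x t"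
    "z n \<in> closure (Z (Suc n))" for n x t
    using s(2)[of n] unfolding extends_def sn by auto
  have Zmono: "Z i \<subseteq> Z j" if "i \<le> j" for i j using lift_Suc_mono_le[of Z, OF step(1) that] .
  have fst: "f (i + k) x t = f i x t" if "x \<in> Z i" "t \<in> V" for i k x t
  proof (induction k)
    case (Suc k)
    have "x \<in> Z (i + k)" using Zmono[of i "i + k"] that by auto
    then show ?case using step(2)[of x "i + k" t] that Suc by simp
  qed simp
  define D where "D = (\<Union>n. Z n)"
  define g where "g x = f (LEAST n. x \<in> Z n) x" for x
  have g: "g x t = f n x t" if x: "x \<in> Z n" and t: "t \<in> V" for x n t
  proof -
    define k where "k = (LEAST n. x \<in> Z n)"
    have "k \<le> n" "x \<in> Z k" unfolding k_def using x by (auto intro: Least_le LeastI)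
    then have "f n x t = f k x t" using fst[OF _ t, of x k "n - k"] by simp
    then show ?thesis by (simp add: g_def k_def)
  qed
  have Zs: "subspace (Z n)" for n using ZA[of n] by (auto simp: subspace_span)
  have both: "\<exists>n. x \<in> Z n \<and> y \<in> Z n" if xy: "x \<in> D" "y \<in> D" for x y
  proof -
    obtain i j where "x \<in> Z i" "y \<in> Z j" using xy unfolding D_def by blast
    then show ?thesis using Zmono[of i "max i j"] Zmono[of j "max i j"] by auto
  qed
  show ?thesis
  proof
    show "subspace D"
    proof (rule subspaceI)
      show "0 \<in> D" using subspace_0[OF Zs] by (auto simp: D_def)
      show "x + y \<in> D" if "x \<in> D" "y \<in> D" for x y
        using both[OF that] subspace_add[OF Zs] unfolding D_def by blast
      show "a *\<^sub>R x \<in> D" if "x \<in> D" for a x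
        using that subspace_scale[OF Zs] unfolding D_def by blast
    qed
    have YZ: "Y \<subseteq> Z n" for n using ZA[of n] by (auto intro: span_base)
    then show "Y \<subseteq> D" unfolding D_def by blast
    have "Z n \<subseteq> span (Y \<union> range z)" for n
    proof -
      obtain A where "A \<subseteq> range z" "Z n = span (Y \<union> A)" using ZA[of n] by blast
      then show ?thesis using span_mono[of "Y \<union> A" "Y \<union> range z"] by blast
    qed
    then show "D \<subseteq> span (Y \<union> range z)" unfolding D_def by blast
    have "z n \<in> closure D" for n
      using step(3)[of n] closure_mono[of "Z (Suc n)" D] unfolding D_def by blast
    then show "range z \<subseteq> closure D" by blast
    show "linear_over D (\<lambda>x. g x t)" if t: "t \<in> V" for t
      unfolding linear_over_def
    proof (intro conjI ballI allI)
      fix x y assume xy: "x \<in> D" "y \<in> D"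
      then obtain n where n: "x \<in> Z n" "y \<in> Z n" using both by blast
      show "g (x + y) t = g x t + g y t"
        using g[OF n(1) t] g[OF n(2) t] g[OF subspace_add[OF Zs n] t]
          linear_over_add[OF fl[OF t] n] by simp
    next
      fix a x assume "x \<in> D"
      then obtain n where n: "x \<in> Z n" unfolding D_def by blast
      show "g (a *\<^sub>R x) t = a * g x t"
        using g[OF n t] g[OF subspace_scale[OF Zs n] t] linear_over_scale[OF fl[OF t] n] by simp
    qed
    show "continuous_on V (g x)" if xD: "x \<in> D" for x
    proof -
      obtain n where n: "x \<in> Z n" using xD unfolding D_def by blast
      show ?thesis using continuous_on_cong[OF refl g[OF n], of V] fc[OF n] by simp
    qed
    show "g y t = \<phi> y t" if "y \<in> Y" "t \<in> V" for y t
      using g[of y 0 t] YZ that fY by auto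
    show "\<bar>g x t\<bar> \<le> m x t + \<epsilon> t * norm x" if xD: "x \<in> D" and t: "t \<in> V" for x t
    proof -
      obtain n where n: "x \<in> Z n" using xD unfolding D_def by blast
      have "\<alpha> n * \<epsilon> t * norm x \<le> 1 * \<epsilon> t * norm x"
        using \<alpha>(3)[of n] \<epsilon>(2)[OF t] by (intro mult_right_mono) auto
      then show ?thesis using fd[OF n t] g[OF n t] by simp
    qed
  qed
qed

text \<open>
  Both \<open>m\<close> and the slack are dominated by the norm, uniformly over \<open>V\<close>, so \<open>f\<close> is uniformly Lipschitz
  and its extension is a uniform limit of continuous functions.
\<close>

lemma extension_to_closure:
  assumes D: "subspace D" "closure D = UNIV" and f: "\<And>t. t \<in> V \<Longrightarrow> linear_over D (\<lambda>x. f x t)"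
    and cont: "\<And>x. x \<in> D \<Longrightarrow> continuous_on V (f x)"
    and \<epsilon>: "\<And>t. t \<in> V \<Longrightarrow> \<epsilon> t \<le> 1"
    and dom: "\<And>x t. x \<in> D \<Longrightarrow> t \<in> V \<Longrightarrow> \<bar>f x t\<bar> \<le> m x t + \<epsilon> t * norm x"
  obtains \<psi> where "\<And>t. t \<in> V \<Longrightarrow> linear (\<lambda>x. \<psi> x t)" "\<And>x. continuous_on V (\<psi> x)"
    "\<And>x t. x \<in> D \<Longrightarrow> t \<in> V \<Longrightarrow> \<psi> x t = f x t"
    "\<And>x t. t \<in> V \<Longrightarrow> \<bar>\<psi> x t\<bar> \<le> m x t + \<epsilon> t * norm x"
proof -
  have lip: "\<bar>f d t - f d' t\<bar> \<le> (C + 1) * norm (d - d')" if d: "d \<in> D" "d' \<in> D" and t: "t \<in> V" for d d' t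
  proof -
    have "\<bar>f d t - f d' t\<bar> = \<bar>f (d - d') t\<bar>" using linear_over_diff[OF f[OF t] D(1) d] by simp
    also have "\<dots> \<le> m (d - d') t + \<epsilon> t * norm (d - d')" by (rule dom[OF subspace_diff[OF D(1) d] t])
    also have "\<dots> \<le> C * norm (d - d') + 1 * norm (d - d')"
      by (intro add_mono bound[OF t] mult_right_mono \<epsilon>[OF t]) simp
    finally show ?thesis by (simp add: distrib_right)
  qed
  have "\<exists>q. (\<forall>n. q n \<in> D) \<and> q \<longlonglongrightarrow> x" for x using D(2) closure_sequential by blast
  then obtain q where q: "\<And>x n. q x n \<in> D" "\<And>x. q x \<longlonglongrightarrow> x" by metis
  define \<psi> where "\<psi> x t = lim (\<lambda>n. f (q x n) t)" for x t
  have conv: "(\<lambda>n. f (q x n) t) \<longlonglongrightarrow> \<psi> x t" if t: "t \<in> V" for x t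
  proof -
    have "Cauchy (q x)" using q(2) by (rule LIMSEQ_imp_Cauchy)
    have "Cauchy (\<lambda>n. f (q x n) t)"
    proof (rule metric_CauchyI)
      fix e :: real assume e: "e > 0"
      define K where "K = \<bar>C\<bar> + 2"
      have K: "K > 0" "C + 1 \<le> K" by (auto simp: K_def)
      obtain M where M: "\<And>i j. i \<ge> M \<Longrightarrow> j \<ge> M \<Longrightarrow> dist (q x i) (q x j) < e / K"
        using metric_CauchyD[OF \<open>Cauchy (q x)\<close>, of "e / K"] e K by auto
      show "\<exists>M. \<forall>i\<ge>M. \<forall>j\<ge>M. dist (f (q x i) t) (f (q x j) t) < e"
      proof (intro exI allI impI)
        fix i j assume ij: "i \<ge> M" "j \<ge> M"
        have "dist (f (q x i) t) (f (q x j) t) \<le> (C + 1) * norm (q x i - q x j)"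
          using lip[OF q(1) q(1) t] by (simp add: dist_real_def)
        also have "\<dots> \<le> K * norm (q x i - q x j)" by (intro mult_right_mono K(2)) simp
        also have "\<dots> < e" using M[OF ij] K(1) by (simp add: dist_norm field_simps)
        finally show "dist (f (q x i) t) (f (q x j) t) < e" .
      qed
    qed
    then show ?thesis unfolding \<psi>_def using Cauchy_convergent_iff convergent_LIMSEQ_iff by blast
  qed
  have near: "\<bar>\<psi> x t - f d t\<bar> \<le> (C + 1) * norm (x - d)" if d: "d \<in> D" and t: "t \<in> V" for x d t
  proof (rule LIMSEQ_le)
    show "(\<lambda>n. \<bar>f (q x n) t - f d t\<bar>) \<longlonglongrightarrow> \<bar>\<psi> x t - f d t\<bar>" by (intro tendsto_intros conv t)
    show "(\<lambda>n. (C + 1) * norm (q x n - d)) \<longlonglongrightarrow> (C + 1) * norm (x - d)" by (intro tendsto_intros q(2))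
  qed (use lip[OF q(1) d t] in auto)
  have lims: "(\<lambda>n. f (d n) t) \<longlonglongrightarrow> \<psi> x t" if d: "\<And>n. d n \<in> D" "d \<longlonglongrightarrow> x" and t: "t \<in> V" for d x t
  proof (rule LIM_zero_cancel, rule Lim_null_comparison)
    show "\<forall>\<^sub>F n in sequentially. norm (f (d n) t - \<psi> x t) \<le> (C + 1) * norm (x - d n)"
      using near[OF d(1) t, of x] by (auto simp: abs_minus_commute)
    have "(\<lambda>n. (C + 1) * norm (x - d n)) \<longlonglongrightarrow> (C + 1) * norm (x - x)" by (intro tendsto_intros d(2))
    then show "(\<lambda>n. (C + 1) * norm (x - d n)) \<longlonglongrightarrow> 0" by simp
  qed
  show ?thesis
  proof
    show "linear (\<lambda>x. \<psi> x t)" if t: "t \<in> V" for t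
    proof (rule linearI)
      fix x y
      have "(\<lambda>n. f (q x n + q y n) t) \<longlonglongrightarrow> \<psi> (x + y) t"
        by (rule lims) (use q t D(1) in \<open>auto intro: subspace_add tendsto_add\<close>)
      moreover have "(\<lambda>n. f (q x n + q y n) t) \<longlonglongrightarrow> \<psi> x t + \<psi> y t"
        using tendsto_add[OF conv[OF t, of x] conv[OF t, of y]] linear_over_add[OF f[OF t] q(1) q(1)] by simp
      ultimately show "\<psi> (x + y) t = \<psi> x t + \<psi> y t" by (rule LIMSEQ_unique)
    next
      fix a x
      have "(\<lambda>n. f (a *\<^sub>R q x n) t) \<longlonglongrightarrow> \<psi> (a *\<^sub>R x) t"
        by (rule lims) (use q t D(1) in \<open>auto intro: subspace_scale tendsto_scaleR\<close>)
      moreover have "(\<lambda>n. f (a *\<^sub>R q x n) t) \<longlonglongrightarrow> a * \<psi> x t"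
        using tendsto_mult_left[OF conv[OF t, of x], of a] linear_over_scale[OF f[OF t] q(1)] by simp
      ultimately show "\<psi> (a *\<^sub>R x) t = a *\<^sub>R \<psi> x t" using LIMSEQ_unique by force
    qed
    show "continuous_on V (\<psi> x)" for x
    proof (rule uniform_limit_theorem[where f = "\<lambda>n. f (q x n)" and F = sequentially])
      show "uniform_limit V (\<lambda>n. f (q x n)) (\<psi> x) sequentially"
      proof (rule uniform_limitI)
        fix e :: real assume "e > 0"
        have "(\<lambda>n. (C + 1) * norm (x - q x n)) \<longlonglongrightarrow> (C + 1) * norm (x - x)" by (intro tendsto_intros q(2))
        then have "\<forall>\<^sub>F n in sequentially. (C + 1) * norm (x - q x n) < e"
          using \<open>e > 0\<close> by (auto dest: order_tendstoD)
        then show "\<forall>\<^sub>F n in sequentially. \<forall>t\<in>V. dist (f (q x n) t) (\<psi> x t) < e"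
        proof eventually_elim
          case (elim n)
          show ?case
          proof
            fix t assume "t \<in> V"
            from near[OF q(1)[of x n] this, of x] elim show "dist (f (q x n) t) (\<psi> x t) < e"
              by (simp add: dist_real_def abs_minus_commute)
          qed
        qed
      qed
    qed (use cont q(1) in auto)
    show "\<psi> x t = f x t" if "x \<in> D" "t \<in> V" for x t using near[OF that, of x] by simp
    show "\<bar>\<psi> x t\<bar> \<le> m x t + \<epsilon> t * norm x" if t: "t \<in> V" for x t
    proof (rule LIMSEQ_le)
      show "(\<lambda>n. \<bar>f (q x n) t\<bar>) \<longlonglongrightarrow> \<bar>\<psi> x t\<bar>" by (intro tendsto_intros conv t)
      have "(\<lambda>n. m x t + C * norm (q x n - x) + \<epsilon> t * norm (q x n))
          \<longlonglongrightarrow> m x t + C * norm (x - x) + \<epsilon> t * norm x" by (intro tendsto_intros q(2))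
      then show "(\<lambda>n. m x t + C * norm (q x n - x) + \<epsilon> t * norm (q x n)) \<longlonglongrightarrow> m x t + \<epsilon> t * norm x"
        by simp
      have "\<bar>f (q x n) t\<bar> \<le> m x t + C * norm (q x n - x) + \<epsilon> t * norm (q x n)" for n
        using dom[OF q(1) t, of x n] m_diff_le[OF t, of "q x n" x] by linarith
      then show "\<exists>N. \<forall>n\<ge>N. \<bar>f (q x n) t\<bar> \<le> m x t + C * norm (q x n - x) + \<epsilon> t * norm (q x n)" by blast
    qed
  qed
qed

end

lemma subspace_closure_normed:
  fixes D :: "'a::real_normed_vector set"
  assumes D: "subspace D"
  shows "subspace (closure D)"
proof (rule subspaceI)
  show "0 \<in> closure D" using subspace_0[OF D] closure_subset by blast
  fix x y :: 'a and a :: real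
  assume x: "x \<in> closure D"
  then obtain u where u: "\<And>n. u n \<in> D" "u \<longlonglongrightarrow> x" unfolding closure_sequential by blast
  have "(\<lambda>n. a *\<^sub>R u n) \<longlonglongrightarrow> a *\<^sub>R x" by (intro tendsto_intros u(2))
  then show "a *\<^sub>R x \<in> closure D" unfolding closure_sequential
    by (intro exI[of _ "\<lambda>n. a *\<^sub>R u n"]) (simp add: subspace_scale[OF D u(1)])
  assume "y \<in> closure D"
  then obtain v where v: "\<And>n. v n \<in> D" "v \<longlonglongrightarrow> y" unfolding closure_sequential by blast
  have "(\<lambda>n. u n + v n) \<longlonglongrightarrow> x + y" by (intro tendsto_intros u(2) v(2))
  then show "x + y \<in> closure D" unfolding closure_sequential
    by (intro exI[of _ "\<lambda>n. u n + v n"]) (simp add: subspace_add[OF D u(1) v(1)])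
qed

lemma separable_dense_sequence:
  assumes "separable_space (euclidean :: 'a::topological_space topology)"
  obtains q :: "nat \<Rightarrow> 'a::topological_space" where "closure (range q) = UNIV"
proof -
  obtain Q :: "'a set" where Q: "countable Q" "closure Q = UNIV"
    using assms unfolding separable_space_def by auto
  then have "Q \<noteq> {}" by auto
  then have "range (from_nat_into Q) = Q" by (rule range_from_nat_into[OF _ Q(1)])
  then show ?thesis using that[of "from_nat_into Q"] Q(2) by simp
qed

text \<open>
  Approximate each \<open>q i\<close> by sums \<open>y + z\<close> with \<open>y \<in> Y\<close>, \<open>z \<in> Yc\<close> and collect the second summands.
\<close>

lemma dense_complement_sequence:
  fixes Y Yc :: "'x::real_normed_vector set" and q :: "nat \<Rightarrow> 'x"
  assumes q: "closure (range q) = UNIV" and Yc: "subspace Yc"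
    and dense: "closure {y + z |y z. y \<in> Y \<and> z \<in> Yc} = UNIV"
  obtains z :: "nat \<Rightarrow> 'x" where "range z \<subseteq> Yc" "closure (span (Y \<union> range z)) = UNIV"
proof -
  have "\<exists>y z. y \<in> Y \<and> z \<in> Yc \<and> dist (y + z) (q i) < 1 / real (Suc n)" for i n
  proof -
    have "q i \<in> closure {y + z |y z. y \<in> Y \<and> z \<in> Yc}" using dense by simp
    then show ?thesis unfolding closure_approachable by (force dest: spec[of _ "1 / real (Suc n)"])
  qed
  then obtain y z where yz: "\<And>i n. y i n \<in> Y" "\<And>i n. z i n \<in> Yc"
      "\<And>i n. dist (y i n + z i n) (q i) < 1 / real (Suc n)"
    by metis
  define z' where "z' k = (case prod_decode k of (i, n) \<Rightarrow> z i n)" for k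
  have z': "z' (prod_encode (i, n)) = z i n" for i n by (simp add: z'_def)
  have "q i \<in> closure (span (Y \<union> range z'))" for i
    unfolding closure_approachable
  proof (intro allI impI)
    fix e :: real assume "e > 0"
    then obtain n where n: "1 / real (Suc n) < e" using nat_approx_posE by blast
    have "y i n + z' (prod_encode (i, n)) \<in> span (Y \<union> range z')"
      using yz(1) by (intro span_add span_base) auto
    then show "\<exists>u\<in>span (Y \<union> range z'). dist u (q i) < e"
      using yz(3)[of i n] n z' by (metis less_trans)
  qed
  then have "closure (range q) \<subseteq> closure (span (Y \<union> range z'))"
    by (intro closure_minimal) auto
  moreover have "range z' \<subseteq> Yc" using yz(2) by (auto simp: z'_def split: prod.split)
  ultimately show ?thesis using that q by blast
qed

context seminorm_family
begin

text \<open>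
  Let \<open>W\<close> be the open set of points where the second alternative of local finiteness holds. Over \<open>W\<close>
  the map is extended along a sequence in \<open>Yc\<close> whose span together with \<open>Y\<close> is dense, with a slack that
  tends to \<open>0\<close> at the boundary.
  Off \<open>W\<close> the seminorm vanishes on \<open>Yc\<close>, so an extension dominated by it has to be \<open>0\<close> there. The two parts fit
  together continuously: at a point off \<open>W\<close> the values on \<open>Yc\<close> are squeezed to \<open>0\<close> by the first
  alternative.
\<close>

lemma extension_over_locally_finite_region:
  fixes q :: "nat \<Rightarrow> 'x"
  assumes q: "closure (range q) = UNIV"
    and Y: "subspace Y" and \<phi>: "\<And>t. t \<in> V \<Longrightarrow> linear_over Y (\<lambda>y. \<phi> y t)"
    and cont: "\<And>y. y \<in> Y \<Longrightarrow> continuous_on V (\<phi> y)"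
    and dom: "\<And>y t. y \<in> Y \<Longrightarrow> t \<in> V \<Longrightarrow> \<bar>\<phi> y t\<bar> \<le> m y t"
    and Yc: "subspace Yc" "Y \<inter> Yc = {0}" "closure {y + z |y z. y \<in> Y \<and> z \<in> Yc} = UNIV"
    and alt: "\<And>t0. t0 \<in> V \<Longrightarrow> locally_finite_at V m Y Yc t0"
    and \<delta>: "continuous_on V \<delta>" "\<And>t. t \<in> V \<Longrightarrow> 0 < \<delta> t" "\<And>t. t \<in> V \<Longrightarrow> \<delta> t \<le> 1"
  obtains \<psi> where "\<And>t. t \<in> V \<Longrightarrow> linear (\<lambda>x. \<psi> x t)" "\<And>x. continuous_on V (\<psi> x)"
    "\<And>y t. y \<in> Y \<Longrightarrow> t \<in> V \<Longrightarrow> \<psi> y t = \<phi> y t"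
    "\<And>x t. t \<in> V \<Longrightarrow> \<bar>\<psi> x t\<bar> \<le> m x t + \<delta> t * norm x"
proof -
  obtain z :: "nat \<Rightarrow> 'x" where z: "range z \<subseteq> Yc" "closure (span (Y \<union> range z)) = UNIV"
    by (rule dense_complement_sequence[OF q Yc(1,3)])
  define W where "W = \<Union>{U. openin (top_of_set V) U \<and> (\<exists>L A. subspace L \<and> finite A \<and>
      Y = span (L \<union> A) \<and> (\<forall>l\<in>L. \<forall>t\<in>U. m l t = 0))}"
  have Wo: "openin (top_of_set V) W" unfolding W_def by (rule openin_Union) blast
  have WV: "W \<subseteq> V" using Wo openin_imp_subset by blast
  have off: "\<exists>U. openin (top_of_set V) U \<and> t0 \<in> U \<and> (\<forall>t\<in>U. m x t < \<eta>)"
    if "t0 \<in> V" "t0 \<notin> W" "x \<in> Yc" "\<eta> > 0" for t0 x \<eta>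
    using alt[OF that(1)] that(2-4) unfolding W_def locally_finite_at_def by blast
  obtain h :: "'p \<Rightarrow> real" where h: "continuous_on V h" "\<And>t. 0 \<le> h t" "\<And>t. h t \<le> 1" "\<And>t. t \<in> V \<Longrightarrow> h t > 0 \<longleftrightarrow> t \<in> W"
    by (rule bump_function[OF Wo]) (rule that, auto)
  \<comment> \<open>The slack is positive exactly on \<open>W\<close>.\<close>
  define \<epsilon> where "\<epsilon> t = h t * \<delta> t" for t
  have \<epsilon>c: "continuous_on V \<epsilon>" unfolding \<epsilon>_def by (intro continuous_intros h(1) \<delta>(1))
  have \<epsilon>le: "\<epsilon> t \<le> \<delta> t" "0 \<le> \<epsilon> t" if "t \<in> V" for t
    using h(2,3)[of t] \<delta>(2)[OF that] by (auto simp: \<epsilon>_def mult_left_le_one_le)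
  have \<epsilon>off: "\<epsilon> t = 0" if "t \<in> V" "t \<notin> W" for t using h(2)[of t] h(4)[OF that(1)] that by (simp add: \<epsilon>_def)
  have \<epsilon>on: "0 < \<epsilon> t" if "t \<in> W" for t
    using h(4)[of t] \<delta>(2)[of t] that WV by (auto simp: \<epsilon>_def)
  interpret W: seminorm_family W m C by (rule seminorm_family_subset[OF seminorm_family_axioms WV])
  obtain D f where D: "subspace D" "Y \<subseteq> D" "D \<subseteq> span (Y \<union> range z)" "range z \<subseteq> closure D"
    and f: "\<And>t. t \<in> W \<Longrightarrow> linear_over D (\<lambda>x. f x t)" "\<And>x. x \<in> D \<Longrightarrow> continuous_on W (f x)"
    "\<And>y t. y \<in> Y \<Longrightarrow> t \<in> W \<Longrightarrow> f y t = \<phi> y t"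
    "\<And>x t. x \<in> D \<Longrightarrow> t \<in> W \<Longrightarrow> \<bar>f x t\<bar> \<le> m x t + \<epsilon> t * norm x"
  proof (rule W.extension_along_sequence[OF Y, of \<phi> \<epsilon> z])
    fix t0 assume "t0 \<in> W"
    then obtain U L A where U: "openin (top_of_set V) U" "t0 \<in> U" "subspace L" "finite A"
      "Y = span (L \<union> A)" "\<forall>l\<in>L. \<forall>t\<in>U. m l t = 0" and "U \<subseteq> W" unfolding W_def by blast
    then show "\<exists>U L A. openin (top_of_set W) U \<and> t0 \<in> U \<and> subspace L \<and> finite A \<and>
      Y = span (L \<union> A) \<and> (\<forall>l\<in>L. \<forall>t\<in>U. m l t = 0)"
      using openin_subset_trans[OF U(1) \<open>U \<subseteq> W\<close> WV] by blast
  qed (use \<phi> continuous_on_subset[OF cont WV] continuous_on_subset[OF \<epsilon>c WV] dom WV \<epsilon>on in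
      \<open>auto intro: that\<close>)
  have decomp: "\<exists>y v. y \<in> Y \<and> v \<in> Yc \<and> x = y + v" if "x \<in> D" for x
  proof -
    have "x \<in> span (Y \<union> Yc)" using that D(3) z(1) span_mono[of "Y \<union> range z" "Y \<union> Yc"] by blast
    then show ?thesis using Y Yc(1) unfolding span_Un
      by (auto simp: span_eq_iff[THEN iffD2])
  qed
  \<comment> \<open>\<open>\<pi>\<close> is the projection onto \<open>Y\<close> along \<open>Yc\<close>.\<close>
  define \<pi> where "\<pi> x = (THE y. y \<in> Y \<and> x - y \<in> Yc)" for x
  have \<pi>: "\<pi> (y + v) = y" if y: "y \<in> Y" "v \<in> Yc" for y v
    unfolding \<pi>_def
  proof (rule the_equality)
    fix y' assume y': "y' \<in> Y \<and> y + v - y' \<in> Yc"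
    then have "(y + v - y') - v \<in> Yc" "y - y' \<in> Y"
      using subspace_diff[OF Yc(1) _ y(2)] subspace_diff[OF Y y(1)] by blast+
    then have "y - y' \<in> Y \<inter> Yc" by (simp add: algebra_simps)
    then show "y' = y" using Yc(2) by auto
  qed (use y in simp)
  define g where "g x t = (if t \<in> W then f x t else \<phi> (\<pi> x) t)" for x t
  have g_off: "g (y + v) t = \<phi> y t" if "y \<in> Y" "v \<in> Yc" "t \<notin> W" for y v t
    using that \<pi> by (simp add: g_def)
  have m0: "m v t = 0" if "v \<in> Yc" "t \<in> V" "t \<notin> W" for v t
  proof (rule ccontr)
    assume "m v t \<noteq> 0"
    then have "m v t > 0" using m_nonneg[OF that(2), of v] by simp
    then show False using off[OF that(2,3,1), of "m v t"] by blast
  qed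
  have g_dom: "\<bar>g x t\<bar> \<le> m x t + \<epsilon> t * norm x" if x: "x \<in> D" and t: "t \<in> V" for x t
  proof (cases "t \<in> W")
    case True
    then show ?thesis using f(4)[OF x] by (simp add: g_def)
  next
    case False
    obtain y v where y: "y \<in> Y" "v \<in> Yc" "x = y + v" using decomp[OF x] by blast
    have "m x t = m y t" unfolding y(3) by (rule m_cong_null[OF t m0[OF y(2) t False]])
    then show ?thesis using g_off[OF y(1,2) False] dom[OF y(1) t] \<epsilon>off[OF t False] by (simp add: y(3))
  qed
  have g_lin: "linear_over D (\<lambda>x. g x t)" if t: "t \<in> V" for t
  proof (cases "t \<in> W")
    case True
    then show ?thesis using f(1) by (simp add: g_def)
  next
    case False
    show ?thesis unfolding linear_over_def
    proof (intro conjI ballI allI)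
      fix x x' assume "x \<in> D" "x' \<in> D"
      then obtain y v y' v' where y: "y \<in> Y" "v \<in> Yc" "x = y + v" "y' \<in> Y" "v' \<in> Yc" "x' = y' + v'"
        using decomp by metis
      have "g ((y + y') + (v + v')) t = \<phi> (y + y') t"
        by (rule g_off) (use y Y Yc(1) False in \<open>auto intro: subspace_add\<close>)
      then show "g (x + x') t = g x t + g x' t"
        using g_off[OF y(1,2) False] g_off[OF y(4,5) False] linear_over_add[OF \<phi>[OF t] y(1,4)]
        by (simp add: y(3,6) algebra_simps)
    next
      fix a x assume "x \<in> D"
      then obtain y v where y: "y \<in> Y" "v \<in> Yc" "x = y + v" using decomp by metis
      have "g (a *\<^sub>R y + a *\<^sub>R v) t = \<phi> (a *\<^sub>R y) t"
        by (rule g_off) (use y Y Yc(1) False in \<open>auto intro: subspace_scale\<close>)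
      then show "g (a *\<^sub>R x) t = a * g x t"
        using g_off[OF y(1,2) False] linear_over_scale[OF \<phi>[OF t] y(1)]
        by (simp add: y(3) algebra_simps)
    qed
  qed
  have g_cont: "continuous_on V (g x)" if x: "x \<in> D" for x
    unfolding continuous_on_def
  proof
    fix t0 assume t0: "t0 \<in> V"
    obtain y v where y: "y \<in> Y" "v \<in> Yc" "x = y + v" using decomp[OF x] by blast
    show "(g x \<longlongrightarrow> g x t0) (at t0 within V)"
    proof (cases "t0 \<in> W")
      case True
      obtain T where T: "open T" "W = V \<inter> T" using Wo by (auto simp: openin_open)
      have "continuous_on W (g x)" using f(2)[OF x] by (simp add: g_def cong: continuous_on_cong)
      then have "(g x \<longlongrightarrow> g x t0) (at t0 within W)" using True by (auto simp: continuous_on_def)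
      moreover have "at t0 within V = at t0 within W"
        by (rule at_within_nhd[of _ T]) (use T True in auto)
      ultimately show ?thesis by simp
    next
      case False
      have "x - y \<in> D" using subspace_diff[OF D(1) x] y(1) D(2) by blast
      then have vD: "v \<in> D" by (simp add: y(3))
      have split: "g x t = \<phi> y t + g v t" if t: "t \<in> V" for t
      proof -
        have "g x t = g y t + g v t"
          using linear_over_add[OF g_lin[OF t]] y(1,3) D(2) vD by blast
        moreover have "g y t = \<phi> y t"
          using f(3)[OF y(1)] g_off[OF y(1), of 0 t] Yc(1) by (auto simp: g_def subspace_0)
        ultimately show ?thesis by simp
      qed
      have "(g v \<longlongrightarrow> 0) (at t0 within V)"
      proof (rule tendstoI)
        fix e :: real assume e: "e > 0"
        obtain U where U: "openin (top_of_set V) U" "t0 \<in> U" "\<forall>t\<in>U. m v t < e/2"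
          using off[OF t0 False y(2), of "e/2"] e by auto
        obtain T where T: "open T" "U = V \<inter> T" using U(1) by (auto simp: openin_open)
        have "\<forall>\<^sub>F t in at t0 within V. t \<in> V \<and> t \<in> T"
          using topological_tendstoD[OF tendsto_ident_at T(1), of t0 V] U(2) T(2)
          by (auto simp: eventually_at_filter elim: eventually_mono)
        moreover have "((\<lambda>t. \<epsilon> t * norm v) \<longlongrightarrow> \<epsilon> t0 * norm v) (at t0 within V)"
          using \<epsilon>c t0 by (auto simp: continuous_on_def intro!: tendsto_mult_right)
        then have "\<forall>\<^sub>F t in at t0 within V. \<epsilon> t * norm v < e/2"
          using order_tendstoD(2)[of _ "\<epsilon> t0 * norm v" _ "e/2"] \<epsilon>off[OF t0 False] e by simp
        ultimately show "\<forall>\<^sub>F t in at t0 within V. dist (g v t) 0 < e"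
        proof eventually_elim
          case (elim t)
          then have "m v t < e/2" using U(3) T(2) by blast
          then show ?case using g_dom[OF vD, of t] elim by simp
        qed
      qed
      moreover have "(\<phi> y \<longlongrightarrow> \<phi> y t0) (at t0 within V)" using cont[OF y(1)] t0 by (auto simp: continuous_on_def)
      ultimately have "((\<lambda>t. \<phi> y t + g v t) \<longlongrightarrow> \<phi> y t0 + 0) (at t0 within V)" by (intro tendsto_add)
      moreover have "g x t0 = \<phi> y t0" using g_off[OF y(1,2) False] y(3) by simp
      ultimately show ?thesis
        using split by (subst Lim_cong_within[where g = "\<lambda>t. \<phi> y t + g v t"]) auto
    qed
  qed
  have "closure D = UNIV"
  proof -
    have "Y \<union> range z \<subseteq> closure D" using D(2,4) closure_subset by blast
    moreover have "subspace (closure D)" by (rule subspace_closure_normed[OF D(1)])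
    ultimately have "span (Y \<union> range z) \<subseteq> closure D" by (rule span_minimal)
    then have "closure (span (Y \<union> range z)) \<subseteq> closure D" by (rule closure_minimal) simp
    then show ?thesis using z(2) by auto
  qed
  then obtain \<psi> where \<psi>: "\<And>t. t \<in> V \<Longrightarrow> linear (\<lambda>x. \<psi> x t)" "\<And>x. continuous_on V (\<psi> x)"
    "\<And>x t. x \<in> D \<Longrightarrow> t \<in> V \<Longrightarrow> \<psi> x t = g x t"
    "\<And>x t. t \<in> V \<Longrightarrow> \<bar>\<psi> x t\<bar> \<le> m x t + \<epsilon> t * norm x"
  proof (rule extension_to_closure[OF D(1) _ g_lin g_cont _ g_dom])
    show "\<epsilon> t \<le> 1" if "t \<in> V" for t using \<epsilon>le(1)[OF that] \<delta>(3)[OF that] by linarith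
  qed (use that in auto)
  show ?thesis
  proof (rule that[OF \<psi>(1,2)])
    show "\<psi> y t = \<phi> y t" if "y \<in> Y" "t \<in> V" for y t
      using \<psi>(3)[of y t] that D(2) f(3)[of y t] g_off[of y 0 t] Yc(1)
      by (auto simp: g_def subspace_0)
    show "\<bar>\<psi> x t\<bar> \<le> m x t + \<delta> t * norm x" if "t \<in> V" for x t
      using \<psi>(4)[OF that, of x] mult_right_mono[OF \<epsilon>le(1)[OF that], of "norm x"] by simp
  qed
qed

end

section \<open>Extensions under a locally balanced seminorm\<close>

text \<open>
  Linear maps that extend \<open>\<phi>\<close> and obey the bound form a convex set at each point, so the local
  solutions can be averaged. The constants \<open>C k\<close> record their norm bounds, which may be unbounded over
  the cover.
\<close>

theorem locally_balanced_extension: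
  fixes S :: "'p::{metric_space,second_countable_topology} set"
    and m :: "'x::real_normed_vector \<Rightarrow> 'p \<Rightarrow> real" and q :: "nat \<Rightarrow> 'x"
  assumes q: "closure (range q) = UNIV"
    and Y: "subspace Y" and \<phi>: "\<And>t. t \<in> S \<Longrightarrow> linear_over Y (\<lambda>y. \<phi> y t)"
    and cont: "\<And>y. y \<in> Y \<Longrightarrow> continuous_on S (\<phi> y)"
    and \<delta>: "continuous_on S \<delta>" "\<And>t. t \<in> S \<Longrightarrow> 0 < \<delta> t"
    and loc: "\<And>t0. t0 \<in> S \<Longrightarrow> \<exists>V m' C Yc. openin (top_of_set S) V \<and> t0 \<in> V \<and> seminorm_family V m' C \<and>
      (\<forall>x. \<forall>t\<in>V. m' x t \<le> m x t) \<and> (\<forall>y\<in>Y. \<forall>t\<in>V. \<bar>\<phi> y t\<bar> \<le> m' y t) \<and>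
      subspace Yc \<and> Y \<inter> Yc = {0} \<and> closure {y + z |y z. y \<in> Y \<and> z \<in> Yc} = UNIV \<and>
      (\<forall>t\<in>V. locally_finite_at V m' Y Yc t)"
  obtains \<psi> where "\<And>t. t \<in> S \<Longrightarrow> linear (\<lambda>x. \<psi> x t)" "\<And>x. continuous_on S (\<psi> x)"
    "\<And>y t. y \<in> Y \<Longrightarrow> t \<in> S \<Longrightarrow> \<psi> y t = \<phi> y t"
    "\<And>x t. t \<in> S \<Longrightarrow> \<bar>\<psi> x t\<bar> \<le> m x t + \<delta> t * norm x"
proof (cases "S = {}")
  case True
  show ?thesis by (rule that[of "\<lambda>_ _. 0"]) (use True in auto)
next
  case False
  define good where "good V d \<longleftrightarrow> (case d of (C, \<psi>) \<Rightarrow> 1 \<le> C \<and> (\<forall>t\<in>V. linear (\<lambda>x. \<psi> x t)) \<and>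
    (\<forall>x. continuous_on V (\<psi> x)) \<and> (\<forall>y\<in>Y. \<forall>t\<in>V. \<psi> y t = \<phi> y t) \<and>
    (\<forall>x. \<forall>t\<in>V. \<bar>\<psi> x t\<bar> \<le> m x t + \<delta> t * norm x) \<and> (\<forall>x. \<forall>t\<in>V. \<bar>\<psi> x t\<bar> \<le> C * norm x))"
    for V and d :: "real \<times> ('x \<Rightarrow> 'p \<Rightarrow> real)"
  have local: "\<exists>V d. openin (top_of_set S) V \<and> t0 \<in> V \<and> good V d" if t0: "t0 \<in> S" for t0
  proof -
    obtain V m' C Yc where V: "openin (top_of_set S) V" "t0 \<in> V" and sem: "seminorm_family V m' C"
      and le': "\<forall>x. \<forall>t\<in>V. m' x t \<le> m x t" and dom': "\<forall>y\<in>Y. \<forall>t\<in>V. \<bar>\<phi> y t\<bar> \<le> m' y t"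
      and Yc: "subspace Yc" "Y \<inter> Yc = {0}" "closure {y + z |y z. y \<in> Y \<and> z \<in> Yc} = UNIV"
      and alt': "\<forall>t\<in>V. locally_finite_at V m' Y Yc t"
      using loc[OF t0] by (elim exE conjE) (rule that)
    have le: "m' x t \<le> m x t" if "t \<in> V" for x t using le' that by blast
    have dom: "\<bar>\<phi> y t\<bar> \<le> m' y t" if "y \<in> Y" "t \<in> V" for y t using dom' that by blast
    have alt: "locally_finite_at V m' Y Yc t" if "t \<in> V" for t using alt' that by blast
    have VS: "V \<subseteq> S" using V(1) openin_imp_subset by blast
    define \<delta>' where "\<delta>' t = min 1 (\<delta> t)" for t
    have \<delta>': "continuous_on V \<delta>'" unfolding \<delta>'_def
      by (intro continuous_intros continuous_on_subset[OF \<delta>(1) VS])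
    have \<delta>'b: "0 < \<delta>' t" "\<delta>' t \<le> 1" "\<delta>' t \<le> \<delta> t" if "t \<in> V" for t
      using \<delta>(2)[of t] that VS by (auto simp: \<delta>'_def)
    obtain \<psi> where \<psi>: "\<And>t. t \<in> V \<Longrightarrow> linear (\<lambda>x. \<psi> x t)" "\<And>x. continuous_on V (\<psi> x)"
      "\<And>y t. y \<in> Y \<Longrightarrow> t \<in> V \<Longrightarrow> \<psi> y t = \<phi> y t"
      "\<And>x t. t \<in> V \<Longrightarrow> \<bar>\<psi> x t\<bar> \<le> m' x t + \<delta>' t * norm x"
    proof (rule seminorm_family.extension_over_locally_finite_region[OF sem q Y _ _ dom Yc alt \<delta>' \<delta>'b(1,2)])
      show "linear_over Y (\<lambda>y. \<phi> y t)" if "t \<in> V" for t using \<phi> that VS by blast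
      show "continuous_on V (\<phi> y)" if "y \<in> Y" for y by (rule continuous_on_subset[OF cont[OF that] VS])
    qed (use that in auto)
    have b1: "\<bar>\<psi> x t\<bar> \<le> m x t + \<delta> t * norm x" if t: "t \<in> V" for x t
      using \<psi>(4)[OF t, of x] le[OF t, of x] mult_right_mono[OF \<delta>'b(3)[OF t], of "norm x"] by simp
    have b2: "\<bar>\<psi> x t\<bar> \<le> (\<bar>C\<bar> + 1) * norm x" if t: "t \<in> V" for x t
    proof -
      have "m' x t \<le> C * norm x" by (rule seminorm_family.bound[OF sem t])
      also have "\<dots> \<le> \<bar>C\<bar> * norm x" by (intro mult_right_mono) auto
      finally show ?thesis
        using \<psi>(4)[OF t, of x] mult_right_mono[OF \<delta>'b(2)[OF t], of "norm x"] by (simp add: distrib_right)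
    qed
    have "good V (\<bar>C\<bar> + 1, \<psi>)" unfolding good_def using \<psi>(1-3) b1 b2 by simp
    then show ?thesis using V by blast
  qed
  obtain U :: "nat \<Rightarrow> 'p set" and d where U: "\<And>k. openin (top_of_set S) (U k)" and d: "\<And>k. good (U k) (d k)"
    and cov: "S \<subseteq> (\<Union>k. U k)"
    by (rule countable_subcover_with_data[OF False local]) (assumption, rule that, auto)
  define C where "C k = fst (d k)" for k
  define \<psi> where "\<psi> k = snd (d k)" for k
  have G: "1 \<le> C k" "t \<in> U k \<Longrightarrow> linear (\<lambda>x. \<psi> k x t)" "continuous_on (U k) (\<psi> k x)"
    "y \<in> Y \<Longrightarrow> t \<in> U k \<Longrightarrow> \<psi> k y t = \<phi> y t"
    "t \<in> U k \<Longrightarrow> \<bar>\<psi> k x t\<bar> \<le> m x t + \<delta> t * norm x" "t \<in> U k \<Longrightarrow> \<bar>\<psi> k x t\<bar> \<le> C k * norm x" for k t x y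
    using d[of k] unfolding good_def C_def \<psi>_def by (auto split: prod.splits)
  obtain w where w: "\<And>k t. t \<in> S \<Longrightarrow> 0 \<le> w k t" "\<And>k t. t \<in> S \<Longrightarrow> t \<notin> U k \<Longrightarrow> w k t = 0"
    "\<And>t. t \<in> S \<Longrightarrow> (\<lambda>k. w k t) sums 1"
    "\<And>f N. (\<And>k. continuous_on (U k) (f k)) \<Longrightarrow> (\<And>k t. t \<in> U k \<Longrightarrow> \<bar>f k t\<bar> \<le> C k * N) \<Longrightarrow>
       continuous_on S (\<lambda>t. \<Sum>k. w k t * f k t) \<and> (\<forall>t\<in>S. summable (\<lambda>k. w k t * f k t))"
    by (rule countable_partition_weights[OF U cov, of C]) (use G(1) in auto)
  define \<Psi> where "\<Psi> x t = (\<Sum>k. w k t * \<psi> k x t)" for x t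
  have \<Psi>c: "continuous_on S (\<Psi> x)" and sm: "\<And>t. t \<in> S \<Longrightarrow> summable (\<lambda>k. w k t * \<psi> k x t)" for x
    using w(4)[of "\<lambda>k. \<psi> k x" "norm x", OF G(3) G(6)] by (auto simp: \<Psi>_def[abs_def])
  show ?thesis
  proof
    show "linear (\<lambda>x. \<Psi> x t)" if t: "t \<in> S" for t
    proof (rule linearI)
      fix x y
      have "w k t * \<psi> k (x + y) t = w k t * \<psi> k x t + w k t * \<psi> k y t" for k
        by (cases "t \<in> U k") (simp_all add: linear_add[OF G(2)] distrib_left w(2)[OF t])
      then show "\<Psi> (x + y) t = \<Psi> x t + \<Psi> y t"
        using suminf_add[OF sm[OF t] sm[OF t], of x y] by (simp add: \<Psi>_def)
    next
      fix a x
      have "w k t * \<psi> k (a *\<^sub>R x) t = a * (w k t * \<psi> k x t)" for k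
        by (cases "t \<in> U k") (simp_all add: linear_scale[OF G(2)] w(2)[OF t])
      then have "\<Psi> (a *\<^sub>R x) t = (\<Sum>k. a * (w k t * \<psi> k x t))" unfolding \<Psi>_def by presburger
      then show "\<Psi> (a *\<^sub>R x) t = a *\<^sub>R \<Psi> x t"
        using suminf_mult[OF sm[OF t, of x], of a] by (simp add: \<Psi>_def)
    qed
    show "\<Psi> y t = \<phi> y t" if y: "y \<in> Y" and t: "t \<in> S" for y t
    proof -
      have "w k t * \<psi> k y t = w k t * \<phi> y t" for k
        by (cases "t \<in> U k") (simp_all add: G(4)[OF y] w(2)[OF t])
      then have "\<Psi> y t = (\<Sum>k. w k t * \<phi> y t)" unfolding \<Psi>_def by presburger
      then show ?thesis using sums_mult2[OF w(3)[OF t], of "\<phi> y t"] by (simp add: sums_iff)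
    qed
    show "\<bar>\<Psi> x t\<bar> \<le> m x t + \<delta> t * norm x" if t: "t \<in> S" for x t
      unfolding \<Psi>_def
    proof (rule convex_series_bound(2)[OF w(1)[OF t] w(3)[OF t]])
      fix k assume "w k t \<noteq> 0"
      then show "\<bar>\<psi> k x t\<bar> \<le> m x t + \<delta> t * norm x" using w(2)[OF t] G(5) by blast
    qed
  qed (rule \<Psi>c)
qed

section \<open>Characters that attain the norm\<close>

lemma scaleC_one: "scaleC 1 x = (x :: 'b::cstar_algebra)"
  using scaleC_of_real[of 1 x] by simp

lemma scaleC_zero_left: "scaleC 0 x = (0 :: 'b::cstar_algebra)"
  using scaleC_of_real[of 0 x] by simp

lemma scaleC_minus_one: "scaleC (- 1) x = - (x :: 'b::cstar_algebra)"
  using scaleC_of_real[of "-1" x] by simp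

lemma scaleC_minus_left: "scaleC (- c) x = - scaleC c (x :: 'b::cstar_algebra)"
  using scaleC_scaleC[of "-1" c x] by (simp add: scaleC_minus_one)

lemma scaleC_diff_left: "scaleC (c - d) x = scaleC c x - scaleC d (x :: 'b::cstar_algebra)"
  using scaleC_add_left[of c "- d" x] by (simp add: scaleC_minus_left)

lemma scaleC_diff_right: "scaleC c (x - y) = scaleC c x - scaleC c (y :: 'b::cstar_algebra)"
  using scaleC_add_right[of c "x - y" y] by simp

text \<open>
  With \<open>h = x\<^sup>* x\<close> one has \<open>(x x)\<^sup>* (x x) = h\<^sup>* h\<close> by commutativity, so two uses of the
  \<open>C\<^sup>*\<close>-identity give the claim.
\<close>

lemma norm_square: "norm (x * x) = (norm (x :: 'b::comm_cstar_algebra))\<^sup>2"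
proof -
  define h where "h = star x * x"
  have hs: "star h = h" by (simp add: h_def star_mult star_star)
  have "(norm (x * x))\<^sup>2 = norm (star (x * x) * (x * x))" by (simp add: cstar_identity)
  also have "star (x * x) * (x * x) = star h * h" unfolding hs by (simp add: h_def star_mult mult_ac)
  also have "norm \<dots> = (norm h)\<^sup>2" by (rule cstar_identity)
  also have "norm h = (norm x)\<^sup>2" unfolding h_def by (rule cstar_identity)
  finally have "(norm (x * x))\<^sup>2 = ((norm x)\<^sup>2)\<^sup>2" .
  then show ?thesis by (rule power2_eq_imp_eq) auto
qed

text \<open>
  The condition \<open>p (x\<^sup>2) = p(x)\<^sup>2\<close> holds for the norm and passes to the limits and infima below; full
  multiplicativity comes from minimality.
\<close>

definition uniform_seminorm :: "('b::comm_cstar_algebra \<Rightarrow> real) \<Rightarrow> bool" where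
  "uniform_seminorm p \<longleftrightarrow> (\<forall>x y. p (x + y) \<le> p x + p y) \<and> (\<forall>c x. p (scaleC c x) = cmod c * p x) \<and>
     (\<forall>x. p x \<le> norm x) \<and> (\<forall>x y. p (x * y) \<le> p x * p y) \<and> (\<forall>x. p (x * x) = (p x)\<^sup>2)"

lemma uniform_seminormD:
  assumes "uniform_seminorm p"
  shows "p (x + y) \<le> p x + p y" "p (scaleC c x) = cmod c * p x" "p x \<le> norm x"
    "p (x * y) \<le> p x * p y" "p (x * x) = (p x)\<^sup>2" "0 \<le> p x" "p (- x) = p x"
    "p (x - y) \<le> p x + p y"
proof -
  show a: "p (x + y) \<le> p x + p y" "p (scaleC c x) = cmod c * p x" "p x \<le> norm x"
    "p (x * y) \<le> p x * p y" "p (x * x) = (p x)\<^sup>2" for x y c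
    using assms by (auto simp: uniform_seminorm_def)
  show m: "p (- x) = p x" for x using a(2)[of "-1" x] by (simp add: scaleC_minus_one)
  have "p 0 = 0" using a(2)[of 0 0] by (simp add: scaleC_zero_left)
  then show "0 \<le> p x" using a(1)[of x "- x"] m[of x] by simp
  show "p (x - y) \<le> p x + p y" using a(1)[of x "- y"] m[of y] by simp
qed

lemma uniform_seminorm_norm: "uniform_seminorm (norm :: 'b::comm_cstar_algebra \<Rightarrow> real)"
  by (simp add: uniform_seminorm_def norm_triangle_ineq norm_scaleC norm_mult_ineq norm_square)

text \<open>
  The product \<open>a c\<^sup>n\<close>; in an algebra without unit \<open>c\<^sup>0\<close> has no meaning of its own.
\<close>

definition times_power :: "'b::comm_ring \<Rightarrow> nat \<Rightarrow> 'b \<Rightarrow> 'b" where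
  "times_power c n a = ((\<lambda>y. y * c) ^^ n) a"

lemma times_power_0 [simp]: "times_power c 0 a = a"
  by (simp add: times_power_def)

lemma times_power_Suc: "times_power c (Suc n) a = times_power c n a * c"
  by (simp add: times_power_def)

lemma times_power_mult: "times_power c (i + j) (a * b) = times_power c i a * times_power c j b"
proof (induction j)
  case 0
  show ?case by (induction i) (simp_all add: times_power_Suc mult_ac)
next
  case (Suc j)
  then show ?case by (simp add: times_power_Suc mult_ac)
qed

lemma times_power_mult_left: "times_power c n (a * b) = times_power c n a * b"
  using times_power_mult[of c n 0 a b] by simp

lemma times_power_mult_self: "times_power c n (a * c) = times_power c (Suc n) a"
  by (simp add: times_power_mult_left times_power_Suc)

lemma times_power_add: "times_power c n (a + b) = times_power c n a + times_power c n b"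
  by (induction n) (simp_all add: times_power_Suc distrib_right)

lemma times_power_scaleC:
  "times_power c n (scaleC k a) = scaleC k (times_power c n (a :: 'b::comm_cstar_algebra))"
  by (induction n) (simp_all add: times_power_Suc mult_scaleC_left)

text \<open>
  The standard way to make a power-multiplicative seminorm multiplicative with respect to one
  element: \<open>q a\<close> is the limit of the decreasing sequence \<open>p (a c\<^sup>n) / p(c)\<^sup>n\<close>. The last clause keeps
  invariance under multiplication by a fixed element from one localization to the next.
\<close>

lemma localized_seminorm:
  fixes p :: "'b::comm_cstar_algebra \<Rightarrow> real"
  assumes p: "uniform_seminorm p" and c: "p c > 0"
  obtains q where "uniform_seminorm q" "\<And>a. q a \<le> p a" "\<And>a. q (a * c) = p c * q a" "q c = p c"
    "\<And>a b. (\<And>x. p (x * b) = p x) \<Longrightarrow> q (a * b) = q a"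
proof -
  note P = uniform_seminormD[OF p]
  define r where "r n a = p (times_power c n a) / p c ^ n" for n a
  have r0: "0 \<le> r n a" for n a using P(6) c by (simp add: r_def)
  have dec: "decseq (\<lambda>n. r n a)" for a
  proof (rule decseq_SucI)
    fix n
    have "p (times_power c n a * c) / p c ^ Suc n \<le> (p (times_power c n a) * p c) / p c ^ Suc n"
      using c by (intro divide_right_mono P(4)) simp
    then show "r (Suc n) a \<le> r n a" using c by (simp add: r_def times_power_Suc)
  qed
  define q where "q a = lim (\<lambda>n. r n a)" for a
  have lim: "(\<lambda>n. r n a) \<longlonglongrightarrow> q a" for a
    unfolding q_def using decseq_convergent[OF dec[of a], of 0] r0
    by (metis limI)
  have qp: "q a \<le> p a" for a
  proof (rule LIMSEQ_le_const2[OF lim], intro exI allI impI)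
    show "r n a \<le> p a" for n using decseqD[OF dec[of a], of 0 n] by (simp add: r_def)
  qed
  have r2: "r (n + n) (a * b) = p (times_power c n a * times_power c n b) / (p c ^ n * p c ^ n)" for n a b
    by (simp add: r_def times_power_mult power_add)
  have lim2: "(\<lambda>n. r (n + n) a) \<longlonglongrightarrow> q a" for a
    using LIMSEQ_subseq_LIMSEQ[OF lim[of a], of "\<lambda>n. n + n"] by (auto simp: strict_mono_def o_def)
  have uq: "uniform_seminorm q" unfolding uniform_seminorm_def
  proof (intro conjI allI)
    fix x y
    show "q (x + y) \<le> q x + q y"
    proof (rule LIMSEQ_le[OF lim tendsto_add[OF lim lim]], intro exI allI impI)
      fix n :: nat
      show "r n (x + y) \<le> r n x + r n y"
        using divide_right_mono[OF P(1)[of "times_power c n x" "times_power c n y"], of "p c ^ n"] c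
        by (simp add: r_def times_power_add add_divide_distrib)
    qed
    show "q x \<le> norm x" using qp[of x] P(3)[of x] by simp
    show "q (x * y) \<le> q x * q y"
    proof (rule LIMSEQ_le[OF lim2 tendsto_mult[OF lim lim]], intro exI allI impI)
      fix n :: nat
      show "r (n + n) (x * y) \<le> r n x * r n y"
        unfolding r2
        using divide_right_mono[OF P(4)[of "times_power c n x" "times_power c n y"], of "p c ^ n * p c ^ n"] c
        by (simp add: r_def)
    qed
    have "r (n + n) (x * x) = (r n x)\<^sup>2" for n
      unfolding r2 by (simp add: r_def P(5) power2_eq_square)
    then have "(\<lambda>n. r (n + n) (x * x)) \<longlonglongrightarrow> (q x)\<^sup>2" using tendsto_power[OF lim[of x], of 2] by simp
    then show "q (x * x) = (q x)\<^sup>2" using LIMSEQ_unique[OF lim2] by blast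
  next
    fix k x
    have "(\<lambda>n. r n (scaleC k x)) \<longlonglongrightarrow> cmod k * q x"
      using tendsto_mult_left[OF lim[of x], of "cmod k"] by (simp add: r_def times_power_scaleC P(2))
    then show "q (scaleC k x) = cmod k * q x" using LIMSEQ_unique[OF lim] by blast
  qed
  have mult: "q (a * c) = p c * q a" for a
  proof -
    have "r n (a * c) = p c * r (Suc n) a" for n
      using c by (simp add: r_def times_power_mult_self)
    moreover have "(\<lambda>n. p c * r (Suc n) a) \<longlonglongrightarrow> p c * q a"
      by (intro tendsto_mult_left LIMSEQ_Suc lim)
    ultimately show ?thesis using LIMSEQ_unique[OF lim[of "a * c"]] by simp
  qed
  \<comment> \<open>Squaring \<open>c\<^sup>n\<^sup>+\<^sup>1\<close> doubles the exponent, so \<open>p (c\<^sup>N) = p(c)\<^sup>N\<close> for powers \<open>N\<close> of \<open>2\<close>; monotonicity fills the gaps.\<close>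
  have pow: "r (2 ^ k - 1) c = p c" for k
  proof (induction k)
    case (Suc k)
    define n :: nat where "n = 2 ^ k - 1"
    have "(1::nat) \<le> 2 ^ k" by simp
    then have n: "2 ^ Suc k - 1 = Suc (n + n)" unfolding n_def power_Suc by linarith
    have "times_power c (Suc (n + n)) c = times_power c n c * times_power c n c"
      using times_power_mult[of c n n c c] times_power_mult_self[of c "n + n" c] by simp
    then have "r (Suc (n + n)) c = (r n c)\<^sup>2 / p c"
      by (simp add: r_def P(5) power2_eq_square power_add)
    then show ?case using Suc c unfolding n by (simp add: n_def power2_eq_square)
  qed (simp add: r_def)
  have "r n c = p c" for n
  proof (rule antisym)
    show "r n c \<le> p c" using decseqD[OF dec[of c], of 0 n] by (simp add: r_def)
    have "n \<le> 2 ^ n - 1" using less_exp[of n] by linarith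
    then show "p c \<le> r n c" using decseqD[OF dec[of c], of n "2 ^ n - 1"] pow[of n] by simp
  qed
  then have qc: "q c = p c" using LIMSEQ_unique[OF lim[of c]] by simp
  have "q (a * b) = q a" if "\<And>x. p (x * b) = p x" for a b
    using LIMSEQ_unique[OF lim[of "a * b"]] lim[of a] that by (simp add: r_def times_power_mult_left)
  then show ?thesis using that[OF uq qp mult qc] by blast
qed

text \<open>
  The conditions on \<open>e\<close> keep these seminorms nonzero: they make \<open>e\<close> act like a unit, which is the role
  of \<open>p 1 = 1\<close> in a unital algebra.
\<close>

definition pointed_seminorms :: "'b::comm_cstar_algebra \<Rightarrow> ('b \<Rightarrow> real) set" where
  "pointed_seminorms e = {p. uniform_seminorm p \<and> p e = 1 \<and> (\<forall>a. p (a * e) = p a)}"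

text \<open>
  In a chain the values at finitely many points can be approximated by one and the same member, so
  every relation between finitely many values passes to the infimum.
\<close>

lemma chain_infimum_pointed_seminorm:
  fixes e :: "'b::comm_cstar_algebra"
  assumes C: "C \<noteq> {}" "C \<subseteq> pointed_seminorms e"
    and chain: "\<And>p p'. p \<in> C \<Longrightarrow> p' \<in> C \<Longrightarrow> (\<forall>a. p a \<le> p' a) \<or> (\<forall>a. p' a \<le> p a)"
  shows "(\<lambda>a. INF p\<in>C. p a) \<in> pointed_seminorms e"
proof -
  define u where "u a = (INF p\<in>C. p a)" for a
  have U: "uniform_seminorm p" "p e = 1" "\<And>a. p (a * e) = p a" if "p \<in> C" for p
    using that C(2) by (auto simp: pointed_seminorms_def)
  have bdd: "bdd_below ((\<lambda>p. p a) ` C)" for a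
    by (rule bdd_belowI2[of _ 0]) (use U(1) uniform_seminormD(6) in blast)
  have lower: "u a \<le> p a" if "p \<in> C" for p a unfolding u_def by (rule cINF_lower[OF bdd that])
  have approx: "\<exists>p\<in>C. p a < u a + \<eta>" if "\<eta> > 0" for a and \<eta> :: real
    using cINF_less_iff[OF C(1) bdd, of a "u a + \<eta>"] that by (simp add: u_def)
  have least: "\<exists>p\<in>C. (\<forall>a. p a \<le> p1 a) \<and> (\<forall>a. p a \<le> p2 a)" if "p1 \<in> C" "p2 \<in> C" for p1 p2
    using chain[OF that] that by blast
  have seq: "\<exists>P. (\<forall>n. P n \<in> C) \<and> (\<lambda>n. P n x) \<longlonglongrightarrow> u x \<and> (\<lambda>n. P n y) \<longlonglongrightarrow> u y \<and> (\<lambda>n. P n z) \<longlonglongrightarrow> u z"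
    for x y z
  proof -
    have "\<exists>p\<in>C. p x < u x + 1 / real (Suc n) \<and> p y < u y + 1 / real (Suc n) \<and> p z < u z + 1 / real (Suc n)" for n
    proof -
      obtain p1 p2 p3 where p: "p1 \<in> C" "p1 x < u x + 1 / real (Suc n)" "p2 \<in> C" "p2 y < u y + 1 / real (Suc n)"
        "p3 \<in> C" "p3 z < u z + 1 / real (Suc n)"
        using approx[of "1 / real (Suc n)"] by (meson of_nat_0_less_iff zero_less_Suc zero_less_divide_1_iff)
      obtain p12 where p12: "p12 \<in> C" "\<forall>a. p12 a \<le> p1 a" "\<forall>a. p12 a \<le> p2 a" using least[OF p(1,3)] by blast
      obtain p where "p \<in> C" "\<forall>a. p a \<le> p12 a" "\<forall>a. p a \<le> p3 a" using least[OF p12(1) p(5)] by blast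
      then show ?thesis using p p12 by (meson order_le_less_trans order_trans)
    qed
    then obtain P where P: "\<And>n. P n \<in> C" "\<And>n. P n x < u x + 1 / real (Suc n)"
      "\<And>n. P n y < u y + 1 / real (Suc n)" "\<And>n. P n z < u z + 1 / real (Suc n)" by metis
    have "(\<lambda>n. P n v) \<longlonglongrightarrow> u v" if "\<And>n. P n v < u v + 1 / real (Suc n)" for v
    proof (rule tendsto_sandwich[OF _ _ tendsto_const])
      show "(\<lambda>n. u v + 1 / real (Suc n)) \<longlonglongrightarrow> u v"
        using tendsto_add[OF tendsto_const[of "u v"] LIMSEQ_inverse_real_of_nat] by (simp add: inverse_eq_divide)
    qed (use lower[OF P(1)] that in \<open>auto intro!: always_eventually less_imp_le\<close>)
    then show ?thesis using P by blast
  qed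
  have "uniform_seminorm u" unfolding uniform_seminorm_def
  proof (intro conjI allI)
    fix x y
    obtain P where P: "\<And>n. P n \<in> C" "(\<lambda>n. P n x) \<longlonglongrightarrow> u x" "(\<lambda>n. P n y) \<longlonglongrightarrow> u y"
      "(\<lambda>n. P n (x + y)) \<longlonglongrightarrow> u (x + y)" using seq[of x y "x + y"] by blast
    show "u (x + y) \<le> u x + u y"
      by (rule LIMSEQ_le[OF P(4) tendsto_add[OF P(2,3)]]) (use uniform_seminormD(1)[OF U(1)[OF P(1)]] in blast)
    show "u x \<le> norm x"
      using lower[OF P(1)[of 0], of x] uniform_seminormD(3)[OF U(1)[OF P(1)[of 0]], of x] by linarith
    obtain P where P: "\<And>n. P n \<in> C" "(\<lambda>n. P n x) \<longlonglongrightarrow> u x" "(\<lambda>n. P n y) \<longlonglongrightarrow> u y"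
      "(\<lambda>n. P n (x * y)) \<longlonglongrightarrow> u (x * y)" using seq[of x y "x * y"] by blast
    show "u (x * y) \<le> u x * u y"
      by (rule LIMSEQ_le[OF P(4) tendsto_mult[OF P(2,3)]]) (use uniform_seminormD(4)[OF U(1)[OF P(1)]] in blast)
    obtain P where P: "\<And>n. P n \<in> C" "(\<lambda>n. P n x) \<longlonglongrightarrow> u x" "(\<lambda>n. P n (x * x)) \<longlonglongrightarrow> u (x * x)"
      using seq[of x x "x * x"] by blast
    have "(\<lambda>n. P n (x * x)) \<longlonglongrightarrow> (u x)\<^sup>2"
      using tendsto_power[OF P(2), of 2] uniform_seminormD(5)[OF U(1)[OF P(1)]] by simp
    then show "u (x * x) = (u x)\<^sup>2" using LIMSEQ_unique[OF P(3)] by blast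
  next
    fix k x
    obtain P where P: "\<And>n. P n \<in> C" "(\<lambda>n. P n x) \<longlonglongrightarrow> u x" "(\<lambda>n. P n (scaleC k x)) \<longlonglongrightarrow> u (scaleC k x)"
      using seq[of x x "scaleC k x"] by blast
    have "(\<lambda>n. P n (scaleC k x)) \<longlonglongrightarrow> cmod k * u x"
      using tendsto_mult_left[OF P(2), of "cmod k"] uniform_seminormD(2)[OF U(1)[OF P(1)]] by simp
    then show "u (scaleC k x) = cmod k * u x" using LIMSEQ_unique[OF P(3)] by blast
  qed
  moreover have "(INF p\<in>C. p e) = (INF p\<in>C. 1)" by (rule INF_cong) (simp_all add: U(2))
  then have "u e = 1" using C(1) by (simp add: u_def)
  moreover have "u (a * e) = u a" for a unfolding u_def by (rule INF_cong) (simp_all add: U(3))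
  ultimately show ?thesis unfolding pointed_seminorms_def u_def by blast
qed

text \<open>
  A minimal seminorm in \<open>pointed_seminorms e\<close> coincides with all its localizations and is therefore
  multiplicative. The set is not empty: it contains the localization of the norm at \<open>e\<close>.
\<close>

lemma multiplicative_pointed_seminorm:
  fixes e :: "'b::comm_cstar_algebra"
  assumes e: "norm e = 1"
  obtains p where "uniform_seminorm p" "p e = 1" "\<And>a b. p (a * b) = p a * p b"
proof -
  define A where "A = pointed_seminorms e"
  define R where "R p p' \<longleftrightarrow> (\<forall>a. p' a \<le> p a)" for p p' :: "'b \<Rightarrow> real"
  obtain p0 where p0: "uniform_seminorm p0" "\<And>a. p0 (a * e) = norm e * p0 a" "p0 e = norm e"
    using localized_seminorm[OF uniform_seminorm_norm, of e] e by (metis zero_less_one)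
  have "p0 \<in> A" using p0 e by (simp add: A_def pointed_seminorms_def)
  have "\<exists>m\<in>A. \<forall>a\<in>A. R m a \<longrightarrow> a = m"
  proof (rule predicate_Zorn)
    show "partial_order_on A (relation_of R A)"
      by (rule partial_order_on_relation_ofI) (auto simp: R_def fun_eq_iff intro: order_trans antisym)
    fix C assume C: "C \<in> Chains (relation_of R A)"
    show "\<exists>u\<in>A. \<forall>a\<in>C. R a u"
    proof (cases "C = {}")
      case True then show ?thesis using \<open>p0 \<in> A\<close> by blast
    next
      case False
      have CA: "C \<subseteq> A" and ch: "\<And>p p'. p \<in> C \<Longrightarrow> p' \<in> C \<Longrightarrow> R p p' \<or> R p' p"
        using C by (auto simp: Chains_def relation_of_def)
      have "(\<lambda>a. INF p\<in>C. p a) \<in> A" unfolding A_def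
        by (rule chain_infimum_pointed_seminorm[OF False]) (use CA ch in \<open>auto simp: A_def R_def\<close>)
      moreover have "R p (\<lambda>a. INF p\<in>C. p a)" if p: "p \<in> C" for p unfolding R_def
      proof
        fix a
        have "bdd_below ((\<lambda>p. p a) ` C)"
        proof (rule bdd_belowI2[of _ 0])
          fix p assume "p \<in> C"
          then have "uniform_seminorm p" using CA by (auto simp: A_def pointed_seminorms_def)
          then show "0 \<le> p a" by (rule uniform_seminormD(6))
        qed
        then show "(INF p\<in>C. p a) \<le> p a" using p by (rule cINF_lower)
      qed
      ultimately show ?thesis by blast
    qed
  qed
  then obtain p where pA: "p \<in> A" and min: "\<And>q. q \<in> A \<Longrightarrow> (\<And>a. q a \<le> p a) \<Longrightarrow> q = p"
    unfolding R_def by blast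
  have p: "uniform_seminorm p" "p e = 1" "\<And>a. p (a * e) = p a"
    using pA by (auto simp: A_def pointed_seminorms_def)
  have "p (a * c) = p a * p c" for a c
  proof (cases "p c > 0")
    case True
    obtain q where q: "uniform_seminorm q" "\<And>a. q a \<le> p a" "\<And>a. q (a * c) = p c * q a" "q c = p c"
      "\<And>a b. (\<And>x. p (x * b) = p x) \<Longrightarrow> q (a * b) = q a" 
      using localized_seminorm[OF p(1) True] by metis
    have qe: "q (a * e) = q a" for a by (rule q(5)[OF p(3)])
    \<comment> \<open>\<open>q (c e)\<close> equals \<open>q c = p c\<close> by invariance and \<open>p c * q e\<close> by localization at \<open>c\<close>.\<close>
    have "p c * q e = p c" using q(3)[of e] qe[of c] q(4) by (simp add: mult.commute)
    then have "q e = 1" using True by simp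
    then have "q \<in> A" using q(1) qe by (simp add: A_def pointed_seminorms_def)
    then have "q = p" by (rule min[OF _ q(2)])
    then show ?thesis using q(3)[of a] by (simp add: mult.commute)
  next
    case False
    then have "p c = 0" using uniform_seminormD(6)[OF p(1), of c] by simp
    then show ?thesis
      using uniform_seminormD(4)[OF p(1), of a c] uniform_seminormD(6)[OF p(1), of "a * c"] by simp
  qed
  then show ?thesis using that p by blast
qed

text \<open>
  An elementary form of the Gelfand--Mazur theorem. Let \<open>M\<close> be the minimum of \<open>F \<mu> = p (a - \<mu> e)\<close> and
  let it be attained at \<open>\<mu>\<close>, with \<open>x = a - \<mu> e\<close>. If \<open>M > 0\<close>, factor \<open>x\<^sup>N - \<nu>\<^sup>N e\<^sup>N\<close> for \<open>N = 2\<^sup>j\<close> into linear factors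
  \<open>x - \<zeta> \<nu> e\<close>. All of them have value at least \<open>M\<close>, while the product is at most \<open>M\<^sup>N + |\<nu>|\<^sup>N\<close>; letting
  \<open>N\<close> grow, \<open>F (\<mu> + \<nu>) = M\<close> whenever \<open>|\<nu>| < M\<close>. Repeated steps of length \<open>M / 2\<close> show that \<open>F\<close> takes
  the value \<open>M\<close> arbitrarily far away, although \<open>F\<close> tends to infinity.
\<close>

lemma gelfand_mazur_seminorm:
  fixes p :: "'b::comm_cstar_algebra \<Rightarrow> real"
  assumes p: "uniform_seminorm p" and e: "p e = 1" and mult: "\<And>a b. p (a * b) = p a * p b"
  shows "\<exists>\<mu>. p (a - scaleC \<mu> e) = 0"
proof -
  note P = uniform_seminormD[OF p]
  define F where "F \<mu> = p (a - scaleC \<mu> e)" for \<mu>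
  have Flip: "F \<mu> \<le> F \<nu> + cmod (\<nu> - \<mu>)" for \<mu> \<nu>
  proof -
    have "F \<mu> = p ((a - scaleC \<nu> e) + scaleC (\<nu> - \<mu>) e)" by (simp add: F_def scaleC_diff_left)
    then show ?thesis
      unfolding F_def[of \<nu>] using P(1)[of "a - scaleC \<nu> e" "scaleC (\<nu> - \<mu>) e"] P(2)[of "\<nu> - \<mu>" e] e by simp
  qed
  have Fgrow: "cmod \<mu> \<le> F \<mu> + p a" for \<mu>
    using P(8)[of a "a - scaleC \<mu> e"] P(2)[of \<mu> e] e by (simp add: F_def)
  have Fcont: "continuous_on UNIV F"
  proof (rule continuous_onI)
    fix x e :: real and \<mu> :: complex assume "e > 0"
    show "\<exists>d>0. \<forall>\<nu>\<in>UNIV. dist \<nu> x' < d \<longrightarrow> dist (F \<nu>) (F x') \<le> e" for x'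
    proof (intro exI[of _ e] conjI ballI impI \<open>e > 0\<close>)
      fix \<nu> assume "dist \<nu> x' < e"
      then show "dist (F \<nu>) (F x') \<le> e"
        using Flip[of \<nu> x'] Flip[of x' \<nu>] by (simp add: dist_real_def dist_norm norm_minus_commute)
    qed
  qed
  define B where "B = 2 * p a"
  have "\<exists>\<mu>\<in>cball 0 B. \<forall>\<nu>\<in>cball 0 B. F \<mu> \<le> F \<nu>"
    by (rule continuous_attains_inf) (use P(6)[of a] in \<open>auto simp: B_def intro: continuous_on_subset[OF Fcont]\<close>)
  then obtain \<mu>0 where "\<forall>\<nu>\<in>cball 0 B. F \<mu>0 \<le> F \<nu>" by blast
  then have \<mu>0: "F \<mu>0 \<le> F \<nu>" if "cmod \<nu> \<le> B" for \<nu> using that by simp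
  have F0: "F 0 = p a" by (simp add: F_def scaleC_zero_left)
  have "0 \<le> B" using P(6)[of a] by (simp add: B_def)
  have min: "F \<mu>0 \<le> F \<nu>" for \<nu>
  proof (cases "cmod \<nu> \<le> B")
    case False
    then have "p a \<le> F \<nu>" using Fgrow[of \<nu>] by (simp add: B_def)
    moreover have "F \<mu>0 \<le> F 0" using \<open>0 \<le> B\<close> by (intro \<mu>0) simp
    ultimately show ?thesis using F0 by simp
  qed (rule \<mu>0)
  define M where "M = F \<mu>0"
  have M0: "0 \<le> M" using P(6) by (simp add: M_def F_def)
  have "M = 0"
  proof (rule ccontr)
    assume "M \<noteq> 0"
    then have Mp: "M > 0" using M0 by simp
    define sq :: "'b \<Rightarrow> 'b" where "sq y = y * y" for y
    have spread: "F (\<mu> + \<nu>) = M" if \<mu>: "F \<mu> = M" and \<nu>: "cmod \<nu> < M" for \<mu> \<nu>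
    proof -
      define x where "x = a - scaleC \<mu> e"
      have factor: "(sq ^^ Suc j) x - scaleC (\<kappa>\<^sup>2) ((sq ^^ Suc j) e)
          = ((sq ^^ j) x - scaleC \<kappa> ((sq ^^ j) e)) * ((sq ^^ j) x - scaleC (- \<kappa>) ((sq ^^ j) e))" for j \<kappa>
        by (simp add: sq_def algebra_simps scaleC_minus_left mult_scaleC_left mult_scaleC_right
            scaleC_scaleC power2_eq_square)
      have lower: "M ^ (2 ^ j) \<le> p ((sq ^^ j) x - scaleC \<kappa> ((sq ^^ j) e))" for j \<kappa>
      proof (induction j arbitrary: \<kappa>)
        case 0
        have "x - scaleC \<kappa> e = a - scaleC (\<mu> + \<kappa>) e" by (simp add: x_def scaleC_add_left)
        then show ?case using min[of "\<mu> + \<kappa>"] by (simp add: M_def F_def)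
      next
        case (Suc j)
        have "M ^ (2 ^ Suc j) = M ^ (2 ^ j) * M ^ (2 ^ j)" by (simp add: power_add[symmetric] mult_2)
        also have "\<dots> \<le> p ((sq ^^ j) x - scaleC (csqrt \<kappa>) ((sq ^^ j) e)) *
            p ((sq ^^ j) x - scaleC (- csqrt \<kappa>) ((sq ^^ j) e))"
          using Suc M0 P(6) by (intro mult_mono) auto
        also have "\<dots> = p ((sq ^^ Suc j) x - scaleC ((csqrt \<kappa>)\<^sup>2) ((sq ^^ Suc j) e))"
          unfolding factor mult ..
        finally show ?case by simp
      qed
      have grow: "F (\<mu> + \<nu>) / M * M ^ (2 ^ j) \<le> p ((sq ^^ j) x - scaleC (\<nu> ^ (2 ^ j)) ((sq ^^ j) e))" for j
      proof (induction j)
        case 0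
        have "x - scaleC \<nu> e = a - scaleC (\<mu> + \<nu>) e" by (simp add: x_def scaleC_add_left)
        then show ?case using Mp by (simp add: F_def)
      next
        case (Suc j)
        have "F (\<mu> + \<nu>) / M * M ^ (2 ^ Suc j) = (F (\<mu> + \<nu>) / M * M ^ (2 ^ j)) * M ^ (2 ^ j)"
          by (simp add: power_add[symmetric] mult_2)
        also have "\<dots> \<le> p ((sq ^^ j) x - scaleC (\<nu> ^ (2 ^ j)) ((sq ^^ j) e)) *
            p ((sq ^^ j) x - scaleC (- (\<nu> ^ (2 ^ j))) ((sq ^^ j) e))"
          using Suc M0 P(6) lower by (intro mult_mono) auto
        also have "\<dots> = p ((sq ^^ Suc j) x - scaleC ((\<nu> ^ (2 ^ j))\<^sup>2) ((sq ^^ Suc j) e))"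
          unfolding factor mult ..
        also have "(\<nu> ^ (2 ^ j))\<^sup>2 = \<nu> ^ (2 ^ Suc j)" by (simp add: power_mult[symmetric] mult.commute)
        finally show ?case .
      qed
      have psq: "p ((sq ^^ j) y) = p y ^ (2 ^ j)" for j y
        by (induction j) (simp_all add: sq_def mult power_add[symmetric] mult_2)
      have up: "F (\<mu> + \<nu>) / M \<le> 1 + (cmod \<nu> / M) ^ (2 ^ j)" for j
      proof -
        have "F (\<mu> + \<nu>) / M * M ^ (2 ^ j) \<le> p ((sq ^^ j) x) + p (scaleC (\<nu> ^ (2 ^ j)) ((sq ^^ j) e))"
          using grow[of j] P(8) order_trans by blast
        also have "\<dots> = M ^ (2 ^ j) + cmod \<nu> ^ (2 ^ j)"
          using \<mu> e by (simp add: psq P(2) norm_power x_def F_def)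
        finally have "F (\<mu> + \<nu>) / M \<le> (M ^ (2 ^ j) + cmod \<nu> ^ (2 ^ j)) / M ^ (2 ^ j)"
          using Mp by (subst pos_le_divide_eq) auto
        then show ?thesis using Mp by (simp add: add_divide_distrib power_divide)
      qed
      have "(\<lambda>j. (cmod \<nu> / M) ^ (2 ^ j)) \<longlonglongrightarrow> 0"
        using LIMSEQ_subseq_LIMSEQ[OF LIMSEQ_realpow_zero[of "cmod \<nu> / M"], of "\<lambda>j. 2 ^ j"] \<nu> Mp
        by (auto simp: o_def strict_mono_def)
      from tendsto_add[OF tendsto_const[of 1] this]
      have "(\<lambda>j. 1 + (cmod \<nu> / M) ^ (2 ^ j)) \<longlonglongrightarrow> 1" by simp
      then have "F (\<mu> + \<nu>) / M \<le> 1" by (rule LIMSEQ_le_const) (use up in auto)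
      then have "F (\<mu> + \<nu>) \<le> M" using Mp by (simp add: field_simps)
      then show ?thesis using min[of "\<mu> + \<nu>"] by (simp add: M_def)
    qed
    have all: "F (\<mu>0 + of_real (real n * (M / 2))) = M" for n
    proof (induction n)
      case (Suc n)
      have "cmod (of_real (M / 2)) < M" using Mp unfolding norm_of_real by simp
      moreover have "\<mu>0 + of_real (real (Suc n) * (M / 2))
          = \<mu>0 + of_real (real n * (M / 2)) + of_real (M / 2)"
        by (simp add: algebra_simps add_divide_distrib)
      ultimately show ?case using spread[OF Suc] by metis
    qed (simp add: M_def)
    obtain n :: nat where n: "(M + p a + cmod \<mu>0) / (M / 2) < real n" using reals_Archimedean2 by blast
    then have big: "M + p a + cmod \<mu>0 < real n * (M / 2)" using Mp by (simp add: field_simps)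
    have "real n * (M / 2) = cmod (of_real (real n * (M / 2)))" unfolding norm_of_real using Mp by simp
    also have "\<dots> \<le> cmod (\<mu>0 + of_real (real n * (M / 2))) + cmod \<mu>0"
      using norm_triangle_ineq4[of "\<mu>0 + of_real (real n * (M / 2))" \<mu>0] by simp
    also have "\<dots> \<le> M + p a + cmod \<mu>0" using Fgrow[of "\<mu>0 + of_real (real n * (M / 2))"] all[of n] by simp
    finally show False using big by simp
  qed
  then show ?thesis unfolding M_def F_def by blast
qed

text \<open>
  For a multiplicative seminorm \<open>p\<close> the algebra modulo the null space of \<open>p\<close> is one-dimensional, spanned
  by the normalised \<open>e\<close>, and the coordinate with respect to \<open>e\<close> is a character up to a factor of
  modulus \<open>1\<close>.
\<close>

lemma character_attaining_norm:
  fixes b :: "'b::comm_cstar_algebra"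
  assumes "b \<noteq> 0"
  obtains t where "t \<in> spectrum" "cmod (t b) = norm b"
proof -
  define e where "e = (1 / norm b) *\<^sub>R b"
  have e: "norm e = 1" using assms by (simp add: e_def)
  have b: "b = scaleC (of_real (norm b)) e" using assms by (simp add: e_def scaleC_of_real)
  obtain p where p: "uniform_seminorm p" "p e = 1" "\<And>a b. p (a * b) = p a * p b"
    using multiplicative_pointed_seminorm[OF e] by blast
  note P = uniform_seminormD[OF p(1)]
  obtain \<theta> where \<theta>: "\<And>a. p (a - scaleC (\<theta> a) e) = 0" using gelfand_mazur_seminorm[OF p] by metis
  have uniq: "\<theta> a = \<mu>" if "p (a - scaleC \<mu> e) = 0" for a \<mu>
  proof -
    have "cmod (\<mu> - \<theta> a) = p (scaleC (\<mu> - \<theta> a) e)" by (simp add: P(2) p(2))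
    also have "scaleC (\<mu> - \<theta> a) e = (a - scaleC (\<theta> a) e) - (a - scaleC \<mu> e)" by (simp add: scaleC_diff_left)
    also have "p \<dots> \<le> 0" using P(8)[of "a - scaleC (\<theta> a) e" "a - scaleC \<mu> e"] \<theta> that by simp
    finally show ?thesis by simp
  qed
  have null_add: "p (x + y) = 0" if "p x = 0" "p y = 0" for x y using P(1)[of x y] P(6)[of "x + y"] that by simp
  have add: "\<theta> (a + c) = \<theta> a + \<theta> c" for a c
  proof (rule uniq)
    have "a + c - scaleC (\<theta> a + \<theta> c) e = (a - scaleC (\<theta> a) e) + (c - scaleC (\<theta> c) e)"
      by (simp add: scaleC_add_left)
    then show "p (a + c - scaleC (\<theta> a + \<theta> c) e) = 0" using null_add[OF \<theta> \<theta>, of a c] by metis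
  qed
  have scale: "\<theta> (scaleC k a) = k * \<theta> a" for k a
  proof (rule uniq)
    have "scaleC k a - scaleC (k * \<theta> a) e = scaleC k (a - scaleC (\<theta> a) e)"
      by (simp add: scaleC_diff_right scaleC_scaleC)
    then show "p (scaleC k a - scaleC (k * \<theta> a) e) = 0" using \<theta>[of a] by (simp add: P(2))
  qed
  \<comment> \<open>\<open>\<theta>\<close> is multiplicative up to the unimodular factor \<open>s\<close>, and \<open>s * \<theta>\<close> is multiplicative.\<close>
  define s where "s = \<theta> (e * e)"
  have mult: "\<theta> (a * c) = s * \<theta> a * \<theta> c" for a c
  proof (rule uniq)
    have "a * c - scaleC (s * \<theta> a * \<theta> c) e = (a - scaleC (\<theta> a) e) * c +
        (scaleC (\<theta> a) e * (c - scaleC (\<theta> c) e) + scaleC (\<theta> a * \<theta> c) (e * e - scaleC s e))"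
      by (simp add: algebra_simps scaleC_diff_right mult_scaleC_left mult_scaleC_right scaleC_scaleC)
    also have "p \<dots> = 0"
      by (intro null_add) (use \<theta> in \<open>simp_all add: p(3) P(2) s_def\<close>)
    finally show "p (a * c - scaleC (s * \<theta> a * \<theta> c) e) = 0" .
  qed
  have \<theta>e: "\<theta> e = 1" by (rule uniq) (use P(2)[of 0 0] in \<open>simp add: scaleC_one scaleC_zero_left\<close>)
  have "cmod s = 1"
  proof -
    have "p (scaleC s e) \<le> p (e * e) + p (e * e - scaleC s e)" using P(8)[of "e * e" "e * e - scaleC s e"] by simp
    moreover have "p (e * e) \<le> p (e * e - scaleC s e) + p (scaleC s e)" using P(1)[of "e * e - scaleC s e" "scaleC s e"] by simp
    ultimately show ?thesis using \<theta>[of "e * e"] by (simp add: s_def P(2) p)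
  qed
  define t where "t a = s * \<theta> a" for a
  have "cmod (t e) = 1" using \<theta>e \<open>cmod s = 1\<close> by (simp add: t_def)
  show ?thesis
  proof
    have "t e \<noteq> 0" using \<open>cmod (t e) = 1\<close> by auto
    then show "t \<in> spectrum"
      by (auto simp: spectrum_def t_def add scale mult algebra_simps)
    show "cmod (t b) = norm b"
      by (subst b) (use \<open>cmod (t e) = 1\<close> in \<open>simp add: t_def scale norm_mult\<close>)
  qed
qed

section \<open>The Gelfand transform of a commutative algebra\<close>

lemma star_minus: "star (- x) = - star (x :: 'b::cstar_algebra)"
  using star_scaleC[of "-1" x] by (simp add: scaleC_minus_one)

lemma star_diff: "star (x - y) = star x - star (y :: 'b::cstar_algebra)"
  using star_add[of x "- y"] by (simp add: star_minus)

text \<open>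
  The spectrum together with the zero functional.
\<close>

definition characters :: "('b::comm_cstar_algebra \<Rightarrow> complex) set" where
  "characters = {t. (\<forall>a b. t (a + b) = t a + t b) \<and> (\<forall>c b. t (scaleC c b) = c * t b) \<and>
     (\<forall>a b. t (a * b) = t a * t b)}"

lemma characters_eq: "characters = insert (\<lambda>_. 0) spectrum"
  by (auto simp: characters_def spectrum_def fun_eq_iff)

lemma characterD:
  assumes "t \<in> characters"
  shows "t (a + b) = t a + t b" "t (scaleC c b) = c * t b" "t (a * b) = t a * t b"
    "t (r *\<^sub>R b) = r *\<^sub>R t b" "t (- b) = - t b" "t (a - b) = t a - t b" "t 0 = 0"
proof -
  show A: "t (a + b) = t a + t b" "t (scaleC c b) = c * t b" "t (a * b) = t a * t b" for a b c
    using assms by (auto simp: characters_def)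
  show "t (r *\<^sub>R b) = r *\<^sub>R t b" using A(2)[of "of_real r" b] by (simp add: scaleC_of_real scaleR_conv_of_real)
  show M: "t (- b) = - t b" for b using A(2)[of "-1" b] by (simp add: scaleC_minus_one)
  show "t (a - b) = t a - t b" using A(1)[of a "- b"] M[of b] by simp
  show "t 0 = 0" using A(2)[of 0 b] by (simp add: scaleC_zero_left)
qed

text \<open>
  If \<open>t y = 1\<close> and \<open>\<parallel>y\<parallel> < 1\<close>, the sum \<open>w = y + y\<^sup>2 + \<dots>\<close> satisfies \<open>w = w y + y\<close>, hence
  \<open>t w = t w + 1\<close>.
\<close>

lemma character_contractive:
  assumes t: "t \<in> characters"
  shows "cmod (t x) \<le> norm x"
proof (rule ccontr)
  note T = characterD[OF t]
  assume "\<not> ?thesis"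
  then have big: "norm x < cmod (t x)" by simp
  then have nz: "t x \<noteq> 0" by (metis norm_ge_zero norm_zero not_less)
  define y where "y = scaleC (1 / t x) x"
  have ty: "t y = 1" using nz by (simp add: y_def T(2))
  have ny: "norm y < 1" using big nz by (simp add: y_def norm_scaleC norm_divide)
  define u where "u n = times_power y n y" for n
  have un: "norm (u n) \<le> norm y * norm y ^ n" for n
  proof (induction n)
    case (Suc n)
    have "norm (u (Suc n)) \<le> norm (u n) * norm y"
      by (simp add: u_def times_power_Suc norm_mult_ineq)
    also have "\<dots> \<le> (norm y * norm y ^ n) * norm y" by (intro mult_right_mono Suc) simp
    finally show ?case by (simp add: mult_ac)
  qed (simp add: u_def)
  have su: "summable u"
    by (rule summable_comparison_test'[of "\<lambda>n. norm y * norm y ^ n"])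
       (use un ny in \<open>auto intro!: summable_mult summable_geometric\<close>)
  define w where "w = suminf u"
  have "w = (\<Sum>n. u (Suc n)) + u 0" unfolding w_def using suminf_split_head[OF su] by simp
  also have "(\<Sum>n. u (Suc n)) = (\<Sum>n. u n * y)" by (simp add: u_def times_power_Suc)
  also have "\<dots> = w * y" unfolding w_def by (rule suminf_mult2[OF su, symmetric])
  finally have "w = w * y + y" by (simp add: u_def)
  then have "t w = t w * t y + t y" using T(1,3) by metis
  then show False using ty by simp
qed

text \<open>
  Arens' trick without a unit. The \<open>C\<^sup>*\<close>-identity bounds the operator \<open>x \<mapsto> a x + \<i> n x\<close> by
  \<open>sqrt (\<parallel>a\<parallel>\<^sup>2 + n\<^sup>2)\<close>; \<open>t\<close> turns it into multiplication by \<open>t a + \<i> n\<close>, so iterating it shows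
  that the modulus of this number obeys the same bound. As \<open>n\<close> may be any real number, this leaves no
  room for an imaginary part of \<open>t a\<close>.
\<close>

lemma character_real_on_self_adjoint:
  assumes t: "t \<in> characters" and a: "star a = a"
  shows "Im (t a) = 0"
proof (cases "\<forall>b. t b = 0")
  case True then show ?thesis by simp
next
  case False
  then obtain x0 where x0: "t x0 \<noteq> 0" by blast
  note T = characterD[OF t]
  have key: "cmod (t a + \<i> * of_real n) \<le> sqrt ((norm a)\<^sup>2 + n\<^sup>2)" for n :: real
  proof -
    define op where "op x = a * x + scaleC (\<i> * of_real n) x" for x
    define R where "R = sqrt ((norm a)\<^sup>2 + n\<^sup>2)"
    have R0: "0 \<le> R" by (simp add: R_def)
    have step: "norm (op x) \<le> R * norm x" for x
    proof -
      have "star (op x) * op x = (a * a) * (star x * x) + scaleC (of_real (n\<^sup>2)) (star x * x)"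
        by (simp add: op_def star_add star_mult star_scaleC a algebra_simps mult_scaleC_left
            mult_scaleC_right scaleC_scaleC power2_eq_square scaleC_minus_left)
      then have "(norm (op x))\<^sup>2 = norm ((a * a) * (star x * x) + scaleC (of_real (n\<^sup>2)) (star x * x))"
        by (simp only: cstar_identity[symmetric])
      also have "\<dots> \<le> norm (a * a) * norm (star x * x) + n\<^sup>2 * norm (star x * x)"
        by (rule norm_triangle_le) (simp add: norm_scaleC norm_mult_ineq norm_power)
      also have "\<dots> = (R * norm x)\<^sup>2"
        by (simp add: cstar_identity norm_square R_def power_mult_distrib distrib_right)
      finally show ?thesis by (rule power2_le_imp_le) (use R0 in simp)
    qed
    have iter: "norm ((op ^^ N) x0) \<le> R ^ N * norm x0" for N
    proof (induction N)
      case (Suc N)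
      have "norm ((op ^^ Suc N) x0) \<le> R * norm ((op ^^ N) x0)" using step by simp
      also have "\<dots> \<le> R * (R ^ N * norm x0)" by (intro mult_left_mono Suc R0)
      finally show ?case by (simp add: mult_ac)
    qed simp
    define A where "A = cmod (t a + \<i> * of_real n)"
    have "t ((op ^^ N) x0) = (t a + \<i> * of_real n) ^ N * t x0" for N
      by (induction N) (simp_all add: op_def T algebra_simps)
    then have "A ^ N * cmod (t x0) \<le> R ^ N * norm x0" for N
      using order_trans[OF character_contractive[OF t] iter[of N]] by (simp add: A_def norm_mult norm_power)
    note grow = this
    show ?thesis unfolding A_def[symmetric] R_def[symmetric]
    proof (rule ccontr)
      assume "\<not> A \<le> R"
      then have AR: "R < A" by simp
      then have Ap: "0 < A" using R0 by linarith
      have "cmod (t x0) \<le> (R / A) ^ N * norm x0" for N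
        using grow[of N] Ap by (simp add: power_divide field_simps)
      moreover have "(\<lambda>N. (R / A) ^ N * norm x0) \<longlonglongrightarrow> 0 * norm x0"
        by (intro tendsto_intros LIMSEQ_realpow_zero) (use R0 AR Ap in auto)
      ultimately have "cmod (t x0) \<le> 0 * norm x0" by (intro LIMSEQ_le_const) auto
      then show False using x0 by simp
    qed
  qed
  define \<beta> where "\<beta> = Im (t a)"
  have ineq: "\<beta>\<^sup>2 + 2 * \<beta> * n \<le> (norm a)\<^sup>2" for n
  proof -
    have "(cmod (t a + \<i> * of_real n))\<^sup>2 \<le> (norm a)\<^sup>2 + n\<^sup>2"
      using power_mono[OF key[of n], of 2] by simp
    then have "(Re (t a))\<^sup>2 + (\<beta> + n)\<^sup>2 \<le> (norm a)\<^sup>2 + n\<^sup>2" by (simp add: cmod_power2 \<beta>_def)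
    moreover have "(\<beta> + n)\<^sup>2 = \<beta>\<^sup>2 + 2 * \<beta> * n + n\<^sup>2" by (simp add: power2_sum)
    ultimately show ?thesis using zero_le_power2[of "Re (t a)"] by linarith
  qed
  have "\<beta> = 0"
  proof (rule ccontr)
    assume "\<beta> \<noteq> 0"
    then show False using ineq[of "((norm a)\<^sup>2 + 1) / (2 * \<beta>)"] zero_le_power2[of \<beta>] by simp
  qed
  then show ?thesis by (simp add: \<beta>_def)
qed

lemma self_adjoint_decomposition:
  fixes b :: "'b::cstar_algebra"
  obtains h k where "star h = h" "star k = k" "b = h + scaleC \<i> k" "star b = h - scaleC \<i> k"
proof -
  define h where "h = scaleC (1/2) (b + star b)"
  define k where "k = scaleC (- \<i> / 2) (b - star b)"
  have half: "scaleC (1/2) x + scaleC (1/2) x = x" for x :: 'b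
    using scaleC_add_left[of "1/2" "1/2" x] by (simp add: scaleC_one)
  have ik: "scaleC \<i> k = scaleC (1/2) (b - star b)" by (simp add: k_def scaleC_scaleC)
  show ?thesis
  proof
    show "star h = h" by (simp add: h_def star_scaleC star_add star_star add.commute)
    have "star k = scaleC (\<i> / 2) (star b - b)" by (simp add: k_def star_scaleC star_diff star_star)
    also have "\<dots> = k" using scaleC_minus_left[of "\<i> / 2" "b - star b"]
      by (simp add: k_def scaleC_diff_right)
    finally show "star k = k" .
    show "b = h + scaleC \<i> k" unfolding ik h_def using half[of b] by (simp add: scaleC_add_right scaleC_diff_right)
    show "star b = h - scaleC \<i> k" unfolding ik h_def using half[of "star b"] by (simp add: scaleC_add_right scaleC_diff_right)
  qed
qed

lemma character_star:
  assumes t: "t \<in> characters"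
  shows "t (star b) = cnj (t b)"
proof -
  obtain h k where hk: "star h = h" "star k = k" "b = h + scaleC \<i> k" "star b = h - scaleC \<i> k"
    by (rule self_adjoint_decomposition)
  have "Im (t h) = 0" "Im (t k) = 0" using character_real_on_self_adjoint[OF t] hk by auto
  then show ?thesis by (subst hk(3), subst hk(4)) (simp add: characterD[OF t] complex_eq_iff)
qed

lemma norm_le_if_characters_le:
  fixes b :: "'b::comm_cstar_algebra"
  assumes "\<And>t. t \<in> spectrum \<Longrightarrow> cmod (t b) \<le> r" "0 \<le> r"
  shows "norm b \<le> r"
proof (cases "b = 0")
  case False
  then obtain t where "t \<in> spectrum" "cmod (t b) = norm b" by (rule character_attaining_norm)
  then show ?thesis using assms(1) by metis
qed (use assms(2) in simp)

lemma eq_if_characters_eq: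
  fixes b c :: "'b::comm_cstar_algebra"
  assumes "\<And>t. t \<in> spectrum \<Longrightarrow> t b = t c"
  shows "b = c"
proof -
  have "cmod (t (b - c)) \<le> 0" if "t \<in> spectrum" for t
    using assms[OF that] that characterD(6)[of t b c] by (simp add: characters_eq)
  then have "norm (b - c) \<le> 0" by (rule norm_le_if_characters_le) auto
  then show ?thesis by simp
qed

lemma bounded_linear_character: "t \<in> characters \<Longrightarrow> bounded_linear t"
  by (rule bounded_linear_intro[of _ 1]) (auto simp: characterD character_contractive)

text \<open>
  A closed subset of a product of discs. Adding the zero functional turns the spectrum into its
  one-point compactification.
\<close>

lemma compact_characters: "compact (characters :: ('b::comm_cstar_algebra \<Rightarrow> complex) set)"
proof -
  define P :: "('b \<Rightarrow> complex) set" where "P = PiE UNIV (\<lambda>b. cball 0 (norm b))"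
  have "compactin (product_topology (\<lambda>i. euclidean) UNIV) P" unfolding P_def compactin_PiE by auto
  then have "compact P" by (simp add: euclidean_product_topology)
  moreover have "closed (characters :: ('b \<Rightarrow> complex) set)" unfolding characters_def
    by (intro closed_Collect_conj closed_Collect_all closed_Collect_eq continuous_intros) auto
  moreover have "characters \<subseteq> P" using character_contractive by (auto simp: P_def PiE_def)
  ultimately show ?thesis by (metis compact_Int_closed inf.absorb2)
qed

text \<open>
  Characters are determined by their values on a dense sequence, so the compact space of characters
  embeds in the metrizable space of complex sequences.
\<close>

lemma characters_homeomorphic_image:
  fixes b :: "nat \<Rightarrow> 'b::comm_cstar_algebra"
  assumes b: "closure (range b) = UNIV"
  obtains g where "homeomorphism characters ((\<lambda>t k. t (b k)) ` characters) (\<lambda>t k. t (b k)) g"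
proof -
  have cont: "continuous_on characters (\<lambda>t k. t (b k))"
    by (intro continuous_on_coordinatewise_then_product continuous_on_subset[OF continuous_on_product_coordinates]) simp
  have "inj_on (\<lambda>t k. t (b k)) characters"
  proof (rule inj_onI)
    fix s t :: "'b \<Rightarrow> complex"
    assume s: "s \<in> characters" and t: "t \<in> characters" and eq: "(\<lambda>k. s (b k)) = (\<lambda>k. t (b k))"
    have "closed {x. s x = t x}"
      by (intro closed_Collect_eq linear_continuous_on bounded_linear_character s t)
    moreover have "range b \<subseteq> {x. s x = t x}" using eq by (auto dest: fun_cong)
    ultimately have "closure (range b) \<subseteq> {x. s x = t x}" by (intro closure_minimal)
    then show "s = t" using b by auto
  qed
  then show ?thesis using homeomorphism_compact[OF compact_characters cont refl] that by blast
qed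

text \<open>
  Stone--Weierstrass on the one-point compactification \<open>X\<close> gives approximations by Gelfand transforms
  plus constants; the constants are small because \<open>f\<close> vanishes at infinity. As the transform is
  isometric, the approximating elements form a Cauchy sequence.
\<close>

lemma gelfand_surjective:
  fixes b :: "nat \<Rightarrow> 'b::comm_cstar_algebra" and f :: "(nat \<Rightarrow> complex) \<Rightarrow> real"
  defines "j \<equiv> (\<lambda>(t :: 'b \<Rightarrow> complex) k. t (b k))"
  assumes b: "closure (range b) = UNIV" and f: "continuous_on (j ` spectrum) f"
    and vanish: "\<And>\<epsilon>. \<epsilon> > 0 \<Longrightarrow> \<exists>K. compact K \<and> K \<subseteq> j ` spectrum \<and> (\<forall>p\<in>j ` spectrum - K. \<bar>f p\<bar> < \<epsilon>)"
  obtains a where "star a = a" "\<And>t. t \<in> spectrum \<Longrightarrow> t a = of_real (f (j t))"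
proof -
  obtain i where hom: "homeomorphism characters (j ` characters) j i"
    using characters_homeomorphic_image[OF b] unfolding j_def by blast
  define X where "X = j ` characters"
  have i: "\<And>t. t \<in> characters \<Longrightarrow> i (j t) = t" "\<And>p. p \<in> X \<Longrightarrow> j (i p) = p"
    "\<And>p. p \<in> X \<Longrightarrow> i p \<in> characters" and ic: "continuous_on X i" and jc: "continuous_on characters j"
    using hom unfolding homeomorphism_def X_def by auto
  have Xc: "compact X" unfolding X_def by (rule compact_continuous_image[OF jc compact_characters])
  \<comment> \<open>\<open>orig\<close> is the point at infinity, and \<open>F\<close> extends \<open>f\<close> by \<open>0\<close> there.\<close>
  define orig where "orig = j (\<lambda>_. 0)"
  have XS: "X = insert orig (j ` spectrum)" by (simp add: X_def orig_def characters_eq)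
  have oX: "orig \<in> X" by (simp add: XS)
  have z: "(\<lambda>_. 0) \<in> characters" by (simp add: characters_eq)
  have o_notin: "orig \<notin> j ` spectrum"
  proof
    assume "orig \<in> j ` spectrum"
    then obtain t where t: "t \<in> spectrum" "j t = orig" by auto
    have "t \<in> characters" using t(1) by (simp add: characters_eq)
    then have "i orig = t" using i(1) t(2) by metis
    moreover have "i orig = (\<lambda>_. 0)" unfolding orig_def by (rule i(1)[OF z])
    ultimately have "t = (\<lambda>_. 0)" by simp
    then show False using t(1) by (simp add: spectrum_def)
  qed
  define F where "F p = (if p = orig then 0 else f p)" for p
  have Fc: "continuous_on X F" unfolding continuous_on_def
  proof
    fix p assume p: "p \<in> X"
    show "(F \<longlongrightarrow> F p) (at p within X)"
    proof (cases "p = orig")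
      case False
      then have pS: "p \<in> j ` spectrum" using p XS by blast
      have "continuous_on (j ` spectrum) F \<longleftrightarrow> continuous_on (j ` spectrum) f"
        by (rule continuous_on_cong) (use o_notin in \<open>auto simp: F_def\<close>)
      then have "continuous_on (j ` spectrum) F" using f by simp
      then have "(F \<longlongrightarrow> F p) (at p within j ` spectrum)" using pS by (auto simp: continuous_on_def)
      moreover have "at p within X = at p within j ` spectrum"
        by (rule at_within_nhd[of _ "- {orig}"]) (use False XS o_notin in auto)
      ultimately show ?thesis by simp
    next
      case True
      show ?thesis
      proof (rule tendstoI)
        fix e :: real assume "e > 0"
        obtain K where K: "compact K" "K \<subseteq> j ` spectrum" "\<forall>p\<in>j ` spectrum - K. \<bar>f p\<bar> < e"
          using vanish[OF \<open>e > 0\<close>] by blast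
        have "open (- K)" using K(1) by (simp add: compact_imp_closed open_Compl)
        moreover have "p \<in> - K" using True K(2) o_notin by blast
        ultimately have "\<forall>\<^sub>F q in at p within X. q \<in> - K" by (rule topological_tendstoD[OF tendsto_ident_at])
        moreover have "\<forall>\<^sub>F q in at p within X. q \<in> X" by (simp add: eventually_at_filter)
        ultimately show "\<forall>\<^sub>F q in at p within X. dist (F q) (F p) < e"
        proof eventually_elim
          case (elim q)
          then show ?case using K(3) XS True \<open>e > 0\<close> by (auto simp: F_def)
        qed
      qed
    qed
  qed
  define Rg :: "((nat \<Rightarrow> complex) \<Rightarrow> real) set"
    where "Rg = {g. \<exists>a c. star a = a \<and> (\<forall>p\<in>X. g p = Re (i p a) + c)}"
  have im0: "Im (i p a) = 0" if "p \<in> X" "star a = a" for p a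
    by (rule character_real_on_self_adjoint[OF i(3)[OF that(1)] that(2)])
  interpret function_ring_on Rg X
  proof
    show "compact X" by (rule Xc)
    show "continuous_on X g" if g: "g \<in> Rg" for g
    proof -
      obtain a c where a: "\<forall>p\<in>X. g p = Re (i p a) + c" using g by (auto simp: Rg_def)
      have "continuous_on X (\<lambda>p. i p a)" by (rule continuous_on_product_then_coordinatewise[OF ic])
      then have "continuous_on X (\<lambda>p. Re (i p a) + c)" by (intro continuous_intros)
      moreover have "continuous_on X g \<longleftrightarrow> continuous_on X (\<lambda>p. Re (i p a) + c)"
        by (rule continuous_on_cong) (use a in auto)
      ultimately show ?thesis by simp
    qed
    fix g h assume "g \<in> Rg" "h \<in> Rg"
    then obtain a c a' c' where g: "star a = a" "\<forall>p\<in>X. g p = Re (i p a) + c"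
      and h: "star a' = a'" "\<forall>p\<in>X. h p = Re (i p a') + c'" by (auto simp: Rg_def)
    have "star (a + a') = a + a'" "\<forall>p\<in>X. g p + h p = Re (i p (a + a')) + (c + c')"
      using g h by (auto simp: star_add characterD[OF i(3)])
    then show "(\<lambda>p. g p + h p) \<in> Rg" unfolding Rg_def by blast
    define e where "e = a * a' + (c' *\<^sub>R a + c *\<^sub>R a')"
    have "star e = e" unfolding e_def scaleC_of_real[symmetric]
      using g h by (simp add: star_add star_mult star_scaleC mult.commute)
    moreover have "\<forall>p\<in>X. g p * h p = Re (i p e) + c * c'"
      using g h im0 by (simp add: e_def characterD[OF i(3)] algebra_simps)
    ultimately show "(\<lambda>p. g p * h p) \<in> Rg" unfolding Rg_def by blast
  next
    fix c :: real
    have "star (0 :: 'b) = 0" using star_scaleC[of 0 0] by (simp add: scaleC_zero_left)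
    then show "(\<lambda>_. c) \<in> Rg" unfolding Rg_def
      using characterD(7)[OF i(3)] by (intro CollectI exI[of _ 0] exI[of _ c]) simp
  next
    fix p q assume pq: "p \<in> X" "q \<in> X" "p \<noteq> q"
    then have "i p \<noteq> i q" using i(2) by metis
    then obtain d where d: "i p d \<noteq> i q d" by (meson ext)
    obtain h k where hk: "star h = h" "star k = k" "d = h + scaleC \<i> k" by (rule self_adjoint_decomposition)
    have "i p h \<noteq> i q h \<or> i p k \<noteq> i q k"
      using d unfolding hk(3) by (auto simp: characterD[OF i(3)[OF pq(1)]] characterD[OF i(3)[OF pq(2)]])
    then obtain a where a: "star a = a" "i p a \<noteq> i q a" using hk by blast
    then have "Re (i p a) \<noteq> Re (i q a)" using im0 pq by (simp add: complex_eq_iff)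
    moreover have "(\<lambda>p. Re (i p a)) \<in> Rg" unfolding Rg_def
      by (rule CollectI, rule exI[of _ a], rule exI[of _ 0]) (simp add: a)
    ultimately show "\<exists>f\<in>Rg. f p \<noteq> f q" by (intro bexI[of _ "\<lambda>p. Re (i p a)"])
  qed
  have approx: "\<exists>a. star a = a \<and> (\<forall>t\<in>spectrum. cmod (t a - of_real (f (j t))) < 2 * e)" if e: "e > 0" for e
  proof -
    obtain g where g: "g \<in> Rg" "\<forall>p\<in>X. \<bar>F p - g p\<bar> < e" using Stone_Weierstrass_basic[OF Fc e] by blast
    obtain a c where a: "star a = a" "\<forall>p\<in>X. g p = Re (i p a) + c" using g(1) by (auto simp: Rg_def)
    \<comment> \<open>At the point at infinity the approximation reads \<open>|0 - c| < e\<close>.\<close>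
    have "\<bar>c\<bar> < e" using g(2) a(2) oX i(1)[OF z] by (auto simp: F_def orig_def)
    have "cmod (t a - of_real (f (j t))) < 2 * e" if t: "t \<in> spectrum" for t
    proof -
      have tc: "t \<in> characters" and tX: "j t \<in> X" "j t \<noteq> orig"
        using t o_notin by (auto simp: characters_eq XS)
      have "t a - of_real (f (j t)) = of_real (Re (t a) - F (j t))"
        using character_real_on_self_adjoint[OF tc a(1)] tX(2) by (simp add: F_def complex_eq_iff)
      then have "cmod (t a - of_real (f (j t))) = \<bar>Re (t a) - F (j t)\<bar>" by (simp only: norm_of_real)
      moreover have "\<bar>F (j t) - (Re (t a) + c)\<bar> < e" using g(2) a(2) tX(1) i(1)[OF tc] by metis
      ultimately show ?thesis using \<open>\<bar>c\<bar> < e\<close> by linarith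
    qed
    then show ?thesis using a(1) by blast
  qed
  have "\<exists>a. star a = a \<and> (\<forall>t\<in>spectrum. cmod (t a - of_real (f (j t))) < 2 * (1 / real (Suc n)))" for n
    by (rule approx) simp
  then obtain a where a: "\<And>n. star (a n) = a n"
    "\<And>n t. t \<in> spectrum \<Longrightarrow> cmod (t (a n) - of_real (f (j t))) < 2 * (1 / real (Suc n))" by metis
  have "Cauchy a"
  proof (rule metric_CauchyI)
    fix e :: real assume "e > 0"
    then obtain N where N: "1 / real (Suc N) < e / 5" using nat_approx_posE[of "e/5"] by auto
    have bd: "cmod (t (a n) - of_real (f (j t))) \<le> 2 * (e / 5)" if t: "t \<in> spectrum" and n: "n \<ge> N" for t n
    proof -
      have "1 / real (Suc n) \<le> 1 / real (Suc N)" using n by (intro divide_left_mono) auto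
      then show ?thesis using a(2)[OF t, of n] N by linarith
    qed
    show "\<exists>N. \<forall>n\<ge>N. \<forall>k\<ge>N. dist (a n) (a k) < e"
    proof (intro exI allI impI)
      fix n k assume nk: "n \<ge> N" "k \<ge> N"
      have "norm (a n - a k) \<le> 4 * (e / 5)"
      proof (rule norm_le_if_characters_le)
        fix t :: "'b \<Rightarrow> complex" assume t: "t \<in> spectrum"
        have "t (a n - a k) = (t (a n) - of_real (f (j t))) - (t (a k) - of_real (f (j t)))"
          using t by (simp add: characters_eq characterD(6))
        then show "cmod (t (a n - a k)) \<le> 4 * (e / 5)"
          using norm_triangle_ineq4[of "t (a n) - of_real (f (j t))" "t (a k) - of_real (f (j t))"]
            bd[OF t nk(1)] bd[OF t nk(2)] by simp
      qed (use \<open>e > 0\<close> in simp)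
      then show "dist (a n) (a k) < e" using \<open>e > 0\<close> by (simp add: dist_norm)
    qed
  qed
  then obtain a' where lim: "a \<longlonglongrightarrow> a'" using Cauchy_convergent_iff convergent_def by blast
  have val: "t a' = of_real (f (j t))" if t: "t \<in> spectrum" for t
  proof (rule LIMSEQ_unique)
    have "bounded_linear t" by (rule bounded_linear_character) (use t in \<open>simp add: characters_eq\<close>)
    then show "(\<lambda>n. t (a n)) \<longlonglongrightarrow> t a'" using lim by (rule bounded_linear.tendsto)
    have "(\<lambda>n. 2 * (1 / real (Suc n))) \<longlonglongrightarrow> 2 * 0"
      using LIMSEQ_inverse_real_of_nat by (intro tendsto_mult tendsto_const) (simp add: inverse_eq_divide)
    then have "(\<lambda>n. 2 * (1 / real (Suc n))) \<longlonglongrightarrow> 0" by simp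
    then show "(\<lambda>n. t (a n)) \<longlonglongrightarrow> of_real (f (j t))"
      by (rule LIM_zero_cancel[OF Lim_null_comparison, rotated])
         (use a(2)[OF t] in \<open>auto intro!: always_eventually less_imp_le\<close>)
  qed
  have "star a' = a'"
  proof (rule eq_if_characters_eq)
    fix t :: "'b \<Rightarrow> complex" assume t: "t \<in> spectrum"
    then show "t (star a') = t a'" using val[OF t] character_star[of t a'] by (simp add: characters_eq)
  qed
  then show ?thesis using that val by blast
qed

section \<open>Extensions with values in the algebra\<close>

text \<open>
  The series \<open>\<Sum>k. 2\<^sup>-\<^sup>k b\<^sub>k\<^sup>* b\<^sub>k / (1 + \<parallel>b\<^sub>k\<parallel>\<^sup>2)\<close> over a dense sequence, scaled down to norm \<open>\<delta>\<close>.
\<close>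

lemma strictly_positive_element:
  fixes b :: "nat \<Rightarrow> 'b::comm_cstar_algebra" and \<delta> :: real
  assumes b: "closure (range b) = UNIV" and \<delta>: "\<delta> > 0"
  obtains e :: 'b where "norm e \<le> \<delta>" "\<And>t. t \<in> spectrum \<Longrightarrow> 0 < Re (t e)"
proof -
  define c where "c k = (1/2) ^ k / (1 + (norm (b k))\<^sup>2)" for k
  have c: "c k > 0" for k by (simp add: c_def add_pos_nonneg)
  define u where "u k = c k *\<^sub>R (star (b k) * b k)" for k
  have un: "norm (u k) \<le> (1/2) ^ k" for k
  proof -
    have "norm (u k) = (1/2) ^ k * ((norm (b k))\<^sup>2 / (1 + (norm (b k))\<^sup>2))"
      using c[of k] by (simp add: u_def cstar_identity c_def)
    also have "\<dots> \<le> (1/2) ^ k * 1" by (intro mult_left_mono) (auto simp: divide_le_eq_1 add_pos_nonneg)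
    finally show ?thesis by simp
  qed
  have su: "summable u"
    by (rule summable_comparison_test'[of "\<lambda>k. (1/2::real) ^ k"]) (use un in \<open>auto intro: summable_geometric\<close>)
  define e where "e = suminf u"
  have pos: "0 < Re (t e)" if t: "t \<in> spectrum" for t
  proof -
    have tc: "t \<in> characters" using t by (simp add: characters_eq)
    note T = characterD[OF tc]
    have tu: "Re (t (u k)) = c k * (cmod (t (b k)))\<^sup>2" for k
    proof -
      have "t (star (b k) * b k) = of_real ((cmod (t (b k)))\<^sup>2)"
        unfolding complex_norm_square by (simp add: T character_star[OF tc] mult.commute)
      then show ?thesis by (simp add: u_def T(4))
    qed
    have "(\<lambda>k. Re (t (u k))) sums Re (t e)"
      unfolding e_def by (intro sums_Re bounded_linear.sums[OF bounded_linear_character[OF tc]] summable_sums su)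
    then have s: "(\<lambda>k. c k * (cmod (t (b k)))\<^sup>2) sums Re (t e)" unfolding tu .
    have "\<exists>k. t (b k) \<noteq> 0"
    proof (rule ccontr)
      assume n: "\<not> ?thesis"
      have "closed {x. t x = 0}"
        by (intro closed_Collect_eq linear_continuous_on bounded_linear_character tc continuous_on_const)
      moreover have "range b \<subseteq> {x. t x = 0}" using n by auto
      ultimately have "closure (range b) \<subseteq> {x. t x = 0}" by (intro closure_minimal)
      then show False using b t by (auto simp: spectrum_def)
    qed
    then obtain k where "t (b k) \<noteq> 0" ..
    then have "0 < c k * (cmod (t (b k)))\<^sup>2" using c by simp
    then have "0 < (\<Sum>k. c k * (cmod (t (b k)))\<^sup>2)"
      by (intro suminf_pos2[of _ k] sums_summable[OF s]) (use c in \<open>auto simp: less_imp_le\<close>)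
    then show ?thesis using s by (simp add: sums_iff)
  qed
  define r where "r = \<delta> / (norm e + 1)"
  have r: "r > 0" using \<delta> by (simp add: r_def add_nonneg_pos)
  show ?thesis
  proof (rule that[of "r *\<^sub>R e"])
    have "norm (r *\<^sub>R e) = \<delta> * (norm e / (norm e + 1))" using r \<delta> by (simp add: r_def)
    also have "\<dots> \<le> \<delta> * 1" using \<delta> by (intro mult_left_mono) (auto simp: divide_le_eq_1 add_nonneg_pos)
    finally show "norm (r *\<^sub>R e) \<le> \<delta>" by simp
    show "0 < Re (t (r *\<^sub>R e))" if "t \<in> spectrum" for t
      using pos[OF that] r that characterD(4)[of t r e] by (simp add: characters_eq)
  qed
qed

text \<open>
  Composition with \<open>i\<close> moves the data of a balanced seminorm from \<open>V\<close> to \<open>V'\<close>.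
\<close>

lemma balanced_transfer:
  fixes Y :: "'x::real_normed_vector set" and \<phi> :: "'x \<Rightarrow> 'b::comm_cstar_algebra"
    and i :: "'p::{metric_space,second_countable_topology} \<Rightarrow> 'b \<Rightarrow> complex"
  assumes Y: "subspace Y" and bal: "balanced V m Y \<phi>" and i: "continuous_on V' i" "i ` V' \<subseteq> V"
  shows "\<exists>m' C Yc. seminorm_family V' m' C \<and>
      (\<forall>x. \<forall>p\<in>V'. m' x p \<le> m x (i p)) \<and> (\<forall>y\<in>Y. \<forall>p\<in>V'. \<bar>Re (i p (\<phi> y))\<bar> \<le> m' y p) \<and>
      subspace Yc \<and> Y \<inter> Yc = {0} \<and> closure {y + z |y z. y \<in> Y \<and> z \<in> Yc} = UNIV \<and>
      (\<forall>p\<in>V'. locally_finite_at V' m' Y Yc p)"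
proof -
  obtain m' where sem: "cone_seminorm V m'" and le: "dominates_seminorm V m m'"
    and fin: "locally_finite V m' Y" and dom: "dominates_map V m' Y \<phi>"
    using bal unfolding balanced_def by blast
  obtain C Yc where C': "\<forall>x. \<forall>t\<in>V. m' x t \<le> C * norm x"
    and Yc: "subspace Yc" "Y \<inter> Yc = {0}" "closure {y + z |y z. y \<in> Y \<and> z \<in> Yc} = UNIV"
    and alt: "\<forall>t0\<in>V.
         (\<forall>x\<in>Yc. \<forall>\<epsilon>>0. \<exists>U. neighbourhood_in V t0 U \<and> (\<forall>t\<in>U. m' x t < \<epsilon>)) \<or>
         (\<exists>F L U. subspace F \<and> F \<subseteq> Y \<and> (\<exists>D. finite D \<and> F = span D) \<and>
            subspace L \<and> L \<subseteq> Y \<and> F \<inter> L = {0} \<and> {u + v |u v. u \<in> F \<and> v \<in> L} = Y \<and>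
            neighbourhood_in V t0 U \<and> (\<forall>y\<in>L. \<forall>t\<in>U. m' y t = 0))"
    using fin unfolding locally_finite_def by (elim exE conjE) (rule that)
  have C: "m' x t \<le> C * norm x" if "t \<in> V" for x t using C' that by blast
  have iV: "i p \<in> V" if "p \<in> V'" for p using i(2) that by blast
  define n where "n x p = m' x (i p)" for x p
  have nb: "\<exists>U'. openin (top_of_set V') U' \<and> p \<in> U' \<and> i ` U' \<subseteq> U"
    if p: "p \<in> V'" and U: "neighbourhood_in V (i p) U" for p U
  proof -
    obtain W where W: "openin (top_of_set V) W" "i p \<in> W" "W \<subseteq> U" using U unfolding neighbourhood_in_def by blast
    have "openin (top_of_set V') (V' \<inter> i -` W)"
      by (rule continuous_openin_preimage[OF i(1) _ W(1)]) (use i(2) in blast)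
    then show ?thesis using p W by (intro exI[of _ "V' \<inter> i -` W"]) auto
  qed
  have "seminorm_family V' n C"
  proof
    show "lower_semicontinuous_on V' (n x)" for x
      unfolding n_def using sem by (intro lower_semicontinuous_on_compose[OF _ i]) (auto simp: cone_seminorm_def cone_def)
  qed (use sem C iV in \<open>auto simp: n_def cone_seminorm_def\<close>)
  moreover have "\<bar>Re (i p (\<phi> y))\<bar> \<le> n y p" if "y \<in> Y" "p \<in> V'" for y p
  proof -
    have "cmod (i p (\<phi> y)) \<le> n y p"
      using dom iV that by (simp add: dominates_map_def gelfand_def n_def)
    then show ?thesis using abs_Re_le_cmod[of "i p (\<phi> y)"] by linarith
  qed
  moreover have "locally_finite_at V' n Y Yc p" if p: "p \<in> V'" for p
    using bspec[OF alt iV[OF p]]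
  proof (elim disjE)
    assume small: "\<forall>x\<in>Yc. \<forall>\<epsilon>>0. \<exists>U. neighbourhood_in V (i p) U \<and> (\<forall>t\<in>U. m' x t < \<epsilon>)"
    have "\<exists>U. openin (top_of_set V') U \<and> p \<in> U \<and> (\<forall>t\<in>U. n x t < \<eta>)" if x: "x \<in> Yc" "\<eta> > 0" for x \<eta>
    proof -
      obtain U where U: "neighbourhood_in V (i p) U" "\<forall>t\<in>U. m' x t < \<eta>" using small x by blast
      show ?thesis using nb[OF p U(1)] U(2) unfolding n_def by blast
    qed
    then show ?thesis unfolding locally_finite_at_def by blast
  next
    assume "\<exists>F L U. subspace F \<and> F \<subseteq> Y \<and> (\<exists>D. finite D \<and> F = span D) \<and>
            subspace L \<and> L \<subseteq> Y \<and> F \<inter> L = {0} \<and> {u + v |u v. u \<in> F \<and> v \<in> L} = Y \<and>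
            neighbourhood_in V (i p) U \<and> (\<forall>y\<in>L. \<forall>t\<in>U. m' y t = 0)"
    then obtain D L U where D: "finite D" and L: "subspace L" and sum: "{u + v |u v. u \<in> span D \<and> v \<in> L} = Y"
      and U: "neighbourhood_in V (i p) U" and null: "\<forall>y\<in>L. \<forall>t\<in>U. m' y t = 0" by blast
    have "span L = L" using L by (simp add: span_eq_iff)
    then have "span (L \<union> D) = {x + y |x y. x \<in> L \<and> y \<in> span D}" unfolding span_Un by (simp only:)
    also have "\<dots> = {u + v |u v. u \<in> span D \<and> v \<in> L}" by (auto; metis add.commute)
    finally have YLD: "Y = span (L \<union> D)" using sum by simp
    obtain U' where U': "openin (top_of_set V') U'" "p \<in> U'" "i ` U' \<subseteq> U" using nb[OF p U] by blast
    have "\<forall>l\<in>L. \<forall>t\<in>U'. n l t = 0" using null U'(3) unfolding n_def by blast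
    then show ?thesis unfolding locally_finite_at_def using U'(1,2) L D YLD by blast
  qed
  moreover have "n x p \<le> m x (i p)" if "p \<in> V'" for x p
    using le iV[OF that] by (simp add: dominates_seminorm_def n_def)
  ultimately show ?thesis using Yc by blast
qed

theorem lemma1:
  fixes Y :: "'x::real_normed_vector set"
    and \<phi> :: "'x \<Rightarrow> 'b::comm_cstar_algebra"
    and m :: "'x \<Rightarrow> ('b \<Rightarrow> complex) \<Rightarrow> real"
    and \<delta> :: real
  assumes "separable_space (euclidean :: 'b topology)"
    and "separable_space (euclidean :: 'x topology)"
    and "subspace Y" and "closed Y"
    and "bounded_real_linear_on Y \<phi>" and "\<phi> ` Y \<subseteq> self_adjoint"
    and "cone_seminorm spectrum m"
    and "dominates_map spectrum m Y \<phi>"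
    and "locally_balanced m Y \<phi>"
    and "\<delta> > 0"
  shows "\<exists>\<psi> :: 'x \<Rightarrow> 'b. linear \<psi> \<and> range \<psi> \<subseteq> self_adjoint \<and> (\<forall>y\<in>Y. \<psi> y = \<phi> y) \<and>
           (\<forall>x. \<forall>t\<in>spectrum. cmod (gelfand (\<psi> x) t) \<le> m x t + \<delta> * norm x)"
proof -
  obtain b :: "nat \<Rightarrow> 'b" where b: "closure (range b) = UNIV" by (rule separable_dense_sequence[OF assms(1)])
  obtain q :: "nat \<Rightarrow> 'x" where q: "closure (range q) = UNIV" by (rule separable_dense_sequence[OF assms(2)])
  define j where "j t k = t (b k)" for t :: "'b \<Rightarrow> complex" and k
  have j_eq: "(\<lambda>t k. t (b k)) = j" by (simp add: j_def fun_eq_iff)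
  have j_apply: "(\<lambda>k. t (b k)) = j t" for t by (simp add: j_def fun_eq_iff)
  define S where "S = j ` spectrum"
  obtain i where hom0: "homeomorphism characters (j ` characters) j i"
    using characters_homeomorphic_image[OF b] unfolding j_eq by blast
  have hom: "homeomorphism spectrum S j i"
    by (rule homeomorphism_of_subsets[OF hom0]) (auto simp: characters_eq S_def)
  have i: "i (j t) = t" if "t \<in> spectrum" for t by (rule homeomorphism_apply1[OF hom that])
  have iS: "i p \<in> spectrum" if "p \<in> S" for p using that i by (auto simp: S_def)
  have ic: "continuous_on S i" and jc: "continuous_on characters j"
    using hom hom0 by (auto simp: homeomorphism_def)
  have ch: "t \<in> characters" if "t \<in> spectrum" for t using that by (simp add: characters_eq)
  obtain e :: 'b where e: "norm e \<le> \<delta>" "\<And>t. t \<in> spectrum \<Longrightarrow> 0 < Re (t e)"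
    by (rule strictly_positive_element[OF b assms(10)]) (rule that, auto)
  have ival: "continuous_on S (\<lambda>p. Re (i p a))" for a
    by (intro continuous_intros continuous_on_product_then_coordinatewise[OF ic])
  have loc: "\<exists>V m' C Yc. openin (top_of_set S) V \<and> p \<in> V \<and> seminorm_family V m' C \<and>
      (\<forall>x. \<forall>p\<in>V. m' x p \<le> m x (i p)) \<and> (\<forall>y\<in>Y. \<forall>p\<in>V. \<bar>Re (i p (\<phi> y))\<bar> \<le> m' y p) \<and>
      subspace Yc \<and> Y \<inter> Yc = {0} \<and> closure {y + z |y z. y \<in> Y \<and> z \<in> Yc} = UNIV \<and>
      (\<forall>p\<in>V. locally_finite_at V m' Y Yc p)" if p: "p \<in> S" for p
  proof -
    obtain V where V: "neighbourhood_in spectrum (i p) V" "balanced V m Y \<phi>"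
      using assms(9) iS[OF p] unfolding locally_balanced_def by blast
    obtain W where W: "openin (top_of_set spectrum) W" "i p \<in> W" "W \<subseteq> V"
      using V(1) unfolding neighbourhood_in_def by blast
    define V' where "V' = S \<inter> i -` W"
    have oV': "openin (top_of_set S) V'" unfolding V'_def
      by (rule continuous_openin_preimage[OF ic _ W(1)]) (use iS in blast)
    have "continuous_on V' i" by (rule continuous_on_subset[OF ic]) (simp add: V'_def)
    moreover have "i ` V' \<subseteq> V" using W(3) by (auto simp: V'_def)
    ultimately have loc_V: "\<exists>m' C Yc. seminorm_family V' m' C \<and>
      (\<forall>x. \<forall>p\<in>V'. m' x p \<le> m x (i p)) \<and> (\<forall>y\<in>Y. \<forall>p\<in>V'. \<bar>Re (i p (\<phi> y))\<bar> \<le> m' y p) \<and>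
      subspace Yc \<and> Y \<inter> Yc = {0} \<and> closure {y + z |y z. y \<in> Y \<and> z \<in> Yc} = UNIV \<and>
      (\<forall>p\<in>V'. locally_finite_at V' m' Y Yc p)"
      by (rule balanced_transfer[OF assms(3) V(2)])
    have "p \<in> V'" using p W(2) by (simp add: V'_def)
    with loc_V oV' show ?thesis by (intro exI[of _ V']) (simp only: simp_thms ex_simps)
  qed
  obtain \<psi> where \<psi>: "\<And>p. p \<in> S \<Longrightarrow> linear (\<lambda>x. \<psi> x p)" "\<And>x. continuous_on S (\<psi> x)"
    "\<And>y p. y \<in> Y \<Longrightarrow> p \<in> S \<Longrightarrow> \<psi> y p = Re (i p (\<phi> y))"
    "\<And>x p. p \<in> S \<Longrightarrow> \<bar>\<psi> x p\<bar> \<le> m x (i p) + Re (i p e) * norm x"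
  proof (rule locally_balanced_extension[OF q assms(3), of S "\<lambda>y p. Re (i p (\<phi> y))" "\<lambda>p. Re (i p e)"
        "\<lambda>x p. m x (i p)"])
    show "linear_over Y (\<lambda>y. Re (i p (\<phi> y)))" if "p \<in> S" for p
      using assms(5) characterD[OF ch[OF iS[OF that]]]
      by (auto simp: linear_over_def bounded_real_linear_on_def)
  qed (use ival e(2) iS loc that in auto)
  have bd: "\<bar>\<psi> x (j t)\<bar> \<le> m x t + Re (t e) * norm x" if "t \<in> spectrum" for x t
    using \<psi>(4)[of "j t" x] i[OF that] that by (simp add: S_def)
  have ex: "\<exists>a. star a = a \<and> (\<forall>t\<in>spectrum. t a = of_real (\<psi> x (j t)))" for x
  proof -
    have vanish: "\<exists>K. compact K \<and> K \<subseteq> j ` spectrum \<and> (\<forall>p\<in>j ` spectrum - K. \<bar>\<psi> x p\<bar> < \<epsilon>)" if \<epsilon>: "\<epsilon> > 0" for \<epsilon>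
    proof -
      have "m x \<in> cone spectrum" using assms(7) by (simp add: cone_seminorm_def)
      then have "\<forall>\<epsilon>>0. \<exists>K. compact K \<and> K \<subseteq> spectrum \<and> (\<forall>t\<in>spectrum - K. m x t < \<epsilon>)"
        by (simp add: cone_def)
      then obtain K where K: "compact K" "K \<subseteq> spectrum" "\<forall>t\<in>spectrum - K. m x t < \<epsilon>/2"
        using half_gt_zero[OF \<epsilon>] by blast
      \<comment> \<open>\<open>K'\<close> omits the zero functional and is therefore a compact part of the spectrum.\<close>
      define K' where "K' = characters \<inter> {t. \<epsilon>/2 \<le> Re (t e) * norm x}"
      have "closed {t :: 'b \<Rightarrow> complex. \<epsilon>/2 \<le> Re (t e) * norm x}"
        by (intro closed_Collect_le continuous_intros continuous_on_product_coordinates)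
      then have "compact K'" unfolding K'_def by (rule compact_Int_closed[OF compact_characters])
      have "K' \<subseteq> spectrum" using \<epsilon> by (auto simp: K'_def characters_eq)
      have "continuous_on (K \<union> K') j"
        by (rule continuous_on_subset[OF jc]) (use K(2) in \<open>auto simp: K'_def ch\<close>)
      then have "compact (j ` (K \<union> K'))"
        by (rule compact_continuous_image) (intro compact_Un K(1) \<open>compact K'\<close>)
      moreover have "j ` (K \<union> K') \<subseteq> j ` spectrum" using K(2) \<open>K' \<subseteq> spectrum\<close> by blast
      moreover have "\<bar>\<psi> x p\<bar> < \<epsilon>" if p: "p \<in> j ` spectrum - j ` (K \<union> K')" for p
      proof -
        obtain t where t: "t \<in> spectrum" "t \<notin> K" "t \<notin> K'" "p = j t" using p by blast
        have "m x t < \<epsilon>/2" "Re (t e) * norm x < \<epsilon>/2" using t K(3) ch[OF t(1)] by (auto simp: K'_def)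
        then show ?thesis using bd[OF t(1), of x] unfolding t(4) by linarith
      qed
      ultimately show ?thesis by blast
    qed
    obtain a where "star a = a" "\<And>t. t \<in> spectrum \<Longrightarrow> t a = of_real (\<psi> x (j t))"
    proof (rule gelfand_surjective[OF b, of "\<psi> x", unfolded j_eq j_apply])
      show "continuous_on (j ` spectrum) (\<psi> x)" using \<psi>(2)[of x] by (simp add: S_def)
    qed (use vanish that in auto)
    then show ?thesis by blast
  qed
  then obtain \<Psi> where \<Psi>: "\<And>x. star (\<Psi> x) = \<Psi> x" "\<And>x t. t \<in> spectrum \<Longrightarrow> t (\<Psi> x) = of_real (\<psi> x (j t))"
    by metis
  have jS: "j t \<in> S" if "t \<in> spectrum" for t using that by (simp add: S_def)
  have "linear \<Psi>"
  proof (rule linearI)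
    show "\<Psi> (x + y) = \<Psi> x + \<Psi> y" for x y
      by (rule eq_if_characters_eq)
         (simp add: \<Psi>(2) characterD[OF ch] linear_add[OF \<psi>(1)[OF jS]])
    show "\<Psi> (r *\<^sub>R x) = r *\<^sub>R \<Psi> x" for r x
      by (rule eq_if_characters_eq)
         (simp add: \<Psi>(2) characterD[OF ch] linear_scale[OF \<psi>(1)[OF jS]] scaleR_conv_of_real)
  qed
  moreover have "range \<Psi> \<subseteq> self_adjoint" using \<Psi>(1) by (auto simp: self_adjoint_def)
  moreover have "\<Psi> y = \<phi> y" if y: "y \<in> Y" for y
  proof (rule eq_if_characters_eq)
    fix t :: "'b \<Rightarrow> complex" assume t: "t \<in> spectrum"
    have "star (\<phi> y) = \<phi> y" using assms(6) y by (auto simp: self_adjoint_def)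
    then have "Im (t (\<phi> y)) = 0" by (rule character_real_on_self_adjoint[OF ch[OF t]])
    then show "t (\<Psi> y) = t (\<phi> y)"
      using \<psi>(3)[OF y jS[OF t]] i[OF t] by (simp add: \<Psi>(2)[OF t] complex_eq_iff)
  qed
  moreover have "cmod (gelfand (\<Psi> x) t) \<le> m x t + \<delta> * norm x" if t: "t \<in> spectrum" for x t
  proof -
    have "Re (t e) \<le> \<delta>"
      using complex_Re_le_cmod[of "t e"] character_contractive[OF ch[OF t], of e] e(1) by linarith
    then have "Re (t e) * norm x \<le> \<delta> * norm x" by (rule mult_right_mono) simp
    then show ?thesis using bd[OF t, of x] by (simp add: gelfand_def \<Psi>(2)[OF t])
  qed
  ultimately show ?thesis by blast
qed

end
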